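(* Let $K$ be a field, let $P=K[x_1,\dots,x_n]$, and let $\mathfrak{M}=\langle x_1,\dots,x_n\rangle$. Let $Z=(z_1,\dots,z_s)$ be a tuple of distinct indeterminates in $X=(x_1,\dots,x_n)$, let $\widehat{P}=K[X\setminus Z]$ be the polynomial ring in the remaining indeterminates, and let $I\subseteq\mathfrak{M}$ be an ideal of $P$ such that the following conditions are satisfied. (1) The ideal $I$ is $Z$-separating. (2) The ring $P_{\mathfrak{M}}/I_{\mathfrak{M}}$ is a regular local ring. (3) The $K$-vector space $\mathrm{Lin}_{\mathfrak{M}}(I)$ is $s$-dimensional. Then the following claims hold. (a) We have $s=n-\dim(P_{\mathfrak{M}}/I_{\mathfrak{M}})$. (b) We have $I\cap\widehat{P}=\{0\}$. In particular, the $Z$-separating re-embedding $\Phi:\ P/I\longrightarrow\widehat{P}=K[X\setminus Z]$ of $I$ is an isomorphism with a polynomial ring, and the scheme $\mathrm{Spec}(P/I)$ is isomorphic to an $(n-s)$-dimensional affine space over $K$.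
   Context: A term ordering is a multiplicative total well-ordering on the terms (power products) of $P$; $\mathrm{LT}_\sigma(J)$ is the ideal generated by the $\sigma$-leading terms of the nonzero elements of an ideal $J$. The ideal $I\subseteq\mathfrak{M}$ is called $Z$-separating if there exist a term ordering $\sigma$ and $f_1,\dots,f_s\in I\setminus\{0\}$ such that $\mathrm{LT}_\sigma(\langle f_1,\dots,f_s\rangle)=\langle z_1,\dots,z_s\rangle$; such a $\sigma$ is called a $Z$-separating term ordering for $I$. The linear part $\mathrm{Lin}_{\mathfrak{M}}(I)$ is the $K$-vector space spanned by the homogeneous components of degree one of the elements of $I$ (if $I=\langle g_1,\dots,g_r\rangle$, it is spanned by the degree one components of $g_1,\dots,g_r$). For a $Z$-separating term ordering $\sigma$ for $I$, the reduced $\sigma$-Gröbner basis of $I$ has the form $\{z_1-h_1,\dots,z_s-h_s,g_1,\dots,g_t\}$ with $h_i,g_j\in\widehat{P}$. The $Z$-separating re-embedding of $I$ is the $K$-algebra isomorphism $\Phi:P/I\to\widehat{P}/(I\cap\widehat{P})$ given by $\Phi(\bar x_i)=\bar x_i$ for $x_i\notin Z$ and $\Phi(\bar x_i)=\bar h_j$ for $x_i=z_j\in Z$; it does not depend on the choice of $\sigma$. *)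

theory Defs
  imports
    "HOL-Analysis.Abstract_Topology"
    "HOL-Algebra.QuotRing"
    "HOL-Algebra.Ring_Divisibility"
    "HOL-Library.Poly_Mapping"
    "HOL-Library.Extended_Nat"
begin

section \<open>Commutative algebra over ring records\<close>

subsection \<open>Localization\<close>

text \<open>
  The fraction $a/b$ in $S^{-1}R$ is the class of $(a,b)$ under
  $(a,b) \sim (c,d)$ iff $t(ad - bc) = 0$ for some $t \in S$.
\<close>

definition fraction :: "('a, 'm) ring_scheme \<Rightarrow> 'a set \<Rightarrow> 'a \<Rightarrow> 'a \<Rightarrow> ('a \<times> 'a) set" where
  "fraction R S a b = {(c, d). c \<in> carrier R \<and> d \<in> S \<and>
     (\<exists>t\<in>S. t \<otimes>\<^bsub>R\<^esub> (a \<otimes>\<^bsub>R\<^esub> d \<ominus>\<^bsub>R\<^esub> b \<otimes>\<^bsub>R\<^esub> c) = \<zero>\<^bsub>R\<^esub>)}"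

definition localization :: "('a, 'm) ring_scheme \<Rightarrow> 'a set \<Rightarrow> ('a \<times> 'a) set ring" where
  "localization R S =
    \<lparr>carrier = {fraction R S a b | a b. a \<in> carrier R \<and> b \<in> S},
     monoid.mult = (\<lambda>A B. \<Union>(a, b)\<in>A. \<Union>(c, d)\<in>B. fraction R S (a \<otimes>\<^bsub>R\<^esub> c) (b \<otimes>\<^bsub>R\<^esub> d)),
     one = fraction R S \<one>\<^bsub>R\<^esub> \<one>\<^bsub>R\<^esub>,
     zero = fraction R S \<zero>\<^bsub>R\<^esub> \<one>\<^bsub>R\<^esub>,
     add = (\<lambda>A B. \<Union>(a, b)\<in>A. \<Union>(c, d)\<in>B.
              fraction R S (a \<otimes>\<^bsub>R\<^esub> d \<oplus>\<^bsub>R\<^esub> c \<otimes>\<^bsub>R\<^esub> b) (b \<otimes>\<^bsub>R\<^esub> d))\<rparr>"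

definition localization_at :: "('a, 'm) ring_scheme \<Rightarrow> 'a set \<Rightarrow> ('a \<times> 'a) set ring" where
  "localization_at R p = localization R (carrier R - p)"

definition extended_ideal_at :: "('a, 'm) ring_scheme \<Rightarrow> 'a set \<Rightarrow> 'a set \<Rightarrow> ('a \<times> 'a) set set" where
  "extended_ideal_at R p I =
     Idl\<^bsub>localization_at R p\<^esub> ((\<lambda>f. fraction R (carrier R - p) f \<one>\<^bsub>R\<^esub>) ` I)"


subsection \<open>Krull dimension and regular local rings\<close>

definition krull_dim :: "('a, 'm) ring_scheme \<Rightarrow> enat" where
  "krull_dim R = Sup {enat k | k. \<exists>p :: nat \<Rightarrow> 'a set.
     (\<forall>i\<le>k. primeideal (p i) R) \<and> (\<forall>i<k. p i \<subset> p (Suc i))}"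

definition num_generators :: "('a, 'm) ring_scheme \<Rightarrow> 'a set \<Rightarrow> nat" where
  "num_generators R I = (LEAST k. \<exists>A \<subseteq> carrier R. finite A \<and> card A = k \<and> I = Idl\<^bsub>R\<^esub> A)"

text \<open>
  A regular local ring is a Noetherian local ring whose maximal ideal is minimally generated by
  as many elements as the Krull dimension of the ring.
\<close>

definition regular_local_ring :: "('a, 'm) ring_scheme \<Rightarrow> bool" where
  "regular_local_ring R \<longleftrightarrow> cring R \<and> noetherian_ring R \<and> (\<exists>!m. maximalideal m R) \<and>
     (\<forall>m. maximalideal m R \<longrightarrow> enat (num_generators R m) = krull_dim R)"


subsection \<open>Algebras over a field\<close>

text \<open>
  A $K$-algebra is given by a ring together with its structure map
  $K \to R$, where $K$ is the type \<open>'k\<close>.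
\<close>

definition alg_iso ::
  "('a, 'm) ring_scheme \<Rightarrow> ('k \<Rightarrow> 'a) \<Rightarrow> ('b, 'l) ring_scheme \<Rightarrow> ('k \<Rightarrow> 'b) \<Rightarrow> ('a \<Rightarrow> 'b) set" where
  "alg_iso R \<iota> S \<kappa> = {f \<in> ring_iso R S. \<forall>c. f (\<iota> c) = \<kappa> c}"


section \<open>Affine schemes over a field\<close>

text \<open>
  A topological space with a sheaf of $K$-algebras: \<open>sections U\<close> is the ring of sections over the
  open set \<open>U\<close>, \<open>restr U V\<close> the restriction map for \<open>V \<subseteq> U\<close>, and \<open>const U\<close> the structure map
  $K \to \mathcal{O}(U)$.  For the locally ringed spaces below the latter is the same datum as a
  morphism to $\mathrm{Spec}(K)$.
\<close>

record ('p, 's, 'k) ringed_space =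
  pts :: "'p topology"
  sections :: "'p set \<Rightarrow> 's ring"
  restr :: "'p set \<Rightarrow> 'p set \<Rightarrow> 's \<Rightarrow> 's"
  const :: "'p set \<Rightarrow> 'k \<Rightarrow> 's"

text \<open>
  An isomorphism $(f, f^\#)$ consists of a homeomorphism $f : X \to Y$ and an isomorphism of sheaves
  of $K$-algebras $f^\# : \mathcal{O}_Y \to f_* \mathcal{O}_X$; for such a pair the induced maps on
  stalks are isomorphisms, hence local.
\<close>

definition ringed_space_iso ::
  "('p, 's, 'k) ringed_space \<Rightarrow> ('q, 't, 'k) ringed_space \<Rightarrow>
   ('p \<Rightarrow> 'q) \<Rightarrow> ('q set \<Rightarrow> 't \<Rightarrow> 's) \<Rightarrow> bool" where
  "ringed_space_iso X Y f \<phi> \<longleftrightarrow>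
     (let pre = (\<lambda>V. {x \<in> topspace (pts X). f x \<in> V}) in
      homeomorphic_map (pts X) (pts Y) f \<and>
      (\<forall>V. openin (pts Y) V \<longrightarrow>
         \<phi> V \<in> alg_iso (sections Y V) (const Y V) (sections X (pre V)) (const X (pre V))) \<and>
      (\<forall>V W. openin (pts Y) V \<and> openin (pts Y) W \<and> W \<subseteq> V \<longrightarrow>
         (\<forall>t \<in> carrier (sections Y V).
            restr X (pre V) (pre W) (\<phi> V t) = \<phi> W (restr Y V W t))))"

definition isomorphic_schemes ::
  "('p, 's, 'k) ringed_space \<Rightarrow> ('q, 't, 'k) ringed_space \<Rightarrow> bool" where
  "isomorphic_schemes X Y \<longleftrightarrow> (\<exists>f \<phi>. ringed_space_iso X Y f \<phi>)"

definition zariski :: "('a, 'm) ring_scheme \<Rightarrow> 'a set topology" where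
  "zariski R = topology (\<lambda>U. \<exists>A \<subseteq> carrier R. U = {p. primeideal p R \<and> \<not> A \<subseteq> p})"

lemma istopology_zariski:
  "istopology (\<lambda>U. \<exists>A \<subseteq> carrier R. U = {p. primeideal p R \<and> \<not> A \<subseteq> p})"
  (is "istopology ?L")
  unfolding istopology_def
proof (intro conjI allI impI)
  fix U V assume "?L U" "?L V"
  then obtain A B where A: "A \<subseteq> carrier R" "U = {p. primeideal p R \<and> \<not> A \<subseteq> p}"
    and B: "B \<subseteq> carrier R" "V = {p. primeideal p R \<and> \<not> B \<subseteq> p}"
    by auto
  let ?C = "{a \<otimes>\<^bsub>R\<^esub> b | a b. a \<in> A \<and> b \<in> B} \<inter> carrier R"
  have "U \<inter> V = {p. primeideal p R \<and> \<not> ?C \<subseteq> p}"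
  proof (intro Set.set_eqI iffI)
    fix p assume p: "p \<in> U \<inter> V"
    then obtain a b where ab: "a \<in> A" "a \<notin> p" "b \<in> B" "b \<notin> p" and pr: "primeideal p R"
      using A B by auto
    interpret primeideal p R by (fact pr)
    have "a \<otimes>\<^bsub>R\<^esub> b \<in> ?C" "a \<otimes>\<^bsub>R\<^esub> b \<notin> p"
      using ab A(1) B(1) I_prime by blast+
    then show "p \<in> {p. primeideal p R \<and> \<not> ?C \<subseteq> p}"
      using pr by blast
  next
    fix p assume "p \<in> {p. primeideal p R \<and> \<not> ?C \<subseteq> p}"
    then obtain a b where ab: "a \<in> A" "b \<in> B" "a \<otimes>\<^bsub>R\<^esub> b \<notin> p" and pr: "primeideal p R"
      by auto
    interpret primeideal p R by (fact pr)
    have "a \<notin> p" "b \<notin> p"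
      using ab A(1) B(1) I_l_closed I_r_closed by blast+
    then show "p \<in> U \<inter> V"
      using ab pr A(2) B(2) by blast
  qed
  then show "?L (U \<inter> V)" by blast
next
  fix \<U> assume "\<forall>U\<in>\<U>. ?L U"
  then obtain F where F: "\<And>U. U \<in> \<U> \<Longrightarrow> F U \<subseteq> carrier R \<and> U = {p. primeideal p R \<and> \<not> F U \<subseteq> p}"
    by metis
  have "\<Union>(F ` \<U>) \<subseteq> carrier R"
    using F by blast
  moreover have "\<Union>\<U> = {p. primeideal p R \<and> \<not> \<Union>(F ` \<U>) \<subseteq> p}"
  proof -
    have "p \<in> U \<longleftrightarrow> primeideal p R \<and> \<not> F U \<subseteq> p" if "U \<in> \<U>" for U p
      using F[OF that] by blast
    then show ?thesis by blast
  qed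
  ultimately show "?L (\<Union>\<U>)" by blast
qed

text \<open>
  Sections over \<open>U\<close> are the families of elements of the stalks $R_p$, $p \in U$, that are locally
  given by a single fraction.
\<close>

definition spec_sections :: "('a, 'm) ring_scheme \<Rightarrow> 'a set set \<Rightarrow> ('a set \<Rightarrow> ('a \<times> 'a) set) ring" where
  "spec_sections R U =
    \<lparr>carrier = {s \<in> (\<Pi>\<^sub>E p\<in>U. carrier (localization_at R p)).
       \<forall>p\<in>U. \<exists>V. openin (zariski R) V \<and> p \<in> V \<and> V \<subseteq> U \<and>
         (\<exists>a \<in> carrier R. \<exists>b \<in> carrier R. \<forall>q\<in>V. b \<notin> q \<and> s q = fraction R (carrier R - q) a b)},
     monoid.mult = (\<lambda>s t. \<lambda>p\<in>U. s p \<otimes>\<^bsub>localization_at R p\<^esub> t p),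
     one = (\<lambda>p\<in>U. \<one>\<^bsub>localization_at R p\<^esub>),
     zero = (\<lambda>p\<in>U. \<zero>\<^bsub>localization_at R p\<^esub>),
     add = (\<lambda>s t. \<lambda>p\<in>U. s p \<oplus>\<^bsub>localization_at R p\<^esub> t p)\<rparr>"

definition Spec ::
  "('a, 'm) ring_scheme \<Rightarrow> ('k \<Rightarrow> 'a) \<Rightarrow> ('a set, 'a set \<Rightarrow> ('a \<times> 'a) set, 'k) ringed_space" where
  "Spec R \<iota> =
    \<lparr>pts = zariski R,
     sections = spec_sections R,
     restr = (\<lambda>U V s. restrict s V),
     const = (\<lambda>U c. \<lambda>p\<in>U. fraction R (carrier R - p) (\<iota> c) \<one>\<^bsub>R\<^esub>)\<rparr>"


section \<open>Polynomial rings\<close>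

text \<open>
  Terms (power products) are exponent vectors; their product is written additively.  The
  indeterminates are indexed by natural numbers, and \<open>poly_ring V\<close> is the polynomial ring in the
  indeterminates $x_i$ with $i \in V$, so that $P$ = \<open>poly_ring {1..n}\<close>.
\<close>

type_synonym pterm = "nat \<Rightarrow>\<^sub>0 nat"
type_synonym 'k mpoly = "pterm \<Rightarrow>\<^sub>0 'k"

definition terms :: "nat set \<Rightarrow> pterm set" where
  "terms V = {t. Poly_Mapping.keys t \<subseteq> V}"

definition poly_ring :: "nat set \<Rightarrow> 'k::field mpoly ring" where
  "poly_ring V = \<lparr>carrier = {f. Poly_Mapping.keys f \<subseteq> terms V},
     monoid.mult = (*), one = 1, zero = 0, add = (+)\<rparr>"

definition cst :: "'k::field \<Rightarrow> 'k mpoly" where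
  "cst c = Poly_Mapping.single 0 c"

definition monomial :: "pterm \<Rightarrow> 'k::field mpoly" where
  "monomial t = Poly_Mapping.single t 1"

definition var :: "nat \<Rightarrow> 'k::field mpoly" where
  "var i = monomial (Poly_Mapping.single i 1)"

abbreviation P_ring :: "nat \<Rightarrow> 'k::field mpoly ring" where
  "P_ring n \<equiv> poly_ring {1..n}"

abbreviation P_hat :: "nat \<Rightarrow> nat list \<Rightarrow> 'k::field mpoly ring" where
  "P_hat n Z \<equiv> poly_ring ({1..n} - set Z)"

definition max_ideal :: "nat \<Rightarrow> 'k::field mpoly set" where
  "max_ideal n = Idl\<^bsub>P_ring n\<^esub> (var ` {1..n})"

abbreviation quot_const :: "'k::field mpoly ring \<Rightarrow> 'k mpoly set \<Rightarrow> 'k \<Rightarrow> 'k mpoly set" where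
  "quot_const R I \<equiv> (\<lambda>c. I +>\<^bsub>R\<^esub> cst c)"

text \<open>The ring $P_{\mathfrak{M}} / I_{\mathfrak{M}}$.\<close>

definition local_ring_at_origin ::
  "nat \<Rightarrow> 'k::field mpoly set \<Rightarrow> ('k mpoly \<times> 'k mpoly) set set ring" where
  "local_ring_at_origin n I =
     localization_at (P_ring n) (max_ideal n) Quot extended_ideal_at (P_ring n) (max_ideal n) I"

definition affine_space ::
  "nat \<Rightarrow> ('k::field mpoly set, 'k mpoly set \<Rightarrow> ('k mpoly \<times> 'k mpoly) set, 'k) ringed_space" where
  "affine_space m = Spec (poly_ring {1..m}) cst"


subsection \<open>Linear parts\<close>

definition term_deg :: "pterm \<Rightarrow> nat" where
  "term_deg t = (\<Sum>i\<in>Poly_Mapping.keys t. Poly_Mapping.lookup t i)"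

definition homog_comp :: "nat \<Rightarrow> 'k::field mpoly \<Rightarrow> 'k mpoly" where
  "homog_comp d f =
     (\<Sum>t | t \<in> Poly_Mapping.keys f \<and> term_deg t = d. Poly_Mapping.single t (Poly_Mapping.lookup f t))"

definition poly_scale :: "'k::field \<Rightarrow> 'k mpoly \<Rightarrow> 'k mpoly" where
  "poly_scale c f = cst c * f"

lemma vector_space_poly_scale: "vector_space (poly_scale :: 'k::field \<Rightarrow> 'k mpoly \<Rightarrow> 'k mpoly)"
  by unfold_locales
    (simp_all add: poly_scale_def cst_def algebra_simps single_add mult_single flip: mult.assoc)

definition Lin :: "'k::field mpoly set \<Rightarrow> 'k mpoly set" where
  "Lin I = module.span poly_scale (homog_comp 1 ` I)"


subsection \<open>Term orderings and Groebner bases\<close>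

text \<open>\<open>(t, u) \<in> \<sigma>\<close> means $t \le_\sigma u$.\<close>

definition term_ordering :: "nat \<Rightarrow> pterm rel \<Rightarrow> bool" where
  "term_ordering n \<sigma> \<longleftrightarrow> well_order_on (terms {1..n}) \<sigma> \<and>
     (\<forall>t u. (t, u) \<in> \<sigma> \<longrightarrow> (\<forall>v \<in> terms {1..n}. (t + v, u + v) \<in> \<sigma>))"

definition lead_term :: "pterm rel \<Rightarrow> 'k::field mpoly \<Rightarrow> pterm" where
  "lead_term \<sigma> f = (THE t. t \<in> Poly_Mapping.keys f \<and> (\<forall>u \<in> Poly_Mapping.keys f. (u, t) \<in> \<sigma>))"

definition LT_ideal :: "nat \<Rightarrow> pterm rel \<Rightarrow> 'k::field mpoly set \<Rightarrow> 'k mpoly set" where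
  "LT_ideal n \<sigma> J = Idl\<^bsub>P_ring n\<^esub> ((\<lambda>f. monomial (lead_term \<sigma> f)) ` (J - {0}))"

definition reduced_groebner_basis ::
  "nat \<Rightarrow> pterm rel \<Rightarrow> 'k::field mpoly set \<Rightarrow> 'k mpoly set \<Rightarrow> bool" where
  "reduced_groebner_basis n \<sigma> I G \<longleftrightarrow>
     finite G \<and> G \<subseteq> I - {0} \<and> LT_ideal n \<sigma> G = LT_ideal n \<sigma> I \<and>
     (\<forall>g\<in>G. Poly_Mapping.lookup g (lead_term \<sigma> g) = 1 \<and>
        (\<forall>g'\<in>G - {g}. \<forall>t\<in>Poly_Mapping.keys g. \<nexists>u. t = lead_term \<sigma> g' + u))"

definition the_reduced_groebner_basis ::
  "nat \<Rightarrow> pterm rel \<Rightarrow> 'k::field mpoly set \<Rightarrow> 'k mpoly set" where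
  "the_reduced_groebner_basis n \<sigma> I = (THE G. reduced_groebner_basis n \<sigma> I G)"


subsection \<open>Separating re-embeddings\<close>

definition separating_term_ordering ::
  "nat \<Rightarrow> nat list \<Rightarrow> 'k::field mpoly set \<Rightarrow> pterm rel \<Rightarrow> bool" where
  "separating_term_ordering n Z I \<sigma> \<longleftrightarrow> term_ordering n \<sigma> \<and>
     (\<exists>fs. length fs = length Z \<and> set fs \<subseteq> I - {0} \<and>
        LT_ideal n \<sigma> (Idl\<^bsub>P_ring n\<^esub> (set fs)) = Idl\<^bsub>P_ring n\<^esub> (var ` set Z))"

definition separating :: "nat \<Rightarrow> nat list \<Rightarrow> 'k::field mpoly set \<Rightarrow> bool" where
  "separating n Z I \<longleftrightarrow> (\<exists>\<sigma>. separating_term_ordering n Z I \<sigma>)"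

text \<open>
  The polynomial $h_j \in \widehat{P}$ such that $z_j - h_j$ is in the reduced Groebner basis;
  it is indexed by the indeterminate $z_j$.
\<close>

definition sep_tail :: "nat \<Rightarrow> nat list \<Rightarrow> 'k::field mpoly set \<Rightarrow> pterm rel \<Rightarrow> nat \<Rightarrow> 'k mpoly" where
  "sep_tail n Z I \<sigma> z =
     (THE h. h \<in> carrier (P_hat n Z) \<and> var z - h \<in> the_reduced_groebner_basis n \<sigma> I)"

abbreviation elim_ideal :: "nat \<Rightarrow> nat list \<Rightarrow> 'k::field mpoly set \<Rightarrow> 'k mpoly set" where
  "elim_ideal n Z I \<equiv> I \<inter> carrier (P_hat n Z)"

definition is_reembedding ::
  "nat \<Rightarrow> nat list \<Rightarrow> 'k::field mpoly set \<Rightarrow> pterm rel \<Rightarrow> ('k mpoly set \<Rightarrow> 'k mpoly set) \<Rightarrow> bool" where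
  "is_reembedding n Z I \<sigma> \<Phi> \<longleftrightarrow>
     \<Phi> \<in> extensional (carrier (P_ring n Quot I)) \<and>
     \<Phi> \<in> alg_iso (P_ring n Quot I) (quot_const (P_ring n) I)
           (P_hat n Z Quot elim_ideal n Z I) (quot_const (P_hat n Z) (elim_ideal n Z I)) \<and>
     (\<forall>i \<in> {1..n} - set Z. \<Phi> (I +>\<^bsub>P_ring n\<^esub> var i) = elim_ideal n Z I +>\<^bsub>P_hat n Z\<^esub> var i) \<and>
     (\<forall>z \<in> set Z. \<Phi> (I +>\<^bsub>P_ring n\<^esub> var z) = elim_ideal n Z I +>\<^bsub>P_hat n Z\<^esub> sep_tail n Z I \<sigma> z)"

definition reembedding ::
  "nat \<Rightarrow> nat list \<Rightarrow> 'k::field mpoly set \<Rightarrow> pterm rel \<Rightarrow> 'k mpoly set \<Rightarrow> 'k mpoly set" where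
  "reembedding n Z I \<sigma> = (THE \<Phi>. is_reembedding n Z I \<sigma> \<Phi>)"

end

theory Submission
  imports Defs
begin

text \<open>
  Let $J = \langle f_1,\dots,f_s\rangle \subseteq I$ be the ideal provided by a $Z$-separating term ordering. Its
  leading terms generate $\langle Z\rangle$, so division by \<open>J\<close> gives $P = J \oplus \widehat{P}$
  (\<open>ex_normal_form\<close>, \<open>J_Int_P'\<close>). Hence $P/J \cong \widehat{P}$, $I = J + (I \cap \widehat{P})$, and \<open>J\<close>
  contains elements $z_i - h_i$ with $h_i \in \widehat{P}$. Their linear parts are linearly independent
  modulo the linear forms of $\widehat{P}$. As $\mathrm{Lin}_{\mathfrak{M}}(I)$ has dimension \<open>s\<close>, every
  element of $I \cap \widehat{P}$ has linear part zero (\<open>elim_linear_part_zero\<close>).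

  Consequently the linear part of the image in $\widehat{P}$ is a derivation at the origin that vanishes on \<open>I\<close>.
  It shows that the maximal ideal of $R = P_{\mathfrak{M}}/I_{\mathfrak{M}}$ needs at least $n - s$ generators
  (\<open>card_generators_ge\<close>), so $\dim R \ge n - s$ by regularity. On the other hand, chains of primes of \<open>R\<close>
  contract to chains of primes of $\widehat{P}$ containing $I \cap \widehat{P}$. Chains of primes in a polynomial
  ring in \<open>m\<close> indeterminates have length at most \<open>m\<close> (\<open>prime_chain_length_le\<close>), so $\dim R = n - s$. If
  $I \cap \widehat{P}$ were nonzero, the zero ideal would prolong a chain of length $n - s$, which is impossible
  (\<open>local_chain_length\<close>, \<open>regular_local_ring_origin\<close>). Thus $I \cap \widehat{P} = 0$ and $I = J$, for
  every $Z$-separating term ordering.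

  The reduced Groebner basis of \<open>J\<close> is $\{z_i - h_i\}$ (\<open>reduced_groebner_basis_unique\<close>), so the
  inverse of $\widehat{P} \to P/J$ is the re-embedding. The statement on schemes follows after renaming the
  indeterminates of $\widehat{P}$ to $x_1,\dots,x_{n-s}$, because isomorphic algebras have isomorphic
  spectra (\<open>isomorphic_Spec\<close>).
\<close>

section \<open>Polynomials as finitely supported functions\<close>

text \<open>
  \<open>f \<cdot> t\<close> is the coefficient of the term \<open>t\<close> in the polynomial \<open>f\<close>; the same notation gives the exponent
  of an indeterminate in a term.
\<close>

notation Poly_Mapping.lookup (infixl "\<cdot>" 100)

(* The exponent in Poly_Mapping.single i 1 and the intervals {1..n} are not to be rewritten to Suc 0. *)
declare One_nat_def [simp del]

interpretation poly_vs: vector_space poly_scale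
  by (rule vector_space_poly_scale)

lemma carrier_poly_ring: "carrier (poly_ring V) = {f. Poly_Mapping.keys f \<subseteq> terms V}"
  by (simp add: poly_ring_def)

lemma poly_ring_ops [simp]:
  "monoid.mult (poly_ring V) = (*)" "one (poly_ring V) = 1"
  "ring.zero (poly_ring V) = 0" "add (poly_ring V) = (+)"
  by (simp_all add: poly_ring_def)

lemma keys_uminus: "Poly_Mapping.keys (- f) = Poly_Mapping.keys (f :: 'a \<Rightarrow>\<^sub>0 'b::ab_group_add)"
  by (auto simp: in_keys_iff)

lemma keys_minus_subset:
  "Poly_Mapping.keys (f - g) \<subseteq> Poly_Mapping.keys f \<union> Poly_Mapping.keys (g :: 'a \<Rightarrow>\<^sub>0 'b::ab_group_add)"
  by (auto simp: in_keys_iff lookup_minus)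

lemma keys_pterm_add: "Poly_Mapping.keys (s + t :: pterm) = Poly_Mapping.keys s \<union> Poly_Mapping.keys t"
  by (auto simp: in_keys_iff lookup_add)

lemma terms_add_iff: "s + t \<in> terms V \<longleftrightarrow> s \<in> terms V \<and> t \<in> terms V"
  by (simp add: terms_def keys_pterm_add)

lemma zero_in_terms [simp]: "0 \<in> terms V"
  by (simp add: terms_def)

lemma single_in_terms: "Poly_Mapping.single i 1 \<in> terms V \<longleftrightarrow> i \<in> V"
  by (simp add: terms_def)

lemma keys_mult_subsetD:
  assumes "u \<in> Poly_Mapping.keys (f * g)"
  obtains a b where "u = a + b" "a \<in> Poly_Mapping.keys f" "b \<in> Poly_Mapping.keys g"
  using assms keys_mult[of f g] by blast

lemma poly_ring_closed:
  assumes "f \<in> carrier (poly_ring V)" "g \<in> carrier (poly_ring V)"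
  shows "f + g \<in> carrier (poly_ring V)" "f * g \<in> carrier (poly_ring V)"
    "- f \<in> carrier (poly_ring V)" "f - g \<in> carrier (poly_ring V)"
proof -
  show "f + g \<in> carrier (poly_ring V)"
    using assms Poly_Mapping.keys_add[of f g] by (auto simp: carrier_poly_ring)
  show "f * g \<in> carrier (poly_ring V)"
    using assms by (force simp: carrier_poly_ring terms_add_iff elim!: keys_mult_subsetD)
  show "- f \<in> carrier (poly_ring V)" "f - g \<in> carrier (poly_ring V)"
    using assms keys_minus_subset[of f g] by (auto simp: carrier_poly_ring keys_uminus)
qed

lemma poly_ring_const_closed [simp]:
  "0 \<in> carrier (poly_ring V)" "1 \<in> carrier (poly_ring V)" "cst c \<in> carrier (poly_ring V)"
  by (auto simp: carrier_poly_ring cst_def)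

lemma monomial_in_carrier: "monomial t \<in> carrier (poly_ring V) \<longleftrightarrow> t \<in> terms V"
  by (simp add: carrier_poly_ring monomial_def)

lemma var_in_carrier: "var i \<in> carrier (poly_ring V) \<longleftrightarrow> i \<in> V"
  using single_in_terms[of i V] by (simp add: var_def monomial_in_carrier)

lemma poly_ring_mono: "V \<subseteq> W \<Longrightarrow> carrier (poly_ring V) \<subseteq> carrier (poly_ring W)"
  by (auto simp: carrier_poly_ring terms_def)

lemma poly_ring_domain: "domain (poly_ring V :: 'k::field mpoly ring)"
proof -
  have "cring (poly_ring V :: 'k mpoly ring)"
    by (rule cringI)
      (unfold_locales, auto simp: poly_ring_closed algebra_simps Units_def
        intro!: bexI[of _ "- _"] poly_ring_closed)
  then show ?thesis
    by (rule domain.intro) (unfold_locales, auto)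
qed

lemma poly_ring_cring: "cring (poly_ring V :: 'k::field mpoly ring)"
  using poly_ring_domain by (rule domain.axioms)

lemma poly_ring_ring: "ring (poly_ring V :: 'k::field mpoly ring)"
  using poly_ring_cring by (rule cring.axioms)

lemma poly_ring_minus:
  assumes "f \<in> carrier (poly_ring V)" "g \<in> carrier (poly_ring V :: 'k::field mpoly ring)"
  shows "f \<ominus>\<^bsub>poly_ring V\<^esub> g = f - g"
proof -
  interpret cring "poly_ring V :: 'k mpoly ring" by (rule poly_ring_cring)
  have "\<ominus>\<^bsub>poly_ring V\<^esub> g = - g"
    by (rule minus_equality) (use assms in \<open>auto simp: poly_ring_closed\<close>)
  then show ?thesis by (simp add: a_minus_def)
qed

text \<open>Ideals of a polynomial ring, in terms of the operations of the type of polynomials.\<close>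

lemma ideal_poly_ringI:
  fixes J :: "'k::field mpoly set"
  assumes "J \<subseteq> carrier (poly_ring V)" "0 \<in> J"
    and "\<And>f g. f \<in> J \<Longrightarrow> g \<in> J \<Longrightarrow> f + g \<in> J"
    and "\<And>f g. f \<in> J \<Longrightarrow> g \<in> carrier (poly_ring V) \<Longrightarrow> g * f \<in> J"
  shows "ideal J (poly_ring V)"
proof -
  interpret cring "poly_ring V :: 'k mpoly ring" by (rule poly_ring_cring)
  have neg: "\<ominus>\<^bsub>poly_ring V\<^esub> f = - f" if "f \<in> carrier (poly_ring V)" for f :: "'k mpoly"
    by (rule minus_equality) (use that in \<open>auto simp: poly_ring_closed\<close>)
  have "- f \<in> J" if "f \<in> J" for f
    using assms(4)[OF that, of "- 1"] poly_ring_closed(3)[of 1 V 1] by simp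
  then have "subgroup J (add_monoid (poly_ring V))"
    using assms neg by (intro add.subgroupI) (auto simp flip: a_inv_def)
  then show ?thesis
    using assms by (intro idealI poly_ring_ring) (auto simp: mult.commute)
qed

lemma ideal_poly_ringD:
  fixes J :: "'k::field mpoly set"
  assumes "ideal J (poly_ring V)"
  shows "J \<subseteq> carrier (poly_ring V)" "0 \<in> J"
    and "f \<in> J \<Longrightarrow> g \<in> J \<Longrightarrow> f + g \<in> J"
    and "f \<in> J \<Longrightarrow> g \<in> J \<Longrightarrow> f - g \<in> J"
    and "f \<in> J \<Longrightarrow> - f \<in> J"
    and "f \<in> J \<Longrightarrow> g \<in> carrier (poly_ring V) \<Longrightarrow> g * f \<in> J"
    and "f \<in> J \<Longrightarrow> g \<in> carrier (poly_ring V) \<Longrightarrow> f * g \<in> J"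
proof -
  interpret ideal J "poly_ring V" by (fact assms)
  show sub: "J \<subseteq> carrier (poly_ring V)" using a_subset .
  show "0 \<in> J" using additive_subgroup.zero_closed[OF additive_subgroup_axioms] by simp
  show add: "f \<in> J \<Longrightarrow> g \<in> J \<Longrightarrow> f + g \<in> J" for f g
    using additive_subgroup.a_closed[OF additive_subgroup_axioms, of f g] by simp
  show lm: "f \<in> J \<Longrightarrow> g \<in> carrier (poly_ring V) \<Longrightarrow> g * f \<in> J" for f g
    using I_l_closed[of f g] by simp
  show "f \<in> J \<Longrightarrow> g \<in> carrier (poly_ring V) \<Longrightarrow> f * g \<in> J"
    using lm by (simp add: mult.commute)
  have neg: "- f \<in> J" if "f \<in> J" for f
    using lm[OF that, of "- 1"] poly_ring_closed(3)[of 1 V 1] by simp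
  then show "f \<in> J \<Longrightarrow> - f \<in> J" .
  show "f - g \<in> J" if "f \<in> J" "g \<in> J"
    using add[OF that(1) neg[OF that(2)]] by simp
qed

lemma ideal_sum_closed:
  fixes J :: "'k::field mpoly set"
  assumes "ideal J (poly_ring V)" and "\<And>x. x \<in> A \<Longrightarrow> f x \<in> J"
  shows "sum f A \<in> J"
  using assms(2)
  by (induction A rule: infinite_finite_induct) (auto simp: ideal_poly_ringD[OF assms(1)])

text \<open>A prime ideal of a polynomial ring, in terms of the operations of the type of polynomials.\<close>

lemma primeideal_poly_ringD:
  fixes p :: "'k::field mpoly set"
  assumes "primeideal p (poly_ring V)"
  shows "ideal p (poly_ring V)" "1 \<notin> p"
    and "f * g \<in> p \<Longrightarrow> f \<in> carrier (poly_ring V) \<Longrightarrow> g \<in> carrier (poly_ring V) \<Longrightarrow> f \<in> p \<or> g \<in> p"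
proof -
  interpret primeideal p "poly_ring V" by (fact assms)
  show "ideal p (poly_ring V)" by unfold_locales
  show "1 \<notin> p" using I_notcarr one_imp_carrier by auto
  show "f * g \<in> p \<Longrightarrow> f \<in> carrier (poly_ring V) \<Longrightarrow> g \<in> carrier (poly_ring V) \<Longrightarrow> f \<in> p \<or> g \<in> p"
    using I_prime[of f g] by simp
qed

subsection \<open>Expansion in monomials\<close>

lemma sum_single_lookup: "(\<Sum>t\<in>Poly_Mapping.keys f. Poly_Mapping.single t (f \<cdot> t)) = f"
  by (rule poly_mapping_eqI) (simp add: lookup_sum lookup_single when_def in_keys_iff)

lemma single_eq_cst_mult: "Poly_Mapping.single t c = cst c * monomial t"
  by (simp add: cst_def monomial_def mult_single)

lemma cst_simps: "cst (a + b) = cst a + cst b" "cst (a * b) = cst a * cst b"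
  "cst 0 = 0" "cst 1 = 1"
  by (simp_all add: cst_def single_add mult_single)

lemma monomial_add: "monomial (s + t) = monomial s * monomial t"
  by (simp add: monomial_def mult_single)

lemma monomial_zero: "monomial 0 = 1"
  by (simp add: monomial_def)

lemma poly_ring_induct [consumes 1, case_names cst var add mult]:
  fixes f :: "'k::field mpoly"
  assumes "f \<in> carrier (poly_ring V)"
    and c: "\<And>c. Q (cst c)" and v: "\<And>i. i \<in> V \<Longrightarrow> Q (var i)"
    and a: "\<And>f g. f \<in> carrier (poly_ring V) \<Longrightarrow> g \<in> carrier (poly_ring V) \<Longrightarrow> Q f \<Longrightarrow> Q g \<Longrightarrow> Q (f + g)"
    and m: "\<And>f g. f \<in> carrier (poly_ring V) \<Longrightarrow> g \<in> carrier (poly_ring V) \<Longrightarrow> Q f \<Longrightarrow> Q g \<Longrightarrow> Q (f * g)"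
  shows "Q f"
proof -
  let ?C = "\<lambda>f. f \<in> carrier (poly_ring V) \<and> Q f"
  have C0: "?C 0" and C1: "?C 1"
    using c[of 0] c[of 1] by (simp_all add: cst_simps)
  have pow: "?C (monomial (Poly_Mapping.single i k))" if "i \<in> V" for i k
  proof (induction k)
    case (Suc k)
    have "Poly_Mapping.single i (Suc k) = Poly_Mapping.single i 1 + Poly_Mapping.single i k"
      by (simp add: One_nat_def flip: single_add)
    then have "(monomial (Poly_Mapping.single i (Suc k)) :: 'k mpoly) = var i * monomial (Poly_Mapping.single i k)"
      by (simp add: monomial_add var_def)
    with Suc that v m show ?case by (auto simp: poly_ring_closed var_in_carrier)
  qed (simp add: C1 monomial_zero)
  have mon: "?C (monomial t)" if t: "t \<in> terms V" for t
  proof -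
    have "A \<subseteq> V \<Longrightarrow> ?C (monomial (\<Sum>i\<in>A. Poly_Mapping.single i (t \<cdot> i)))" for A
    proof (induction A rule: infinite_finite_induct)
      case (insert i A)
      then show ?case using pow[of i "t \<cdot> i"] m by (auto simp: monomial_add poly_ring_closed)
    qed (simp_all add: C1 monomial_zero)
    from this[of "Poly_Mapping.keys t"] t show ?thesis
      by (simp add: sum_single_lookup terms_def)
  qed
  have "A \<subseteq> Poly_Mapping.keys f \<Longrightarrow> ?C (\<Sum>t\<in>A. Poly_Mapping.single t (f \<cdot> t))" for A
  proof (induction A rule: infinite_finite_induct)
    case (insert t A)
    then have "t \<in> terms V" using assms(1) by (auto simp: carrier_poly_ring)
    then have "?C (Poly_Mapping.single t (f \<cdot> t))"
      unfolding single_eq_cst_mult using mon[of t] c m by (auto intro: poly_ring_closed)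
    with insert a show ?case by (auto intro: poly_ring_closed)
  qed (simp_all add: C0)
  from this[of "Poly_Mapping.keys f"] show ?thesis by (simp add: sum_single_lookup)
qed

subsection \<open>Coefficients of products\<close>

lemma lookup_single_mult: "(Poly_Mapping.single t c * f) \<cdot> (t + u) = c * (f \<cdot> u)"
  for f :: "'k::field mpoly"
proof -
  have "Poly_Mapping.single t c * f = (\<Sum>v\<in>Poly_Mapping.keys f. Poly_Mapping.single (t + v) (c * (f \<cdot> v)))"
    by (subst (1) sum_single_lookup[of f, symmetric]) (simp add: sum_distrib_left mult_single)
  then show ?thesis
    by (simp add: lookup_sum lookup_single when_def in_keys_iff)
qed

lemma keys_single_mult:
  assumes "u \<in> Poly_Mapping.keys (Poly_Mapping.single t c * f)"
  obtains v where "u = t + v" "v \<in> Poly_Mapping.keys f"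
  using assms by (rule keys_mult_subsetD) (auto split: if_splits)

lemma lookup_cst_mult: "(cst c * f) \<cdot> t = c * (f \<cdot> t)"
  using lookup_single_mult[of 0 c f t] by (simp add: cst_def)

lemma term_deg_superset:
  assumes "finite A" "Poly_Mapping.keys t \<subseteq> A"
  shows "term_deg t = (\<Sum>i\<in>A. t \<cdot> i)"
  unfolding term_deg_def by (rule sum.mono_neutral_left) (use assms in \<open>auto simp: in_keys_iff\<close>)

lemma term_deg_add: "term_deg (s + t) = term_deg s + term_deg t"
proof -
  let ?A = "Poly_Mapping.keys s \<union> Poly_Mapping.keys t"
  have "term_deg (s + t) = (\<Sum>i\<in>?A. (s + t) \<cdot> i)"
    by (rule term_deg_superset) (auto simp: keys_pterm_add)
  also have "\<dots> = (\<Sum>i\<in>?A. s \<cdot> i) + (\<Sum>i\<in>?A. t \<cdot> i)"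
    by (simp add: lookup_add sum.distrib)
  also have "\<dots> = term_deg s + term_deg t"
    using term_deg_superset[of ?A s] term_deg_superset[of ?A t] by simp
  finally show ?thesis .
qed

lemma term_deg_eq_0 [simp]: "term_deg t = 0 \<longleftrightarrow> t = 0"
  by (auto simp: term_deg_def in_keys_iff intro: poly_mapping_eqI)

lemma term_deg_zero [simp]: "term_deg 0 = 0"
  by (simp add: term_deg_def)

lemma term_deg_single [simp]: "term_deg (Poly_Mapping.single i k) = k"
  by (simp add: term_deg_def)

lemma term_deg_1E:
  assumes "term_deg t = 1"
  obtains i where "t = Poly_Mapping.single i 1"
proof -
  have "t \<noteq> 0" using assms term_deg_eq_0[of t] by linarith
  then obtain i where i: "i \<in> Poly_Mapping.keys t" using keys_eq_empty by blast
  have *: "t = Poly_Mapping.single i 1 + (t - Poly_Mapping.single i 1)"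
    using i by (intro poly_mapping_eqI) (auto simp: lookup_add lookup_minus lookup_single when_def in_keys_iff)
  have "term_deg t = 1 + term_deg (t - Poly_Mapping.single i 1)"
    by (subst *) (simp add: term_deg_add)
  with assms have "t - Poly_Mapping.single i 1 = 0" by simp
  with * that show thesis by simp
qed

lemma lookup_homog_comp: "homog_comp d f \<cdot> t = (if term_deg t = d then f \<cdot> t else 0)"
  by (auto simp: homog_comp_def lookup_sum lookup_single when_def in_keys_iff)

lemma homog_comp_add: "homog_comp d (f + g) = homog_comp d f + homog_comp d g"
  by (rule poly_mapping_eqI) (simp add: lookup_homog_comp lookup_add)

lemma homog_comp_var: "homog_comp 1 (var i) = var i"
  by (rule poly_mapping_eqI) (auto simp: lookup_homog_comp var_def monomial_def lookup_single when_def)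

text \<open>
  Splitting off the constant terms of both factors leaves a product whose terms all have degree
  at least two.  Hence the constant coefficient is multiplicative, and the linear part is a
  derivation at the origin.
\<close>

lemma lookup_mult_low_degree:
  fixes f g :: "'k::field mpoly"
  shows "(f * g) \<cdot> 0 = (f \<cdot> 0) * (g \<cdot> 0)"
    and "homog_comp 1 (f * g) = poly_scale (f \<cdot> 0) (homog_comp 1 g) + poly_scale (g \<cdot> 0) (homog_comp 1 f)"
proof -
  define f' g' where "f' = f - cst (f \<cdot> 0)" and "g' = g - cst (g \<cdot> 0)"
  have pos: "term_deg t \<ge> 1" if "t \<in> Poly_Mapping.keys f' \<or> t \<in> Poly_Mapping.keys g'" for t
  proof -
    have "f' \<cdot> 0 = 0" "g' \<cdot> 0 = 0" by (simp_all add: f'_def g'_def lookup_minus cst_def)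
    with that have "t \<noteq> 0" by (auto simp: in_keys_iff)
    then show ?thesis using term_deg_eq_0[of t] by linarith
  qed
  have "term_deg t \<ge> 2" if "t \<in> Poly_Mapping.keys (f' * g')" for t
  proof -
    obtain a b where "t = a + b" "a \<in> Poly_Mapping.keys f'" "b \<in> Poly_Mapping.keys g'"
      using \<open>t \<in> _\<close> by (rule keys_mult_subsetD)
    then show ?thesis using pos[of a] pos[of b] by (simp add: term_deg_add)
  qed
  then have low: "(f' * g') \<cdot> t = 0" if "term_deg t \<le> 1" for t
    using that by (force simp: in_keys_iff)
  have prod: "f * g = cst (f \<cdot> 0) * g + cst (g \<cdot> 0) * f - cst (f \<cdot> 0) * cst (g \<cdot> 0) + f' * g'"
    by (simp add: f'_def g'_def algebra_simps)
  show "(f * g) \<cdot> 0 = (f \<cdot> 0) * (g \<cdot> 0)"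
    using low[of 0] by (simp add: prod lookup_add lookup_minus lookup_cst_mult) (simp add: cst_def)
  show "homog_comp 1 (f * g) = poly_scale (f \<cdot> 0) (homog_comp 1 g) + poly_scale (g \<cdot> 0) (homog_comp 1 f)"
  proof (rule poly_mapping_eqI)
    fix t
    have "cst (g \<cdot> 0) \<cdot> t = 0" if "term_deg t = 1"
      using that by (auto simp: cst_def lookup_single when_def)
    then show "homog_comp 1 (f * g) \<cdot> t =
      (poly_scale (f \<cdot> 0) (homog_comp 1 g) + poly_scale (g \<cdot> 0) (homog_comp 1 f)) \<cdot> t"
      using low[of t]
      by (simp add: lookup_homog_comp prod poly_scale_def lookup_add lookup_minus lookup_cst_mult)
  qed
qed

subsection \<open>Monomial ideals\<close>

lemma Idl_monomials:
  fixes T :: "pterm set"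
  assumes "T \<subseteq> terms V"
  shows "Idl\<^bsub>poly_ring V\<^esub> (monomial ` T :: 'k::field mpoly set) =
    {f \<in> carrier (poly_ring V). \<forall>u\<in>Poly_Mapping.keys f. \<exists>t\<in>T. \<exists>v. u = t + v}" (is "?L = ?R")
proof (rule subset_antisym)
  interpret cring "poly_ring V :: 'k mpoly ring" by (rule poly_ring_cring)
  have car: "monomial ` T \<subseteq> carrier (poly_ring V :: 'k mpoly ring)"
    using assms by (auto simp: monomial_in_carrier)
  have "ideal ?R (poly_ring V)"
  proof (rule ideal_poly_ringI)
    show "?R \<subseteq> carrier (poly_ring V)" "0 \<in> ?R" by auto
    show "f + g \<in> ?R" if "f \<in> ?R" "g \<in> ?R" for f g
    proof -
      have "Poly_Mapping.keys (f + g) \<subseteq> Poly_Mapping.keys f \<union> Poly_Mapping.keys g"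
        by (rule Poly_Mapping.keys_add)
      with that show ?thesis by (blast intro: poly_ring_closed)
    qed
    show "g * f \<in> ?R" if "f \<in> ?R" "g \<in> carrier (poly_ring V)" for f g
    proof -
      have "\<exists>t\<in>T. \<exists>v. u = t + v" if "u \<in> Poly_Mapping.keys (g * f)" for u
        using that
      proof (rule keys_mult_subsetD)
        fix a b assume "u = a + b" "b \<in> Poly_Mapping.keys f"
        moreover from this \<open>f \<in> ?R\<close> obtain t v where "t \<in> T" "b = t + v" by blast
        ultimately have "u = t + (a + v)" by (simp add: ac_simps)
        with \<open>t \<in> T\<close> show ?thesis by blast
      qed
      with that show ?thesis by (auto intro: poly_ring_closed)
    qed
  qed
  moreover have "monomial ` T \<subseteq> ?R"
    using assms by (auto simp: monomial_in_carrier) (auto simp: monomial_def intro!: bexI exI[of _ 0])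
  ultimately show "?L \<subseteq> ?R" by (rule genideal_minimal)
  have id: "ideal ?L (poly_ring V)" by (rule genideal_ideal[OF car])
  show "?R \<subseteq> ?L"
  proof
    fix f assume f: "f \<in> ?R"
    have "Poly_Mapping.single u (f \<cdot> u) \<in> ?L" if u: "u \<in> Poly_Mapping.keys f" for u
    proof -
      from f u obtain t v where t: "t \<in> T" "u = t + v" by blast
      have "u \<in> terms V" using f u by (auto simp: carrier_poly_ring)
      then have "v \<in> terms V" using t by (simp add: terms_add_iff)
      then have "cst (f \<cdot> u) * monomial v \<in> carrier (poly_ring V)"
        by (intro poly_ring_closed) (auto simp: monomial_in_carrier)
      moreover have "monomial t \<in> ?L" using genideal_self[OF car] t by blast
      ultimately have "(cst (f \<cdot> u) * monomial v) * monomial t \<in> ?L"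
        using ideal_poly_ringD(6)[OF id] by blast
      then show ?thesis using t by (simp add: single_eq_cst_mult monomial_add ac_simps)
    qed
    then have "(\<Sum>u\<in>Poly_Mapping.keys f. Poly_Mapping.single u (f \<cdot> u)) \<in> ?L"
      by (rule ideal_sum_closed[OF id])
    then show "f \<in> ?L" by (simp add: sum_single_lookup)
  qed
qed

lemma single_dvd_iff: "(\<exists>v. u = Poly_Mapping.single i 1 + v) \<longleftrightarrow> i \<in> Poly_Mapping.keys (u :: pterm)"
proof
  assume "i \<in> Poly_Mapping.keys u"
  then have "u = Poly_Mapping.single i 1 + (u - Poly_Mapping.single i 1)"
    by (intro poly_mapping_eqI) (auto simp: lookup_add lookup_minus lookup_single when_def in_keys_iff)
  then show "\<exists>v. u = Poly_Mapping.single i 1 + v" ..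
qed (auto simp: keys_pterm_add)

lemma Idl_vars:
  assumes "A \<subseteq> V"
  shows "Idl\<^bsub>poly_ring V\<^esub> (var ` A :: 'k::field mpoly set) =
    {f \<in> carrier (poly_ring V). \<forall>u\<in>Poly_Mapping.keys f. Poly_Mapping.keys u \<inter> A \<noteq> {}}"
proof -
  have "(\<lambda>i. Poly_Mapping.single i 1) ` A \<subseteq> terms V"
    using assms single_in_terms by auto
  from Idl_monomials[OF this]
  have "Idl\<^bsub>poly_ring V\<^esub> (var ` A :: 'k::field mpoly set) = {f \<in> carrier (poly_ring V).
      \<forall>u\<in>Poly_Mapping.keys f. \<exists>i\<in>A. \<exists>v. u = Poly_Mapping.single i 1 + v}"
    by (simp add: image_image var_def)
  then show ?thesis by (auto simp only: single_dvd_iff)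
qed

lemma max_ideal_eq: "max_ideal n = {f \<in> carrier (P_ring n). f \<cdot> 0 = (0 :: 'k::field)}"
proof -
  have "(\<forall>u\<in>Poly_Mapping.keys f. Poly_Mapping.keys u \<inter> {1..n} \<noteq> {}) \<longleftrightarrow> f \<cdot> 0 = 0"
    if "f \<in> carrier (P_ring n)" for f :: "'k mpoly"
  proof
    assume *: "f \<cdot> 0 = 0"
    show "\<forall>u\<in>Poly_Mapping.keys f. Poly_Mapping.keys u \<inter> {1..n} \<noteq> {}"
    proof
      fix u assume u: "u \<in> Poly_Mapping.keys f"
      with * have "u \<noteq> 0" by (auto simp: in_keys_iff)
      then have "Poly_Mapping.keys u \<noteq> {}" by (auto simp: in_keys_iff intro: poly_mapping_eqI)
      moreover have "Poly_Mapping.keys u \<subseteq> {1..n}"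
        using u that by (auto simp: carrier_poly_ring terms_def)
      ultimately show "Poly_Mapping.keys u \<inter> {1..n} \<noteq> {}" by blast
    qed
  qed (use in_keys_iff[of 0 f] in auto)
  then show ?thesis by (auto simp: max_ideal_def Idl_vars)
qed

section \<open>The dimension of a polynomial ring\<close>

text \<open>The terms in the indeterminates \<open>V\<close> all of whose exponents are at most \<open>D\<close>.\<close>

definition term_box :: "nat set \<Rightarrow> nat \<Rightarrow> pterm set" where
  "term_box V D = {t \<in> terms V. \<forall>i. t \<cdot> i \<le> D}"

lemma term_box_card:
  assumes "finite V"
  shows "finite (term_box V D)" "card (term_box V D) \<le> (D + 1) ^ card V"
proof -
  let ?h = "\<lambda>t. restrict (Poly_Mapping.lookup t) V"
  have inj: "inj_on ?h (term_box V D)"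
  proof (rule inj_onI)
    fix s t assume st: "s \<in> term_box V D" "t \<in> term_box V D" "?h s = ?h t"
    show "s = t"
    proof (rule poly_mapping_eqI)
      fix i
      show "s \<cdot> i = t \<cdot> i"
      proof (cases "i \<in> V")
        case True
        then show ?thesis using fun_cong[OF st(3), of i] by simp
      next
        case False
        then have "i \<notin> Poly_Mapping.keys s" "i \<notin> Poly_Mapping.keys t"
          using st by (auto simp: term_box_def terms_def)
        then show ?thesis by (simp add: in_keys_iff)
      qed
    qed
  qed
  have sub: "?h ` term_box V D \<subseteq> (\<Pi>\<^sub>E i\<in>V. {..D})"
    by (auto simp: term_box_def)
  have fin: "finite (\<Pi>\<^sub>E i\<in>V. {..D})"
    by (rule finite_PiE) (use assms in auto)
  show "finite (term_box V D)"
    using inj finite_subset[OF sub fin] by (rule finite_imageD[rotated])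
  have "card (term_box V D) \<le> card (\<Pi>\<^sub>E i\<in>V. {..D})"
    by (rule card_inj_on_le[OF inj sub fin])
  also have "\<dots> = (D + 1) ^ card V"
    by (subst card_PiE) (use assms in \<open>auto simp: One_nat_def\<close>)
  finally show "card (term_box V D) \<le> (D + 1) ^ card V" .
qed

lemma term_box_add: "s \<in> term_box V D \<Longrightarrow> t \<in> term_box V E \<Longrightarrow> s + t \<in> term_box V (D + E)"
  by (auto simp: term_box_def terms_add_iff lookup_add add_mono)

lemma term_box_mono: "D \<le> E \<Longrightarrow> term_box V D \<subseteq> term_box V E"
  by (auto simp: term_box_def intro: order_trans)

lemma keys_mult_term_box:
  assumes "Poly_Mapping.keys f \<subseteq> term_box V D" "Poly_Mapping.keys g \<subseteq> term_box V E"
  shows "Poly_Mapping.keys (f * g) \<subseteq> term_box V (D + E)"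
  using assms by (auto elim!: keys_mult_subsetD intro!: term_box_add)

lemma ex_term_box:
  assumes "f \<in> carrier (poly_ring V)"
  shows "\<exists>D. Poly_Mapping.keys f \<subseteq> term_box V D"
proof -
  define D where "D = (\<Sum>t\<in>Poly_Mapping.keys f. term_deg t)"
  have "t \<cdot> i \<le> D" if t: "t \<in> Poly_Mapping.keys f" for t i
  proof -
    have "t \<cdot> i \<le> term_deg t"
    proof (cases "i \<in> Poly_Mapping.keys t")
      case True
      then show ?thesis unfolding term_deg_def by (intro member_le_sum) auto
    qed (simp add: in_keys_iff)
    also have "\<dots> \<le> D" unfolding D_def using t by (intro member_le_sum) auto
    finally show ?thesis .
  qed
  then show ?thesis using assms by (auto simp: term_box_def carrier_poly_ring intro!: exI[of _ D])
qed

text \<open>Finite sets of polynomials whose residue classes modulo \<open>p\<close> are distinct and linearly independent.\<close>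

definition indep_mod :: "'k::field mpoly set \<Rightarrow> 'k mpoly set \<Rightarrow> bool" where
  "indep_mod p B \<longleftrightarrow> finite B \<and> (\<forall>c. (\<Sum>b\<in>B. cst (c b) * b) \<in> p \<longrightarrow> (\<forall>b\<in>B. c b = 0))"

lemma indep_mod_antimono: "indep_mod q B \<Longrightarrow> p \<subseteq> q \<Longrightarrow> indep_mod p B"
  by (auto simp: indep_mod_def)

lemma indep_mod_notin:
  assumes "indep_mod p B" "b \<in> B"
  shows "b \<notin> p"
proof
  assume "b \<in> p"
  have fin: "finite B" using assms by (simp add: indep_mod_def)
  have "(\<Sum>x\<in>B. cst (if x = b then 1 else 0) * x) = (\<Sum>x\<in>B. if x = b then x else 0)"
    by (rule sum.cong) (auto simp: cst_simps)
  also have "\<dots> = b" using fin assms(2) by simp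
  finally have "(\<Sum>x\<in>B. cst (if x = b then 1 else 0) * x) \<in> p" using \<open>b \<in> p\<close> by simp
  then have "\<forall>x\<in>B. (if x = b then 1 else 0) = (0 :: 'a)"
    using assms(1) unfolding indep_mod_def by (elim conjE allE[of _ "\<lambda>x. if x = b then 1 else 0"]) simp
  then show False using assms(2) by auto
qed

text \<open>
  If a combination of \<open>B1 \<union> f B0\<close> lies in the smaller prime \<open>p\<close>, its part on \<open>B1\<close> lies in \<open>q\<close>, since
  \<open>f\<close> does, and vanishes; the remaining part is \<open>f\<close> times a combination of \<open>B0\<close>, and \<open>f\<close> can be
  cancelled modulo \<open>p\<close>.
\<close>

lemma indep_mod_extend:
  fixes p q :: "'k::field mpoly set"
  assumes p: "primeideal p (poly_ring V)" and q: "primeideal q (poly_ring V)" and pq: "p \<subseteq> q"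
    and f: "f \<in> q" "f \<notin> p"
    and B1: "indep_mod q B1" and B0: "indep_mod p B0" "B0 \<subseteq> carrier (poly_ring V)"
  shows "indep_mod p (B1 \<union> (*) f ` B0)" "card (B1 \<union> (*) f ` B0) = card B1 + card B0"
proof -
  note ip = primeideal_poly_ringD(1)[OF p] and iq = primeideal_poly_ringD(1)[OF q]
  have fc: "f \<in> carrier (poly_ring V)" using f ideal_poly_ringD(1)[OF iq] by blast
  have fin: "finite B1" "finite B0" using B1 B0 by (auto simp: indep_mod_def)
  have "f \<noteq> 0" using f ideal_poly_ringD(2)[OF ip] by auto
  then have inj: "inj_on ((*) f) B0" by (auto intro!: inj_onI)
  have fq: "f * b \<in> q" if "b \<in> B0" for b
    using ideal_poly_ringD(7)[OF iq f(1)] that B0(2) by blast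
  then have disj: "B1 \<inter> (*) f ` B0 = {}"
    using indep_mod_notin[OF B1] by blast
  show "card (B1 \<union> (*) f ` B0) = card B1 + card B0"
    using disj fin inj by (simp add: card_Un_disjoint card_image)
  show "indep_mod p (B1 \<union> (*) f ` B0)"
    unfolding indep_mod_def
  proof (intro conjI allI impI)
    show "finite (B1 \<union> (*) f ` B0)" using fin by simp
    fix c assume c: "(\<Sum>b\<in>B1 \<union> (*) f ` B0. cst (c b) * b) \<in> p"
    define g where "g = (\<Sum>b\<in>B0. cst (c (f * b)) * b)"
    have sum: "(\<Sum>b\<in>B1 \<union> (*) f ` B0. cst (c b) * b) = (\<Sum>b\<in>B1. cst (c b) * b) + f * g"
      using fin disj inj
      by (simp add: sum.union_disjoint sum.reindex g_def sum_distrib_left mult.left_commute)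
    have gc: "g \<in> carrier (poly_ring V)" unfolding g_def
      by (rule ideal_sum_closed[where J = "carrier (poly_ring V)", OF ring.oneideal[OF poly_ring_ring]])
        (use B0(2) in \<open>auto intro!: poly_ring_closed\<close>)
    have "(\<Sum>b\<in>B1. cst (c b) * b) = (\<Sum>b\<in>B1 \<union> (*) f ` B0. cst (c b) * b) - f * g"
      using sum by simp
    also have "\<dots> \<in> q"
      using c pq ideal_poly_ringD(7)[OF iq f(1) gc] by (intro ideal_poly_ringD(4)[OF iq]) auto
    finally have z1: "\<forall>b\<in>B1. c b = 0" using B1 by (auto simp: indep_mod_def)
    then have "(\<Sum>b\<in>B1. cst (c b) * b) = 0" by (simp add: cst_simps)
    then have "f * g \<in> p" using c sum by simp
    then have "g \<in> p" using primeideal_poly_ringD(3)[OF p _ fc gc] f by blast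
    then have "\<forall>b\<in>B0. c (f * b) = 0"
      using B0(1) unfolding indep_mod_def g_def by (elim conjE allE[of _ "\<lambda>b. c (f * b)"]) auto
    with z1 show "\<forall>b\<in>B1 \<union> (*) f ` B0. c b = 0" by auto
  qed
qed

text \<open>
  Iterating the construction gives the products \<open>f ^ i * b\<close> with \<open>i \<le> r\<close> and \<open>b\<close> in \<open>B\<close>.
\<close>

lemma indep_mod_layers:
  fixes p q :: "'k::field mpoly set"
  assumes p: "primeideal p (poly_ring V)" and q: "primeideal q (poly_ring V)" and pq: "p \<subseteq> q"
    and f: "f \<in> q" "f \<notin> p" "Poly_Mapping.keys f \<subseteq> term_box V e"
    and B: "indep_mod q B" "\<And>b. b \<in> B \<Longrightarrow> Poly_Mapping.keys b \<subseteq> term_box V D"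
  shows "\<exists>B'. indep_mod p B' \<and> card B' = (r + 1) * card B \<and>
    (\<forall>b\<in>B'. Poly_Mapping.keys b \<subseteq> term_box V (D + r * e))"
proof (induction r)
  case 0
  then show ?case using B indep_mod_antimono[OF B(1) pq] by (intro exI[of _ B]) auto
next
  case (Suc r)
  then obtain B' where B': "indep_mod p B'" "card B' = (r + 1) * card B"
    "\<forall>b\<in>B'. Poly_Mapping.keys b \<subseteq> term_box V (D + r * e)" by blast
  have car: "B' \<subseteq> carrier (poly_ring V)"
    using B'(3) by (auto simp: carrier_poly_ring term_box_def)
  have "Poly_Mapping.keys b \<subseteq> term_box V (D + Suc r * e)" if "b \<in> B \<union> (*) f ` B'" for b
    using that
  proof
    assume "b \<in> B"
    then show ?thesis using B(2)[of b] term_box_mono[of D "D + Suc r * e" V] by auto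
  next
    assume "b \<in> (*) f ` B'"
    then obtain b' where b': "b' \<in> B'" "b = f * b'" by auto
    have "Poly_Mapping.keys (f * b') \<subseteq> term_box V (e + (D + r * e))"
      using f(3) B'(3) b' by (intro keys_mult_term_box) auto
    then show ?thesis using b' by (simp add: ac_simps)
  qed
  then show ?case
    using indep_mod_extend[OF p q pq f(1,2) B(1) B'(1) car] B'(2)
    by (intro exI[of _ "B \<union> (*) f ` B'"]) (auto simp: algebra_simps)
qed

text \<open>
  Picking $f_i$ in the \<open>i\<close>-th prime of a chain but not in the one before, the products
  $f_1^{a_1} \cdots f_k^{a_k}$ with exponents at most \<open>N\<close> are linearly independent.  There are $(N+1)^k$ of them,
  in a space of dimension at most a constant times $(N+1)^m$, where \<open>m\<close> is the number of indeterminates.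
\<close>

theorem prime_chain_length_le:
  fixes p :: "nat \<Rightarrow> 'k::field mpoly set"
  assumes V: "finite V" and prime: "\<And>i. i \<le> k \<Longrightarrow> primeideal (p i) (poly_ring V)"
    and strict: "\<And>i. i < k \<Longrightarrow> p i \<subset> p (Suc i)"
  shows "k \<le> card V"
proof (rule ccontr)
  assume "\<not> k \<le> card V"
  define m where "m = card V"
  have km: "Suc m \<le> k" using \<open>\<not> k \<le> card V\<close> by (simp add: m_def)
  have "\<forall>i. \<exists>f. i < k \<longrightarrow> f \<in> p (Suc i) \<and> f \<notin> p i" using strict by blast
  then obtain f where f: "\<And>i. i < k \<Longrightarrow> f i \<in> p (Suc i) \<and> f i \<notin> p i" by metis
  have "\<forall>i. \<exists>D. i < k \<longrightarrow> Poly_Mapping.keys (f i) \<subseteq> term_box V D"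
  proof (intro allI)
    fix i
    show "\<exists>D. i < k \<longrightarrow> Poly_Mapping.keys (f i) \<subseteq> term_box V D"
    proof (cases "i < k")
      case True
      then have "f i \<in> carrier (poly_ring V)"
        using f[OF True] ideal_poly_ringD(1)[OF primeideal_poly_ringD(1)[OF prime[of "Suc i"]]] by auto
      then show ?thesis using ex_term_box by blast
    qed auto
  qed
  then obtain E where E: "\<And>i. i < k \<Longrightarrow> Poly_Mapping.keys (f i) \<subseteq> term_box V (E i)" by metis
  define e where "e = (\<Sum>i<k. E i)"
  have e: "Poly_Mapping.keys (f i) \<subseteq> term_box V e" if "i < k" for i
  proof -
    have "E i \<le> e" unfolding e_def using that by (intro member_le_sum) auto
    then show ?thesis using E[OF that] term_box_mono by blast
  qed
  \<comment> \<open>With this \<open>N\<close>, the bound \<open>(N * k * e + 1) ^ m\<close> on the dimension is at most \<open>(N + 1) ^ m * N\<close>.\<close>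
  define N where "N = (k * e + 1) ^ m"
  have "\<exists>B. indep_mod (p (k - j)) B \<and> card B = (N + 1) ^ j \<and>
      (\<forall>b\<in>B. Poly_Mapping.keys b \<subseteq> term_box V (N * j * e))" if "j \<le> k" for j
    using that
  proof (induction j)
    case 0
    have "c = 0" if "cst c \<in> p k" for c
    proof (rule ccontr)
      assume "c \<noteq> 0"
      then have "cst (inverse c) * cst c = (1 :: 'k mpoly)" by (simp add: cst_simps flip: cst_simps(2))
      then show False
        using that ideal_poly_ringD(6)[OF primeideal_poly_ringD(1)[OF prime[of k]] that, of "cst (inverse c)"]
          primeideal_poly_ringD(2)[OF prime[of k]] by simp
    qed
    then show ?case
      by (intro exI[of _ "{1}"]) (auto simp: indep_mod_def term_box_def)
  next
    case (Suc j)
    then obtain B where B: "indep_mod (p (k - j)) B" "card B = (N + 1) ^ j"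
      "\<forall>b\<in>B. Poly_Mapping.keys b \<subseteq> term_box V (N * j * e)" by auto
    define i where "i = k - Suc j"
    have i: "i < k" "k - j = Suc i" using Suc.prems by (auto simp: i_def)
    have "\<exists>B'. indep_mod (p i) B' \<and> card B' = (N + 1) * card B \<and>
      (\<forall>b\<in>B'. Poly_Mapping.keys b \<subseteq> term_box V (N * j * e + N * e))"
    proof (rule indep_mod_layers)
      show "primeideal (p i) (poly_ring V)" "primeideal (p (Suc i)) (poly_ring V)" "p i \<subseteq> p (Suc i)"
        using prime i strict[of i] by auto
      show "indep_mod (p (Suc i)) B" using B(1) i(2) by simp
      show "\<And>b. b \<in> B \<Longrightarrow> Poly_Mapping.keys b \<subseteq> term_box V (N * j * e)" using B(3) by auto
    qed (use f e i in auto)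
    then show ?case using B(2) by (simp add: i_def algebra_simps)
  qed
  from this[of k] obtain B where B: "indep_mod (p 0) B" "card B = (N + 1) ^ k"
    "\<forall>b\<in>B. Poly_Mapping.keys b \<subseteq> term_box V (N * k * e)" by auto
  let ?T = "(monomial ` term_box V (N * k * e) :: 'k mpoly set)"
  have "poly_vs.independent B"
  proof (rule poly_vs.independent_if_scalars_zero)
    show "finite B" using B(1) by (simp add: indep_mod_def)
    fix c x assume "(\<Sum>x\<in>B. poly_scale (c x) x) = 0" "x \<in> B"
    then show "c x = 0"
      using B(1) ideal_poly_ringD(2)[OF primeideal_poly_ringD(1)[OF prime[of 0]]]
      by (auto simp: indep_mod_def poly_scale_def)
  qed
  moreover have "B \<subseteq> poly_vs.span ?T"
  proof
    fix b assume "b \<in> B"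
    have "(\<Sum>t\<in>Poly_Mapping.keys b. poly_scale (b \<cdot> t) (monomial t)) \<in> poly_vs.span ?T"
      using B(3) \<open>b \<in> B\<close> by (intro poly_vs.span_sum poly_vs.span_scale poly_vs.span_base) auto
    then show "b \<in> poly_vs.span ?T"
      by (simp add: poly_scale_def sum_single_lookup flip: single_eq_cst_mult)
  qed
  ultimately have "card B \<le> card ?T"
    using poly_vs.independent_span_bound[of ?T B] term_box_card(1)[OF V] by simp
  also have "\<dots> \<le> card (term_box V (N * k * e))"
    by (rule card_image_le[OF term_box_card(1)[OF V]])
  also have "\<dots> \<le> (N * k * e + 1) ^ m"
    unfolding m_def by (rule term_box_card(2)[OF V])
  also have "\<dots> \<le> ((N + 1) * (k * e + 1)) ^ m"
    by (rule power_mono) (auto simp: algebra_simps)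
  also have "\<dots> = (N + 1) ^ m * N" by (simp only: power_mult_distrib flip: N_def)
  also have "\<dots> < (N + 1) ^ Suc m" by simp
  also have "\<dots> \<le> (N + 1) ^ k" by (rule power_increasing[OF km]) simp
  finally show False using B(2) by simp
qed

section \<open>Leading terms and separating term orderings\<close>

lemma single_one_eq_iff: "Poly_Mapping.single i (1 :: nat) = Poly_Mapping.single j 1 \<longleftrightarrow> i = j"
proof
  assume "Poly_Mapping.single i (1 :: nat) = Poly_Mapping.single j 1"
  then have "Poly_Mapping.keys (Poly_Mapping.single i (1 :: nat)) = Poly_Mapping.keys (Poly_Mapping.single j (1 :: nat))"
    by (rule arg_cong)
  then show "i = j" by simp
qed simp

lemma term_orderingD:
  assumes "term_ordering n \<sigma>"
  shows "trans \<sigma>" "antisym \<sigma>" "wf (\<sigma> - Id)"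
    and "t \<in> terms {1..n} \<Longrightarrow> (t, t) \<in> \<sigma>"
    and "s \<in> terms {1..n} \<Longrightarrow> t \<in> terms {1..n} \<Longrightarrow> (s, t) \<in> \<sigma> \<or> (t, s) \<in> \<sigma>"
    and "(s, t) \<in> \<sigma> \<Longrightarrow> u \<in> terms {1..n} \<Longrightarrow> (s + u, t + u) \<in> \<sigma>"
proof -
  have wo: "well_order_on (terms {1..n}) \<sigma>" and mono: "\<And>t u v. (t, u) \<in> \<sigma> \<Longrightarrow> v \<in> terms {1..n} \<Longrightarrow> (t + v, u + v) \<in> \<sigma>"
    using assms by (auto simp: term_ordering_def)
  then show "trans \<sigma>" "antisym \<sigma>" "wf (\<sigma> - Id)"
    by (auto simp: order_on_defs)
  show refl: "(t, t) \<in> \<sigma>" if "t \<in> terms {1..n}" for t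
    using wo that by (auto simp: order_on_defs refl_on_def)
  have total: "total_on (terms {1..n}) \<sigma>" using wo by (simp add: order_on_defs)
  show "(s, t) \<in> \<sigma> \<or> (t, s) \<in> \<sigma>" if "s \<in> terms {1..n}" "t \<in> terms {1..n}"
  proof (cases "s = t")
    case True
    then show ?thesis using refl[OF that(1)] by simp
  next
    case False
    then show ?thesis using total that by (simp add: total_on_def)
  qed
  show "(s, t) \<in> \<sigma> \<Longrightarrow> u \<in> terms {1..n} \<Longrightarrow> (s + u, t + u) \<in> \<sigma>"
    by (rule mono)
qed

lemma lead_term_eqI:
  assumes "term_ordering n \<sigma>" "t \<in> Poly_Mapping.keys f" "\<And>u. u \<in> Poly_Mapping.keys f \<Longrightarrow> (u, t) \<in> \<sigma>"
  shows "lead_term \<sigma> f = t"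
  unfolding lead_term_def
  by (rule the_equality) (use assms antisymD[OF term_orderingD(2)[OF assms(1)]] in blast)+

lemma lead_term:
  assumes ord: "term_ordering n \<sigma>" and f: "f \<in> carrier (P_ring n)" "f \<noteq> 0"
  shows "lead_term \<sigma> f \<in> Poly_Mapping.keys f"
    and "u \<in> Poly_Mapping.keys f \<Longrightarrow> (u, lead_term \<sigma> f) \<in> \<sigma>"
proof -
  have "\<exists>t\<in>A. \<forall>u\<in>A. (u, t) \<in> \<sigma>" if "finite A" "A \<noteq> {}" "A \<subseteq> terms {1..n}" for A
    using that
  proof (induction A rule: finite_ne_induct)
    case (singleton x)
    then show ?case using term_orderingD(4)[OF ord] by auto
  next
    case (insert x A)
    then obtain t where t: "t \<in> A" "\<And>u. u \<in> A \<Longrightarrow> (u, t) \<in> \<sigma>" by auto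
    have "(x, t) \<in> \<sigma> \<or> (t, x) \<in> \<sigma>"
      using term_orderingD(5)[OF ord] insert.prems t(1) by auto
    then show ?case
    proof
      assume "(x, t) \<in> \<sigma>"
      with t show ?thesis by (intro bexI[of _ t]) auto
    next
      assume "(t, x) \<in> \<sigma>"
      then have "(u, x) \<in> \<sigma>" if "u \<in> insert x A" for u
        using that t insert.prems transD[OF term_orderingD(1)[OF ord]] term_orderingD(4)[OF ord, of x] by blast
      then show ?thesis by (intro bexI[of _ x]) auto
    qed
  qed
  from this[of "Poly_Mapping.keys f"] f obtain t
    where t: "t \<in> Poly_Mapping.keys f" "\<And>u. u \<in> Poly_Mapping.keys f \<Longrightarrow> (u, t) \<in> \<sigma>"
    by (auto simp: carrier_poly_ring)
  with lead_term_eqI[OF ord] have "lead_term \<sigma> f = t" by blast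
  with t show "lead_term \<sigma> f \<in> Poly_Mapping.keys f"
    "u \<in> Poly_Mapping.keys f \<Longrightarrow> (u, lead_term \<sigma> f) \<in> \<sigma>" by auto
qed

lemma lead_term_in_terms:
  assumes "term_ordering n \<sigma>" "f \<in> carrier (P_ring n)" "f \<noteq> 0"
  shows "lead_term \<sigma> f \<in> terms {1..n}"
proof -
  have "Poly_Mapping.keys f \<subseteq> terms {1..n}" using assms(2) by (simp add: carrier_poly_ring)
  then show ?thesis using lead_term(1)[OF assms] by (rule subsetD)
qed

lemma term_ordering_zero_least:
  assumes ord: "term_ordering n \<sigma>" and v: "v \<in> terms {1..n}"
  shows "(0, v) \<in> \<sigma>"
proof (rule ccontr)
  assume "(0, v) \<notin> \<sigma>"
  let ?Q = "{v \<in> terms {1..n}. v \<noteq> 0 \<and> (v, 0) \<in> \<sigma>}"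
  have "v \<in> ?Q"
    using \<open>(0, v) \<notin> \<sigma>\<close> term_orderingD(4,5)[OF ord] v zero_in_terms by blast
  then obtain w where w: "w \<in> ?Q" "\<And>y. (y, w) \<in> \<sigma> - Id \<Longrightarrow> y \<notin> ?Q"
    by (rule wfE_min[OF term_orderingD(3)[OF ord]]) iprover
  have wT: "w \<in> terms {1..n}" and w0: "w \<noteq> 0" and wl: "(w, 0) \<in> \<sigma>" using w(1) by auto
  have ww: "(w + w, w) \<in> \<sigma>" using term_orderingD(6)[OF ord wl wT] by simp
  have "(w + w, 0) \<in> \<sigma>" using transD[OF term_orderingD(1)[OF ord] ww wl] .
  moreover have "w + w \<noteq> 0" using w0 keys_pterm_add[of w w] by (metis Un_absorb keys_eq_empty)
  ultimately have "w + w \<in> ?Q" using wT by (simp add: terms_add_iff)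
  moreover have "w + w \<noteq> w" using w0 by simp
  ultimately show False using w(2)[of "w + w"] ww by simp
qed

text \<open>
  The setting of what follows: \<open>J\<close> is an ideal of $P$ whose ideal of leading terms is
  generated by the indeterminates in \<open>Z\<close>.
\<close>

locale separated_ideal =
  fixes n :: nat and Z :: "nat list" and J :: "'k::field mpoly set" and \<sigma> :: "pterm rel"
  assumes ord: "term_ordering n \<sigma>" and Z: "set Z \<subseteq> {1..n}" and J: "ideal J (P_ring n)"
    and LT: "LT_ideal n \<sigma> J = Idl\<^bsub>P_ring n\<^esub> (var ` set Z)"
begin

abbreviation "V \<equiv> {1..n} - set Z"
abbreviation "P \<equiv> carrier (P_ring n :: 'k mpoly ring)"
abbreviation "P' \<equiv> carrier (P_hat n Z :: 'k mpoly ring)"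

lemmas JD = ideal_poly_ringD[OF J]

lemma P'_subset_P: "P' \<subseteq> P"
  by (rule poly_ring_mono) auto

lemma in_P'_iff: "f \<in> P' \<longleftrightarrow> f \<in> P \<and> (\<forall>u\<in>Poly_Mapping.keys f. Poly_Mapping.keys u \<inter> set Z = {})"
  by (auto simp: carrier_poly_ring terms_def)

text \<open>Membership in a monomial ideal is decided on the terms, so leading terms are divisible by some $z_i$.\<close>

lemma lead_term_hits_Z:
  assumes "f \<in> J" "f \<noteq> 0"
  shows "Poly_Mapping.keys (lead_term \<sigma> f) \<inter> set Z \<noteq> {}"
proof -
  have "monomial (lead_term \<sigma> g) \<in> P" if "g \<in> J - {0}" for g
  proof -
    have "g \<in> P" "g \<noteq> 0" using that JD(1) by auto
    from lead_term_in_terms[OF ord this] show ?thesis by (simp add: monomial_in_carrier)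
  qed
  then have "(\<lambda>f. monomial (lead_term \<sigma> f)) ` (J - {0}) \<subseteq> P" by blast
  then have "monomial (lead_term \<sigma> f) \<in> LT_ideal n \<sigma> J"
    using assms ring.genideal_self[OF poly_ring_ring] unfolding LT_ideal_def by blast
  then show ?thesis
    unfolding LT Idl_vars[OF Z] by (simp add: monomial_def)
qed

lemma lead_term_indeterminate:
  assumes G: "G \<subseteq> J" "LT_ideal n \<sigma> G = Idl\<^bsub>P_ring n\<^esub> (var ` set Z :: 'k mpoly set)" and z: "z \<in> set Z"
  shows "\<exists>g\<in>G - {0}. lead_term \<sigma> g = Poly_Mapping.single z 1"
proof -
  let ?L = "lead_term \<sigma> ` (G - {0})"
  have "lead_term \<sigma> g \<in> terms {1..n}" if "g \<in> G - {0}" for g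
    by (rule lead_term_in_terms[OF ord]) (use that G(1) JD(1) in auto)
  then have sub: "?L \<subseteq> terms {1..n}" by blast
  have "(var z :: 'k mpoly) \<in> Idl\<^bsub>P_ring n\<^esub> (var ` set Z)"
    using z Z by (intro subsetD[OF ring.genideal_self[OF poly_ring_ring]]) (auto simp: var_in_carrier)
  then have "(var z :: 'k mpoly) \<in> Idl\<^bsub>P_ring n\<^esub> (monomial ` ?L)"
    unfolding G(2)[symmetric] by (simp add: LT_ideal_def image_image)
  then obtain g v where g: "g \<in> G - {0}" "Poly_Mapping.single z 1 = lead_term \<sigma> g + v"
    unfolding Idl_monomials[OF sub] by (auto simp: var_def monomial_def)
  have "lead_term \<sigma> g \<noteq> 0" using lead_term_hits_Z[of g] g G by auto
  moreover have "term_deg (lead_term \<sigma> g) + term_deg v = 1"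
    using g(2) term_deg_add[of "lead_term \<sigma> g" v] by (metis term_deg_single)
  ultimately have "term_deg v = 0" using term_deg_eq_0[of "lead_term \<sigma> g"] by linarith
  then have "v = 0" by simp
  then show ?thesis using g by auto
qed

subsection \<open>The decomposition $P = J \oplus \widehat{P}$\<close>

lemma J_Int_P': "J \<inter> P' = {0}"
proof -
  have "f = 0" if "f \<in> J" "f \<in> P'" for f
  proof (rule ccontr)
    assume "f \<noteq> 0"
    have "f \<in> P" using that(1) JD(1) by blast
    from lead_term(1)[OF ord this \<open>f \<noteq> 0\<close>] lead_term_hits_Z[OF that(1) \<open>f \<noteq> 0\<close>] that(2)
    show False unfolding in_P'_iff by blast
  qed
  then show ?thesis using JD(2) by auto
qed

text \<open>Division by \<open>J\<close>: every term divisible by some $z_i$ can be cancelled by a multiple of an element of \<open>J\<close>.\<close>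

lemma ex_normal_form:
  assumes "f \<in> P"
  shows "\<exists>j\<in>J. f - j \<in> P'"
proof (cases "f = 0")
  case True
  then show ?thesis using JD(2) by (intro bexI[of _ 0]) auto
next
  case False
  have "\<forall>f\<in>P. (\<forall>u\<in>Poly_Mapping.keys f. (u, t) \<in> \<sigma>) \<longrightarrow> (\<exists>j\<in>J. f - j \<in> P')"
    if "t \<in> terms {1..n}" for t
    using that
  proof (induction t rule: wf_induct_rule[OF term_orderingD(3)[OF ord]])
    case (1 t)
    have smaller: "\<exists>j\<in>J. f - j \<in> P'"
      if f: "f \<in> P" "\<forall>u\<in>Poly_Mapping.keys f. (u, t) \<in> \<sigma>" "f \<cdot> t = 0" for f
    proof (cases "f = 0")
      case True
      then show ?thesis using JD(2) by (intro bexI[of _ 0]) auto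
    next
      case False
      note lt = lead_term[OF ord f(1) False]
      have "lead_term \<sigma> f \<noteq> t" using lt(1) f(3) by (auto simp: in_keys_iff)
      then have "(lead_term \<sigma> f, t) \<in> \<sigma> - Id" using f(2) lt(1) by simp
      note IH = bspec[OF "1.IH"[OF this lead_term_in_terms[OF ord f(1) False]] f(1)]
      have "\<forall>u\<in>Poly_Mapping.keys f. (u, lead_term \<sigma> f) \<in> \<sigma>" using lt(2) by (rule ballI)
      then show ?thesis by (rule mp[OF IH])
    qed
    show ?case
    proof (intro ballI impI)
      fix f assume f: "f \<in> P" "\<forall>u\<in>Poly_Mapping.keys f. (u, t) \<in> \<sigma>"
      show "\<exists>j\<in>J. f - j \<in> P'"
      proof (cases "Poly_Mapping.keys t \<inter> set Z = {}")
        \<comment> \<open>The leading term itself is moved into the remainder.\<close>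
        case True
        have "t \<in> terms {1..n}" by fact
        with True have m: "Poly_Mapping.single t (f \<cdot> t) \<in> P'"
          unfolding in_P'_iff by (simp add: carrier_poly_ring)
        define f' where "f' = f - Poly_Mapping.single t (f \<cdot> t)"
        have "f' \<in> P" unfolding f'_def using f(1) m P'_subset_P by (blast intro: poly_ring_closed)
        moreover have "\<forall>u\<in>Poly_Mapping.keys f'. (u, t) \<in> \<sigma>"
          using f(2) by (auto simp: f'_def in_keys_iff lookup_minus lookup_single when_def split: if_splits)
        ultimately obtain j where j: "j \<in> J" "f' - j \<in> P'"
          using smaller[of f'] by (auto simp: f'_def lookup_minus)
        have "(f' - j) + Poly_Mapping.single t (f \<cdot> t) \<in> P'" using j m by (blast intro: poly_ring_closed)
        then show ?thesis using j by (intro bexI[of _ j]) (simp_all add: f'_def)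
      next
        case False
        then obtain z u where z: "z \<in> set Z" "t = u + Poly_Mapping.single z 1"
          using single_dvd_iff[of t] by (metis IntE add.commute ex_in_conv)
        obtain g where g: "g \<in> J" "g \<noteq> 0" "lead_term \<sigma> g = Poly_Mapping.single z 1"
          using lead_term_indeterminate[OF subset_refl LT z(1)] by auto
        have gP: "g \<in> P" using g JD(1) by blast
        note ltg = lead_term[OF ord gP g(2), unfolded g(3)]
        define a where "a = g \<cdot> (Poly_Mapping.single z 1)"
        have "a \<noteq> 0" using ltg(1) by (simp add: a_def in_keys_iff)
        have uT: "u \<in> terms {1..n}" using "1.prems" z(2) by (simp add: terms_add_iff)
        define j0 where "j0 = Poly_Mapping.single u (f \<cdot> t / a) * g"
        have j0: "j0 \<in> J" unfolding j0_def
          using g(1) uT by (intro JD(6)) (auto simp: carrier_poly_ring)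
        define f' where "f' = f - j0"
        have "f' \<in> P" unfolding f'_def using f(1) j0 JD(1) by (blast intro: poly_ring_closed)
        moreover have "(w, t) \<in> \<sigma>" if "w \<in> Poly_Mapping.keys f'" for w
        proof -
          have "w \<in> Poly_Mapping.keys f \<or> w \<in> Poly_Mapping.keys j0"
            using that keys_minus_subset[of f j0] by (auto simp: f'_def)
          then show ?thesis
          proof
            assume "w \<in> Poly_Mapping.keys j0"
            then obtain v where v: "w = u + v" "v \<in> Poly_Mapping.keys g"
              unfolding j0_def by (rule keys_single_mult)
            then show ?thesis
              using term_orderingD(6)[OF ord ltg(2)[OF v(2)] uT] by (simp add: z(2) add.commute)
          qed (use f(2) in blast)
        qed
        moreover have "f' \<cdot> t = 0"
          using \<open>a \<noteq> 0\<close> by (simp add: f'_def j0_def lookup_minus z(2) lookup_single_mult a_def)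
        ultimately obtain j where j: "j \<in> J" "f' - j \<in> P'"
          using smaller[of f'] by blast
        then show ?thesis using JD(3)[OF j0 j(1)]
          by (intro bexI[of _ "j0 + j"]) (simp_all add: f'_def diff_diff_eq)
      qed
    qed
  qed
  from this[of "lead_term \<sigma> f"] show ?thesis
    using lead_term[OF ord assms False] assms by (auto simp: carrier_poly_ring)
qed

text \<open>The projection of $P$ onto $\widehat{P}$ along \<open>J\<close>.\<close>

definition nf :: "'k mpoly \<Rightarrow> 'k mpoly" where
  "nf f = (THE r. r \<in> P' \<and> f - r \<in> J)"

lemma nf_eqI:
  assumes "r \<in> P'" "f - r \<in> J"
  shows "nf f = r"
  unfolding nf_def
proof (rule the_equality)
  fix q assume q: "q \<in> P' \<and> f - q \<in> J"
  have "(f - r) - (f - q) \<in> J" using q assms JD(4) by blast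
  then have "q - r \<in> J \<inter> P'" using q assms by (auto intro: poly_ring_closed)
  then have "q - r = 0" using J_Int_P' by blast
  then show "q = r" by simp
qed (use assms in auto)

lemma nf:
  assumes "f \<in> P"
  shows "nf f \<in> P'" "f - nf f \<in> J"
proof -
  obtain j where "j \<in> J" "f - j \<in> P'" using ex_normal_form[OF assms] by auto
  then have "nf f = f - j" by (intro nf_eqI) auto
  then show "nf f \<in> P'" "f - nf f \<in> J" using \<open>j \<in> J\<close> \<open>f - j \<in> P'\<close> by auto
qed

lemma nf_id: "r \<in> P' \<Longrightarrow> nf r = r"
  using JD(2) by (intro nf_eqI) auto

lemma nf_eq_0_iff: "f \<in> P \<Longrightarrow> nf f = 0 \<longleftrightarrow> f \<in> J"
  using nf(2)[of f] nf_eqI[of 0 f] by auto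

lemma nf_add:
  assumes "f \<in> P" "g \<in> P"
  shows "nf (f + g) = nf f + nf g"
proof (rule nf_eqI)
  show "nf f + nf g \<in> P'" using assms by (intro poly_ring_closed nf)
  have "(f - nf f) + (g - nf g) \<in> J" using assms by (intro JD(3) nf)
  then show "f + g - (nf f + nf g) \<in> J" by (simp add: algebra_simps)
qed

lemma nf_mult:
  assumes "f \<in> P" "g \<in> P"
  shows "nf (f * g) = nf f * nf g"
proof (rule nf_eqI)
  show "nf f * nf g \<in> P'" using assms by (intro poly_ring_closed nf)
  have "nf f \<in> P" using nf(1)[OF assms(1)] P'_subset_P by blast
  then have "g * (f - nf f) + nf f * (g - nf g) \<in> J" using assms by (intro JD(3,6) nf)
  then show "f * g - nf f * nf g \<in> J" by (simp add: algebra_simps)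
qed

subsection \<open>The reduced Groebner basis\<close>

text \<open>The element $z - h$ of \<open>J\<close> with $h \in \widehat{P}$.\<close>

definition sep_elem :: "nat \<Rightarrow> 'k mpoly" where
  "sep_elem z = var z - nf (var z)"

lemma var_in_P: "z \<in> set Z \<Longrightarrow> var z \<in> P"
  using Z by (auto simp: var_in_carrier)

lemma lookup_P': "f \<in> P' \<Longrightarrow> Poly_Mapping.keys t \<inter> set Z \<noteq> {} \<Longrightarrow> f \<cdot> t = 0"
  by (auto simp: in_P'_iff in_keys_iff)

lemma sep_elem:
  assumes z: "z \<in> set Z"
  shows "sep_elem z \<in> J" "sep_elem z \<in> P"
    and "\<And>z'. z' \<in> set Z \<Longrightarrow> sep_elem z \<cdot> (Poly_Mapping.single z' 1) = (if z = z' then 1 else 0)"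
    and "sep_elem z \<noteq> 0" "lead_term \<sigma> (sep_elem z) = Poly_Mapping.single z 1"
    and "\<And>u. u \<in> Poly_Mapping.keys (sep_elem z) \<Longrightarrow> u = Poly_Mapping.single z 1 \<or> Poly_Mapping.keys u \<inter> set Z = {}"
proof -
  note h = nf[OF var_in_P[OF z]]
  show J': "sep_elem z \<in> J" using h(2) by (simp add: sep_elem_def)
  then show P: "sep_elem z \<in> P" using JD(1) by blast
  show c: "sep_elem z \<cdot> (Poly_Mapping.single z' 1) = (if z = z' then 1 else 0)" if "z' \<in> set Z" for z'
  proof -
    have "nf (var z) \<cdot> (Poly_Mapping.single z' 1) = 0" using that by (intro lookup_P' h) simp
    then show ?thesis
      by (auto simp: sep_elem_def lookup_minus var_def monomial_def lookup_single when_def single_one_eq_iff)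
  qed
  show "sep_elem z \<noteq> 0" using c[OF z] by auto
  show k: "u = Poly_Mapping.single z 1 \<or> Poly_Mapping.keys u \<inter> set Z = {}"
    if "u \<in> Poly_Mapping.keys (sep_elem z)" for u
    using that keys_minus_subset[of "var z" "nf (var z)"] h(1)
    by (auto simp: sep_elem_def var_def monomial_def in_P'_iff split: if_splits)
  show "lead_term \<sigma> (sep_elem z) = Poly_Mapping.single z 1"
    using k lead_term(1)[OF ord P \<open>sep_elem z \<noteq> 0\<close>] lead_term_hits_Z[OF J' \<open>sep_elem z \<noteq> 0\<close>] by blast
qed

lemma reduced_groebner_basis_sep_elem: "reduced_groebner_basis n \<sigma> J (sep_elem ` set Z)"
  unfolding reduced_groebner_basis_def
proof (intro conjI ballI)
  show "finite (sep_elem ` set Z)" by simp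
  show "sep_elem ` set Z \<subseteq> J - {0}" using sep_elem by auto
  have "sep_elem ` set Z - {0} = sep_elem ` set Z" using sep_elem by auto
  moreover have "(\<lambda>f. monomial (lead_term \<sigma> f)) ` sep_elem ` set Z = (var ` set Z :: 'k mpoly set)"
    by (auto simp: image_image sep_elem(5) var_def)
  ultimately show "LT_ideal n \<sigma> (sep_elem ` set Z) = LT_ideal n \<sigma> J"
    unfolding LT by (simp add: LT_ideal_def)
next
  fix g assume "g \<in> sep_elem ` set Z"
  then obtain z where z: "z \<in> set Z" "g = sep_elem z" by auto
  show "g \<cdot> (lead_term \<sigma> g) = 1" using sep_elem(3,5)[OF z(1)] z by simp
  fix g' t assume "g' \<in> sep_elem ` set Z - {g}" and t: "t \<in> Poly_Mapping.keys g"
  then obtain z' where z': "z' \<in> set Z" "z' \<noteq> z" "g' = sep_elem z'" using z by auto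
  show "\<nexists>u. t = lead_term \<sigma> g' + u"
  proof
    assume "\<exists>u. t = lead_term \<sigma> g' + u"
    then have "z' \<in> Poly_Mapping.keys t" using z' by (auto simp: sep_elem(5) keys_pterm_add)
    then show False using sep_elem(6)[OF z(1), of t] t z z' by auto
  qed
qed

lemma reduced_groebner_basis_unique:
  assumes "reduced_groebner_basis n \<sigma> J G"
  shows "G = sep_elem ` set Z"
proof -
  have GJ: "G \<subseteq> J - {0}" and LTG: "LT_ideal n \<sigma> G = Idl\<^bsub>P_ring n\<^esub> (var ` set Z)"
    and monic: "\<And>g. g \<in> G \<Longrightarrow> g \<cdot> (lead_term \<sigma> g) = 1"
    and red: "\<And>g g' t u. g \<in> G \<Longrightarrow> g' \<in> G \<Longrightarrow> g' \<noteq> g \<Longrightarrow> t \<in> Poly_Mapping.keys g \<Longrightarrow> t \<noteq> lead_term \<sigma> g' + u"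
    using assms unfolding reduced_groebner_basis_def LT by blast+
  have ex: "\<exists>g\<in>G. lead_term \<sigma> g = Poly_Mapping.single z 1" if "z \<in> set Z" for z
    using lead_term_indeterminate[of G z] GJ LTG that by blast
  have eq: "g = sep_elem z" if g: "g \<in> G" and z: "z \<in> set Z" and l: "lead_term \<sigma> g = Poly_Mapping.single z 1" for g z
  proof -
    have gJ: "g \<in> J" "g \<in> P" "g \<noteq> 0" using g GJ JD(1) by auto
    note lt = lead_term[OF ord gJ(2,3), unfolded l]
    have "g - sep_elem z \<in> P'"
      unfolding in_P'_iff
    proof (intro conjI ballI)
      show "g - sep_elem z \<in> P" using gJ sep_elem(2)[OF z] by (intro poly_ring_closed)
      fix u assume u: "u \<in> Poly_Mapping.keys (g - sep_elem z)"
      have "(g - sep_elem z) \<cdot> (Poly_Mapping.single z 1) = 0"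
        using monic[OF g] sep_elem(3)[OF z z] by (simp add: lookup_minus l)
      then have uz: "u \<noteq> Poly_Mapping.single z 1" using u by (auto simp: in_keys_iff)
      show "Poly_Mapping.keys u \<inter> set Z = {}"
      proof (rule ccontr)
        assume *: "Poly_Mapping.keys u \<inter> set Z \<noteq> {}"
        then have ug: "u \<in> Poly_Mapping.keys g"
          using sep_elem(6)[OF z, of u] uz u keys_minus_subset[of g "sep_elem z"] by blast
        from * obtain z' v where z': "z' \<in> set Z" "u = Poly_Mapping.single z' 1 + v"
          using single_dvd_iff[of u] by blast
        show False
        proof (cases "z' = z")
          case True
          have "v \<in> terms {1..n}" using ug gJ(2) z' by (auto simp: carrier_poly_ring terms_add_iff)
          moreover have "Poly_Mapping.single z 1 \<in> terms {1..n}"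
            using z Z single_in_terms by auto
          ultimately have "(Poly_Mapping.single z 1, u) \<in> \<sigma>"
            using term_orderingD(6)[OF ord term_ordering_zero_least[OF ord]] z' True
            by (metis add.commute add_0)
          then show False using antisymD[OF term_orderingD(2)[OF ord]] lt(2)[OF ug] uz by blast
        next
          case False
          obtain g' where g': "g' \<in> G" "lead_term \<sigma> g' = Poly_Mapping.single z' 1"
            using ex[OF z'(1)] by blast
          have "g' \<noteq> g" using g'(2) l False by (auto simp: single_one_eq_iff)
          then show False using red[OF g g'(1) _ ug, of v] g' z' by auto
        qed
      qed
    qed
    moreover have "g - sep_elem z \<in> J" using gJ sep_elem(1)[OF z] by (intro JD(4))
    ultimately have "g - sep_elem z = 0" using J_Int_P' by blast
    then show ?thesis by simp
  qed
  show ?thesis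
  proof (rule subset_antisym)
    show "sep_elem ` set Z \<subseteq> G" using ex eq by blast
    show "G \<subseteq> sep_elem ` set Z"
    proof
      fix g assume g: "g \<in> G"
      then have "g \<in> J" "g \<noteq> 0" "g \<in> P" using GJ JD(1) by auto
      then obtain z v where z: "z \<in> set Z" "lead_term \<sigma> g = Poly_Mapping.single z 1 + v"
        using lead_term_hits_Z[of g] single_dvd_iff[of "lead_term \<sigma> g"] by blast
      obtain g' where g': "g' \<in> G" "lead_term \<sigma> g' = Poly_Mapping.single z 1"
        using ex[OF z(1)] by blast
      have "g' = g"
        using red[OF g g'(1) _ lead_term(1)[OF ord \<open>g \<in> P\<close> \<open>g \<noteq> 0\<close>], of v] g' z by auto
      then show "g \<in> sep_elem ` set Z" using eq[OF g z(1)] g' z(1) by auto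
    qed
  qed
qed

lemma sep_tail_eq:
  assumes z: "z \<in> set Z"
  shows "sep_tail n Z J \<sigma> z = nf (var z)"
proof -
  have "the_reduced_groebner_basis n \<sigma> J = sep_elem ` set Z"
    unfolding the_reduced_groebner_basis_def
    using reduced_groebner_basis_sep_elem reduced_groebner_basis_unique by (rule the_equality)
  moreover have "h = nf (var z)" if h: "h \<in> P'" "var z - h = sep_elem z'" "z' \<in> set Z" for h z'
  proof -
    have "(var z - h) \<cdot> (Poly_Mapping.single z 1) = 1"
      using lookup_P'[OF h(1), of "Poly_Mapping.single z 1"] z
      by (simp add: lookup_minus var_def monomial_def)
    then have "z' = z" using sep_elem(3)[OF h(3) z] h(2) by (auto split: if_splits)
    then show ?thesis using h(2) by (simp add: sep_elem_def)
  qed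
  moreover have "var z - nf (var z) \<in> sep_elem ` set Z"
    using z by (intro image_eqI[of _ _ z]) (simp_all add: sep_elem_def)
  ultimately show ?thesis
    unfolding sep_tail_def using nf(1)[OF var_in_P[OF z]]
    by (intro the_equality) (simp, blast)
qed

end

section \<open>Localization and the local ring of a quotient\<close>

lemma primeideal_vimage:
  assumes h: "h \<in> ring_hom R S" and R: "cring R" and S: "cring S" and p: "primeideal p S"
  shows "primeideal {a \<in> carrier R. h a \<in> p} R"
proof -
  interpret h: ring_hom_cring R S h
    using h R S by (intro ring_hom_cring.intro ring_hom_cring_axioms.intro)
  interpret p: primeideal p S by (rule p)
  show ?thesis
  proof (rule primeidealI)
    show "ideal {a \<in> carrier R. h a \<in> p} R"
      by (rule h.ring.ideal_vimage[OF p.ideal_axioms])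
    show "cring R" by (rule R)
    have "h \<one>\<^bsub>R\<^esub> \<notin> p"
      using p.I_notcarr p.one_imp_carrier by auto
    then show "carrier R \<noteq> {a \<in> carrier R. h a \<in> p}" using h.R.one_closed by blast
    fix a b assume "a \<in> carrier R" "b \<in> carrier R" "a \<otimes>\<^bsub>R\<^esub> b \<in> {a \<in> carrier R. h a \<in> p}"
    then show "a \<in> {a \<in> carrier R. h a \<in> p} \<or> b \<in> {a \<in> carrier R. h a \<in> p}"
      using p.I_prime[of "h a" "h b"] by simp
  qed
qed

text \<open>Localization of \<open>R\<close> at a multiplicatively closed set \<open>S\<close>.\<close>

locale localized_ring = cring R for R (structure) +
  fixes S
  assumes S_carrier: "S \<subseteq> carrier R" and S_one: "\<one> \<in> S"
    and S_mult: "s \<in> S \<Longrightarrow> t \<in> S \<Longrightarrow> s \<otimes> t \<in> S"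
begin

abbreviation "F \<equiv> fraction R S"
abbreviation "Q \<equiv> localization R S"

lemma S_closed [simp]: "s \<in> S \<Longrightarrow> s \<in> carrier R"
  using S_carrier by blast

lemma in_fraction_iff:
  assumes "a \<in> carrier R" "b \<in> S"
  shows "(c, d) \<in> F a b \<longleftrightarrow> c \<in> carrier R \<and> d \<in> S \<and> (\<exists>t\<in>S. t \<otimes> (a \<otimes> d) = t \<otimes> (b \<otimes> c))"
proof -
  have "t \<otimes> (a \<otimes> d \<ominus> b \<otimes> c) = \<zero> \<longleftrightarrow> t \<otimes> (a \<otimes> d) = t \<otimes> (b \<otimes> c)"
    if "c \<in> carrier R" "d \<in> S" "t \<in> S" for t
  proof -
    have "t \<otimes> (a \<otimes> d \<ominus> b \<otimes> c) = t \<otimes> (a \<otimes> d) \<ominus> t \<otimes> (b \<otimes> c)"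
      using assms that by (simp add: a_minus_def r_distr r_minus)
    then show ?thesis using assms that by simp
  qed
  then show ?thesis unfolding fraction_def by auto
qed

lemma fraction_eq_iff:
  assumes "a \<in> carrier R" "b \<in> S" "c \<in> carrier R" "d \<in> S"
  shows "F a b = F c d \<longleftrightarrow> (\<exists>t\<in>S. t \<otimes> (a \<otimes> d) = t \<otimes> (c \<otimes> b))"
proof
  assume "F a b = F c d"
  moreover have "(c, d) \<in> F c d"
    using assms S_one by (auto simp: in_fraction_iff m_comm intro!: bexI[of _ \<one>])
  ultimately have "\<exists>t\<in>S. t \<otimes> (a \<otimes> d) = t \<otimes> (b \<otimes> c)"
    using in_fraction_iff[OF assms(1,2), of c d] by blast
  then show "\<exists>t\<in>S. t \<otimes> (a \<otimes> d) = t \<otimes> (c \<otimes> b)"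
    using assms m_comm[of b c] by simp
next
  have sub: "F a b \<subseteq> F c d"
    if car: "a \<in> carrier R" "b \<in> S" "c \<in> carrier R" "d \<in> S"
      and t: "t \<in> S" "t \<otimes> (a \<otimes> d) = t \<otimes> (c \<otimes> b)" for a b c d t
  proof (rule subrelI)
    fix x y assume "(x, y) \<in> F a b"
    then obtain u where u: "x \<in> carrier R" "y \<in> S" "u \<in> S" "u \<otimes> (a \<otimes> y) = u \<otimes> (b \<otimes> x)"
      using car by (auto simp: in_fraction_iff)
    have "(t \<otimes> u \<otimes> b) \<otimes> (c \<otimes> y) = (t \<otimes> (c \<otimes> b)) \<otimes> (u \<otimes> y)"
      using car t(1) u(1-3) by (simp add: m_ac)
    also have "\<dots> = (u \<otimes> (a \<otimes> y)) \<otimes> (t \<otimes> d)"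
      unfolding t(2)[symmetric] using car t(1) u(1-3) by (simp add: m_ac)
    also have "\<dots> = (t \<otimes> u \<otimes> b) \<otimes> (d \<otimes> x)"
      unfolding u(4) using car t(1) u(1-3) by (simp add: m_ac)
    finally show "(x, y) \<in> F c d"
      using car t u S_mult by (auto simp: in_fraction_iff)
  qed
  assume "\<exists>t\<in>S. t \<otimes> (a \<otimes> d) = t \<otimes> (c \<otimes> b)"
  then obtain t where "t \<in> S" "t \<otimes> (a \<otimes> d) = t \<otimes> (c \<otimes> b)" by blast
  then show "F a b = F c d" using sub[of a b c d t] sub[of c d a b t] assms by auto
qed

lemma fraction_self: "a \<in> carrier R \<Longrightarrow> b \<in> S \<Longrightarrow> (a, b) \<in> F a b"
  using S_one by (auto simp: in_fraction_iff m_comm intro!: bexI[of _ \<one>])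

lemma Q_carrier: "carrier Q = {F a b | a b. a \<in> carrier R \<and> b \<in> S}"
  by (simp add: localization_def)

lemma fraction_in_Q [simp]: "a \<in> carrier R \<Longrightarrow> b \<in> S \<Longrightarrow> F a b \<in> carrier Q"
  by (auto simp: Q_carrier)

lemma Q_one: "\<one>\<^bsub>Q\<^esub> = F \<one> \<one>" and Q_zero: "\<zero>\<^bsub>Q\<^esub> = F \<zero> \<one>"
  by (simp_all add: localization_def)

lemma Union_over_fractions:
  assumes "a \<in> carrier R" "b \<in> S" "c \<in> carrier R" "d \<in> S"
    and "\<And>a' b' c' d' t u. a' \<in> carrier R \<Longrightarrow> b' \<in> S \<Longrightarrow> c' \<in> carrier R \<Longrightarrow> d' \<in> S \<Longrightarrow> t \<in> S \<Longrightarrow> u \<in> S \<Longrightarrow>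
      t \<otimes> (a \<otimes> b') = t \<otimes> (b \<otimes> a') \<Longrightarrow> u \<otimes> (c \<otimes> d') = u \<otimes> (d \<otimes> c') \<Longrightarrow> G a' b' c' d' = C"
  shows "(\<Union>(a', b')\<in>F a b. \<Union>(c', d')\<in>F c d. G a' b' c' d') = C"
proof -
  have "G a' b' c' d' = C" if "(a', b') \<in> F a b" "(c', d') \<in> F c d" for a' b' c' d'
    using that assms by (auto simp: in_fraction_iff)
  moreover have "(a, b) \<in> F a b" "(c, d) \<in> F c d" using assms fraction_self by auto
  ultimately show ?thesis by fast
qed

lemma Q_mult:
  assumes "a \<in> carrier R" "b \<in> S" "c \<in> carrier R" "d \<in> S"
  shows "F a b \<otimes>\<^bsub>Q\<^esub> F c d = F (a \<otimes> c) (b \<otimes> d)"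
proof -
  have "(\<Union>(a', b')\<in>F a b. \<Union>(c', d')\<in>F c d. F (a' \<otimes> c') (b' \<otimes> d')) = F (a \<otimes> c) (b \<otimes> d)"
  proof (rule Union_over_fractions[OF assms])
    fix a' b' c' d' t u
    assume h: "a' \<in> carrier R" "b' \<in> S" "c' \<in> carrier R" "d' \<in> S" "t \<in> S" "u \<in> S"
      and e: "t \<otimes> (a \<otimes> b') = t \<otimes> (b \<otimes> a')" "u \<otimes> (c \<otimes> d') = u \<otimes> (d \<otimes> c')"
    have "(t \<otimes> u) \<otimes> ((a' \<otimes> c') \<otimes> (b \<otimes> d)) = (t \<otimes> (b \<otimes> a')) \<otimes> (u \<otimes> (d \<otimes> c'))"
      using assms h by (simp add: m_ac)
    also have "\<dots> = (t \<otimes> u) \<otimes> ((a \<otimes> c) \<otimes> (b' \<otimes> d'))"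
      unfolding e[symmetric] using assms h by (simp add: m_ac)
    finally show "F (a' \<otimes> c') (b' \<otimes> d') = F (a \<otimes> c) (b \<otimes> d)"
      using assms h S_mult by (subst fraction_eq_iff) auto
  qed
  then show ?thesis by (simp add: localization_def)
qed

lemma Q_add:
  assumes "a \<in> carrier R" "b \<in> S" "c \<in> carrier R" "d \<in> S"
  shows "F a b \<oplus>\<^bsub>Q\<^esub> F c d = F (a \<otimes> d \<oplus> c \<otimes> b) (b \<otimes> d)"
proof -
  have "(\<Union>(a', b')\<in>F a b. \<Union>(c', d')\<in>F c d. F (a' \<otimes> d' \<oplus> c' \<otimes> b') (b' \<otimes> d')) =
    F (a \<otimes> d \<oplus> c \<otimes> b) (b \<otimes> d)"
  proof (rule Union_over_fractions[OF assms])
    fix a' b' c' d' t u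
    assume h: "a' \<in> carrier R" "b' \<in> S" "c' \<in> carrier R" "d' \<in> S" "t \<in> S" "u \<in> S"
      and e: "t \<otimes> (a \<otimes> b') = t \<otimes> (b \<otimes> a')" "u \<otimes> (c \<otimes> d') = u \<otimes> (d \<otimes> c')"
    have "(t \<otimes> u) \<otimes> ((a' \<otimes> d' \<oplus> c' \<otimes> b') \<otimes> (b \<otimes> d)) =
      (t \<otimes> (b \<otimes> a')) \<otimes> (u \<otimes> (d \<otimes> d')) \<oplus> (u \<otimes> (d \<otimes> c')) \<otimes> (t \<otimes> (b \<otimes> b'))"
      using assms h by (simp add: m_ac l_distr r_distr)
    also have "\<dots> = (t \<otimes> u) \<otimes> ((a \<otimes> d \<oplus> c \<otimes> b) \<otimes> (b' \<otimes> d'))"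
      unfolding e[symmetric] using assms h by (simp add: m_ac l_distr r_distr)
    finally show "F (a' \<otimes> d' \<oplus> c' \<otimes> b') (b' \<otimes> d') = F (a \<otimes> d \<oplus> c \<otimes> b) (b \<otimes> d)"
      using assms h S_mult by (subst fraction_eq_iff) auto
  qed
  then show ?thesis by (simp add: localization_def)
qed

lemma fraction_eqI:
  assumes "a \<in> carrier R" "b \<in> S" "c \<in> carrier R" "d \<in> S" "a \<otimes> d = c \<otimes> b"
  shows "F a b = F c d"
  using assms S_one by (subst fraction_eq_iff) auto

lemma Q_neg:
  assumes "a \<in> carrier R" "b \<in> S"
  shows "F (\<ominus> a) b \<oplus>\<^bsub>Q\<^esub> F a b = \<zero>\<^bsub>Q\<^esub>"
proof -
  have "F (\<ominus> a \<otimes> b \<oplus> a \<otimes> b) (b \<otimes> b) = F \<zero> \<one>"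
    by (rule fraction_eqI) (use assms S_mult S_one in \<open>auto simp: l_minus l_neg\<close>)
  then show ?thesis using assms by (simp add: Q_add Q_zero)
qed

lemma Q_cases:
  assumes "x \<in> carrier Q"
  obtains a b where "x = F a b" "a \<in> carrier R" "b \<in> S"
  using assms by (auto simp: Q_carrier)

lemma Q_cring: "cring Q"
proof (rule cringI)
  show "abelian_group Q"
  proof (rule abelian_groupI)
    fix x y z assume x: "x \<in> carrier Q" and y: "y \<in> carrier Q" and z: "z \<in> carrier Q"
    obtain a b where ab: "x = F a b" "a \<in> carrier R" "b \<in> S" using x by (rule Q_cases)
    obtain c d where cd: "y = F c d" "c \<in> carrier R" "d \<in> S" using y by (rule Q_cases)
    obtain e f where ef: "z = F e f" "e \<in> carrier R" "f \<in> S" using z by (rule Q_cases)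
    show "x \<oplus>\<^bsub>Q\<^esub> y \<in> carrier Q" using ab cd S_mult by (simp add: Q_add)
    show "x \<oplus>\<^bsub>Q\<^esub> y \<oplus>\<^bsub>Q\<^esub> z = x \<oplus>\<^bsub>Q\<^esub> (y \<oplus>\<^bsub>Q\<^esub> z)"
      using ab cd ef S_mult by (auto simp: Q_add m_ac l_distr r_distr a_ac)
    show "x \<oplus>\<^bsub>Q\<^esub> y = y \<oplus>\<^bsub>Q\<^esub> x"
      using ab cd S_mult by (simp add: Q_add m_ac a_ac)
    show "\<zero>\<^bsub>Q\<^esub> \<oplus>\<^bsub>Q\<^esub> x = x"
      using ab S_one by (simp add: Q_add Q_zero)
    have "F (\<ominus> a) b \<oplus>\<^bsub>Q\<^esub> x = \<zero>\<^bsub>Q\<^esub>"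
      unfolding ab(1) using ab(2,3) by (rule Q_neg)
    then show "\<exists>y\<in>carrier Q. y \<oplus>\<^bsub>Q\<^esub> x = \<zero>\<^bsub>Q\<^esub>"
      using ab by (intro bexI[of _ "F (\<ominus> a) b"]) auto
  next
    show "\<zero>\<^bsub>Q\<^esub> \<in> carrier Q" using S_one by (simp add: Q_zero)
  qed
  show "Group.comm_monoid Q"
  proof (rule comm_monoidI)
    fix x y z assume x: "x \<in> carrier Q" and y: "y \<in> carrier Q" and z: "z \<in> carrier Q"
    obtain a b where ab: "x = F a b" "a \<in> carrier R" "b \<in> S" using x by (rule Q_cases)
    obtain c d where cd: "y = F c d" "c \<in> carrier R" "d \<in> S" using y by (rule Q_cases)
    obtain e f where ef: "z = F e f" "e \<in> carrier R" "f \<in> S" using z by (rule Q_cases)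
    show "x \<otimes>\<^bsub>Q\<^esub> y \<in> carrier Q" using ab cd S_mult by (simp add: Q_mult)
    show "x \<otimes>\<^bsub>Q\<^esub> y \<otimes>\<^bsub>Q\<^esub> z = x \<otimes>\<^bsub>Q\<^esub> (y \<otimes>\<^bsub>Q\<^esub> z)"
      using ab cd ef S_mult by (simp add: Q_mult m_ac)
    show "x \<otimes>\<^bsub>Q\<^esub> y = y \<otimes>\<^bsub>Q\<^esub> x" using ab cd by (simp add: Q_mult m_ac)
    show "\<one>\<^bsub>Q\<^esub> \<otimes>\<^bsub>Q\<^esub> x = x" using ab S_one by (simp add: Q_mult Q_one)
  next
    show "\<one>\<^bsub>Q\<^esub> \<in> carrier Q" using S_one by (simp add: Q_one)
  qed
  fix x y z assume x: "x \<in> carrier Q" and y: "y \<in> carrier Q" and z: "z \<in> carrier Q"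
  obtain a b where ab: "x = F a b" "a \<in> carrier R" "b \<in> S" using x by (rule Q_cases)
  obtain c d where cd: "y = F c d" "c \<in> carrier R" "d \<in> S" using y by (rule Q_cases)
  obtain e f where ef: "z = F e f" "e \<in> carrier R" "f \<in> S" using z by (rule Q_cases)
  show "(x \<oplus>\<^bsub>Q\<^esub> y) \<otimes>\<^bsub>Q\<^esub> z = x \<otimes>\<^bsub>Q\<^esub> z \<oplus>\<^bsub>Q\<^esub> y \<otimes>\<^bsub>Q\<^esub> z"
    unfolding ab(1) cd(1) ef(1) using ab(2,3) cd(2,3) ef(2,3) S_mult
    by (simp add: Q_add Q_mult) (rule fraction_eqI, auto simp: m_ac l_distr r_distr)
qed

lemma fraction_hom: "(\<lambda>a. F a \<one>) \<in> ring_hom R Q"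
  using S_one by (intro ring_hom_memI) (auto simp: Q_mult Q_add Q_one)

end

text \<open>
  The quotient of a localization by the extension of an ideal \<open>I\<close>.  The ring and the canonical
  map \<open>to_quot\<close> from \<open>R\<close> to it are used only through the following facts: elements of \<open>S\<close> become
  units, every element is a quotient of images, and the kernel is the \<open>S\<close>-saturation of \<open>I\<close>.
\<close>

locale localized_quotient = localized_ring R S + I: ideal I R for R (structure) and S and I
begin

abbreviation "E \<equiv> Idl\<^bsub>Q\<^esub> ((\<lambda>f. F f \<one>) ` I)"
definition L where "L = Q Quot E"

definition to_quot where "to_quot a = E +>\<^bsub>Q\<^esub> F a \<one>"

sublocale Q: cring Q by (rule Q_cring)

lemma I_gens: "(\<lambda>f. F f \<one>) ` I \<subseteq> carrier Q"
  using S_one I.a_subset by auto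

lemma E_ideal: "ideal E Q"
  by (rule Q.genideal_ideal[OF I_gens])

sublocale E: ideal E Q by (rule E_ideal)

sublocale L: cring L
  unfolding L_def by (rule E.quotient_is_cring[OF Q_cring])

lemma coset_hom: "(+>\<^bsub>Q\<^esub>) E \<in> ring_hom Q L"
  unfolding L_def by (rule E.rcos_ring_hom)

lemma to_quot_hom: "to_quot \<in> ring_hom R L"
proof -
  have "(\<lambda>a. E +>\<^bsub>Q\<^esub> F a \<one>) \<in> ring_hom R L"
    using ring_hom_trans[OF fraction_hom coset_hom] by (simp add: comp_def)
  then show ?thesis by (simp add: to_quot_def[abs_def])
qed

sublocale to_quot: ring_hom_cring R L to_quot
  by unfold_locales (rule to_quot_hom)

lemma E_subset:
  assumes "x \<in> E"
  shows "\<exists>a\<in>I. \<exists>s\<in>S. x = F a s"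
proof -
  let ?E = "{x \<in> carrier Q. \<exists>a\<in>I. \<exists>s\<in>S. x = F a s}"
  have mem: "F a s \<in> ?E" if "a \<in> I" "s \<in> S" for a s
  proof -
    have "F a s \<in> carrier Q" using that I.a_subset by (intro fraction_in_Q) auto
    then show ?thesis using that by blast
  qed
  have "ideal ?E Q"
  proof (rule idealI[OF Q.ring_axioms])
    show "subgroup ?E (add_monoid Q)"
    proof (rule Q.add.subgroupI)
      show "?E \<subseteq> carrier Q" by auto
      have "\<zero>\<^bsub>Q\<^esub> \<in> ?E"
        unfolding Q_zero using additive_subgroup.zero_closed[OF I.additive_subgroup_axioms] S_one by (rule mem)
      then show "?E \<noteq> {}" by blast
      fix x y assume x: "x \<in> ?E" and y: "y \<in> ?E"
      obtain a s where a: "a \<in> I" "s \<in> S" "x = F a s" using x by blast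
      obtain b t where b: "b \<in> I" "t \<in> S" "y = F b t" using y by blast
      have ac: "a \<in> carrier R" "b \<in> carrier R" using a b I.a_subset by auto
      have "x \<oplus>\<^bsub>Q\<^esub> y = F (a \<otimes> t \<oplus> b \<otimes> s) (s \<otimes> t)" using a b ac by (simp add: Q_add)
      moreover have "a \<otimes> t \<oplus> b \<otimes> s \<in> I" using a b by (simp add: I.I_r_closed I.a_closed)
      ultimately show "x \<oplus>\<^bsub>Q\<^esub> y \<in> ?E"
        using mem S_mult[OF a(2) b(2)] by simp
      have "F (\<ominus> a) s \<oplus>\<^bsub>Q\<^esub> x = \<zero>\<^bsub>Q\<^esub>"
        unfolding a(3) using ac(1) a(2) by (rule Q_neg)
      then have "\<ominus>\<^bsub>Q\<^esub> x = F (\<ominus> a) s" using a ac by (intro Q.minus_equality) auto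
      then show "\<ominus>\<^bsub>Q\<^esub> x \<in> ?E"
        using mem[OF additive_subgroup.a_inv_closed[OF I.additive_subgroup_axioms a(1)] a(2)] by simp
    qed
    fix x y assume x: "x \<in> ?E" and y: "y \<in> carrier Q"
    obtain a s where a: "a \<in> I" "s \<in> S" "x = F a s" using x by blast
    obtain b t where b: "b \<in> carrier R" "t \<in> S" "y = F b t" using y by (elim Q_cases)
    have ac: "a \<in> carrier R" using a I.a_subset by auto
    have "y \<otimes>\<^bsub>Q\<^esub> x = F (b \<otimes> a) (t \<otimes> s)" using a b ac by (simp add: Q_mult)
    then show "y \<otimes>\<^bsub>Q\<^esub> x \<in> ?E"
      using mem[OF I.I_l_closed[OF a(1) b(1)] S_mult[OF b(2) a(2)]] by simp
    then show "x \<otimes>\<^bsub>Q\<^esub> y \<in> ?E" using x y by (simp add: Q.m_comm)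
  qed
  moreover have "(\<lambda>f. F f \<one>) ` I \<subseteq> ?E" using I_gens S_one by auto
  ultimately have "E \<subseteq> ?E" by (rule Q.genideal_minimal)
  then show ?thesis using assms by blast
qed

lemma to_quot_eq_zero_iff:
  assumes a: "a \<in> carrier R"
  shows "to_quot a = \<zero>\<^bsub>L\<^esub> \<longleftrightarrow> (\<exists>u\<in>S. u \<otimes> a \<in> I)"
proof -
  have "to_quot a = \<zero>\<^bsub>L\<^esub> \<longleftrightarrow> F a \<one> \<in> E"
    unfolding to_quot_def L_def FactRing_def
    using a S_one E.rcos_const_imp_mem[of "F a \<one>"] Q.a_rcos_zero[OF E_ideal, of "F a \<one>"] by auto
  also have "\<dots> \<longleftrightarrow> (\<exists>u\<in>S. u \<otimes> a \<in> I)"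
  proof
    assume "F a \<one> \<in> E"
    then obtain b s where b: "b \<in> I" "s \<in> S" "F a \<one> = F b s" using E_subset by blast
    have "b \<in> carrier R" using b I.a_subset by auto
    then obtain t where t: "t \<in> S" "t \<otimes> (a \<otimes> s) = t \<otimes> (b \<otimes> \<one>)"
      using b a S_one by (auto simp: fraction_eq_iff)
    have "(t \<otimes> s) \<otimes> a = t \<otimes> b" using t a b \<open>b \<in> carrier R\<close> by (simp add: m_ac)
    also have "\<dots> \<in> I" using b t by (simp add: I.I_l_closed)
    finally show "\<exists>u\<in>S. u \<otimes> a \<in> I" using S_mult t b by blast
  next
    assume "\<exists>u\<in>S. u \<otimes> a \<in> I"
    then obtain u where u: "u \<in> S" "u \<otimes> a \<in> I" by blast
    have "F \<one> u \<otimes>\<^bsub>Q\<^esub> F (u \<otimes> a) \<one> \<in> E"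
      using u S_one Q.genideal_self[OF I_gens] by (intro E.I_l_closed) auto
    moreover have "F \<one> u \<otimes>\<^bsub>Q\<^esub> F (u \<otimes> a) \<one> = F a \<one>"
      using u a S_one S_mult by (simp add: Q_mult) (rule fraction_eqI, auto simp: m_ac)
    ultimately show "F a \<one> \<in> E" by simp
  qed
  finally show ?thesis .
qed

lemma to_quot_eq_iff:
  assumes "a \<in> carrier R" "b \<in> carrier R"
  shows "to_quot a = to_quot b \<longleftrightarrow> (\<exists>u\<in>S. u \<otimes> (a \<ominus> b) \<in> I)"
proof -
  have "to_quot (a \<ominus> b) = to_quot a \<ominus>\<^bsub>L\<^esub> to_quot b"
    using assms by (simp add: a_minus_def)
  then have "to_quot a = to_quot b \<longleftrightarrow> to_quot (a \<ominus> b) = \<zero>\<^bsub>L\<^esub>"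
    using assms L.r_right_minus_eq[of "to_quot a" "to_quot b"] by simp
  then show ?thesis using to_quot_eq_zero_iff[of "a \<ominus> b"] assms by simp
qed

lemma to_quot_unit:
  assumes "s \<in> S"
  shows "to_quot s \<in> Units L"
proof -
  have "F s \<one> \<otimes>\<^bsub>Q\<^esub> F \<one> s = \<one>\<^bsub>Q\<^esub>"
    using assms S_one S_mult by (simp add: Q_mult Q_one) (rule fraction_eqI, auto)
  then have "(E +>\<^bsub>Q\<^esub> F s \<one>) \<otimes>\<^bsub>L\<^esub> (E +>\<^bsub>Q\<^esub> F \<one> s) = \<one>\<^bsub>L\<^esub>"
    using assms S_one ring_hom_memE(2)[OF coset_hom, of "F s \<one>" "F \<one> s"]
      ring_hom_memE(4)[OF coset_hom] by simp
  then have inv: "to_quot s \<otimes>\<^bsub>L\<^esub> (E +>\<^bsub>Q\<^esub> F \<one> s) = \<one>\<^bsub>L\<^esub>"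
    by (simp only: to_quot_def)
  have car: "E +>\<^bsub>Q\<^esub> F \<one> s \<in> carrier L"
    using assms ring_hom_memE(1)[OF coset_hom] by simp
  have "to_quot s \<in> carrier L" using assms by simp
  then show ?thesis
    using car inv L.m_comm[OF car] unfolding Units_def by blast
qed

lemma L_cases:
  assumes "r \<in> carrier L"
  obtains a s where "a \<in> carrier R" "s \<in> S" "r \<otimes>\<^bsub>L\<^esub> to_quot s = to_quot a"
proof -
  obtain x where x: "x \<in> carrier Q" "r = E +>\<^bsub>Q\<^esub> x"
    using assms unfolding L_def FactRing_def A_RCOSETS_def' partial_object.simps by blast
  obtain a s where as: "x = F a s" "a \<in> carrier R" "s \<in> S" using x(1) by (rule Q_cases)
  have "F a s \<otimes>\<^bsub>Q\<^esub> F s \<one> = F a \<one>"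
    using as S_one S_mult by (simp add: Q_mult) (rule fraction_eqI, auto simp: m_ac)
  then have "r \<otimes>\<^bsub>L\<^esub> to_quot s = to_quot a"
    using as S_one ring_hom_memE(2)[OF coset_hom, of "F a s" "F s \<one>"]
    by (simp add: x(2) to_quot_def)
  with as that show thesis by blast
qed

subsection \<open>Ideals of the local ring\<close>

lemma unit_in_ideal:
  assumes "ideal K L" "x \<in> K" "x \<in> Units L"
  shows "K = carrier L"
proof -
  obtain y where y: "y \<in> carrier L" "y \<otimes>\<^bsub>L\<^esub> x = \<one>\<^bsub>L\<^esub>"
    using assms(3) by (auto simp: Units_def)
  have "\<one>\<^bsub>L\<^esub> \<in> K" using ideal.I_l_closed[OF assms(1,2) y(1)] y(2) by simp
  then show ?thesis by (rule ideal.one_imp_carrier[OF assms(1)])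
qed

lemma prime_vimage: "primeideal p L \<Longrightarrow> primeideal {a \<in> carrier R. to_quot a \<in> p} R"
  by (rule primeideal_vimage[OF to_quot_hom cring_axioms L.is_cring])

text \<open>Distinct comparable primes have distinct preimages, because their difference contains the image of an element of \<open>R\<close>.\<close>

lemma prime_strict:
  assumes p: "primeideal p L" and q: "primeideal q L" and "p \<subset> q"
  shows "\<exists>a\<in>carrier R. to_quot a \<in> q \<and> to_quot a \<notin> p"
proof -
  interpret p: primeideal p L by (rule p)
  interpret q: primeideal q L by (rule q)
  obtain r where r: "r \<in> q" "r \<notin> p" using \<open>p \<subset> q\<close> by blast
  have rL: "r \<in> carrier L" using r(1) q.a_subset by blast
  obtain a s where as: "a \<in> carrier R" "s \<in> S" "r \<otimes>\<^bsub>L\<^esub> to_quot s = to_quot a" using rL by (rule L_cases)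
  have sL: "to_quot s \<in> carrier L" using as(2) by simp
  have "to_quot a \<in> q" using q.I_r_closed[OF r(1) sL] as(3) by simp
  moreover have "to_quot s \<notin> p"
    using unit_in_ideal[OF p.ideal_axioms _ to_quot_unit[OF as(2)]] p.I_notcarr by blast
  then have "to_quot a \<notin> p" using p.I_prime[OF rL sL] as(3) r(2) by auto
  ultimately show ?thesis using as(1) by blast
qed

text \<open>The extension of an ideal \<open>X\<close> of \<open>R\<close>: the quotients with numerator in \<open>X\<close>.\<close>

definition extension where
  "extension X = {r \<in> carrier L. \<exists>f\<in>X. \<exists>s\<in>S. r \<otimes>\<^bsub>L\<^esub> to_quot s = to_quot f}"

lemma extensionI:
  "r \<in> carrier L \<Longrightarrow> f \<in> X \<Longrightarrow> s \<in> S \<Longrightarrow> r \<otimes>\<^bsub>L\<^esub> to_quot s = to_quot f \<Longrightarrow> r \<in> extension X"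
  unfolding extension_def by blast

lemma extensionE:
  assumes "r \<in> extension X"
  obtains f s where "f \<in> X" "s \<in> S" "r \<otimes>\<^bsub>L\<^esub> to_quot s = to_quot f" "r \<in> carrier L"
  using assms unfolding extension_def by blast

lemma extension_ideal:
  assumes "ideal X R"
  shows "ideal (extension X) L"
proof -
  interpret X: ideal X R by fact
  have XR: "f \<in> X \<Longrightarrow> f \<in> carrier R" for f using X.a_subset by blast
  show ?thesis
  proof (rule idealI[OF L.ring_axioms])
    show "subgroup (extension X) (add_monoid L)"
    proof (rule L.add.subgroupI)
      show "extension X \<subseteq> carrier L" by (auto simp: extension_def)
      have "\<zero> \<in> X" by (rule additive_subgroup.zero_closed[OF X.additive_subgroup_axioms])
      then have "\<zero>\<^bsub>L\<^esub> \<in> extension X" using S_one by (intro extensionI[of _ "\<zero>" X "\<one>"]) auto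
      then show "extension X \<noteq> {}" by blast
      fix x y assume x: "x \<in> extension X" and y: "y \<in> extension X"
      obtain f s where f: "f \<in> X" "s \<in> S" "x \<otimes>\<^bsub>L\<^esub> to_quot s = to_quot f" "x \<in> carrier L"
        using x by (rule extensionE)
      obtain g t where g: "g \<in> X" "t \<in> S" "y \<otimes>\<^bsub>L\<^esub> to_quot t = to_quot g" "y \<in> carrier L"
        using y by (rule extensionE)
      show "\<ominus>\<^bsub>L\<^esub> x \<in> extension X"
      proof (rule extensionI)
        show "\<ominus> f \<in> X" using f(1) by (rule additive_subgroup.a_inv_closed[OF X.additive_subgroup_axioms])
        show "s \<in> S" by (rule f(2))
        show "\<ominus>\<^bsub>L\<^esub> x \<otimes>\<^bsub>L\<^esub> to_quot s = to_quot (\<ominus> f)"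
          using f XR by (simp add: L.l_minus)
      qed (rule L.a_inv_closed[OF f(4)])
      show "x \<oplus>\<^bsub>L\<^esub> y \<in> extension X"
      proof (rule extensionI)
        show "f \<otimes> t \<oplus> g \<otimes> s \<in> X"
          using f(1,2) g(1,2) by (intro additive_subgroup.a_closed[OF X.additive_subgroup_axioms] X.I_r_closed) simp_all
        show "s \<otimes> t \<in> S" using f g S_mult by blast
        have "(x \<oplus>\<^bsub>L\<^esub> y) \<otimes>\<^bsub>L\<^esub> to_quot (s \<otimes> t) =
          (x \<otimes>\<^bsub>L\<^esub> to_quot s) \<otimes>\<^bsub>L\<^esub> to_quot t \<oplus>\<^bsub>L\<^esub> (y \<otimes>\<^bsub>L\<^esub> to_quot t) \<otimes>\<^bsub>L\<^esub> to_quot s"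
          using f(2,4) g(2,4) by (simp add: L.l_distr L.r_distr L.m_ac)
        also have "\<dots> = to_quot (f \<otimes> t \<oplus> g \<otimes> s)"
          unfolding f(3) g(3) using f(1,2) g(1,2) XR by simp
        finally show "(x \<oplus>\<^bsub>L\<^esub> y) \<otimes>\<^bsub>L\<^esub> to_quot (s \<otimes> t) = to_quot (f \<otimes> t \<oplus> g \<otimes> s)" .
      qed (rule L.a_closed[OF f(4) g(4)])
    qed
    fix x y assume x: "x \<in> extension X" and y: "y \<in> carrier L"
    obtain f s where f: "f \<in> X" "s \<in> S" "x \<otimes>\<^bsub>L\<^esub> to_quot s = to_quot f" "x \<in> carrier L"
      using x by (rule extensionE)
    obtain g t where g: "g \<in> carrier R" "t \<in> S" "y \<otimes>\<^bsub>L\<^esub> to_quot t = to_quot g" using y by (rule L_cases)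
    show yx: "y \<otimes>\<^bsub>L\<^esub> x \<in> extension X"
    proof (rule extensionI)
      show "g \<otimes> f \<in> X" using X.I_l_closed f(1) g(1) by blast
      show "t \<otimes> s \<in> S" using f g S_mult by blast
      have "(y \<otimes>\<^bsub>L\<^esub> x) \<otimes>\<^bsub>L\<^esub> to_quot (t \<otimes> s) = (y \<otimes>\<^bsub>L\<^esub> to_quot t) \<otimes>\<^bsub>L\<^esub> (x \<otimes>\<^bsub>L\<^esub> to_quot s)"
        using f(2,4) g(2) y by (simp add: L.m_ac)
      also have "\<dots> = to_quot (g \<otimes> f)" unfolding f(3) g(3) using f(1) g(1) XR by simp
      finally show "(y \<otimes>\<^bsub>L\<^esub> x) \<otimes>\<^bsub>L\<^esub> to_quot (t \<otimes> s) = to_quot (g \<otimes> f)" .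
    qed (rule L.m_closed[OF y f(4)])
    show "x \<otimes>\<^bsub>L\<^esub> y \<in> extension X" using yx L.m_comm[OF f(4) y] by simp
  qed
qed

lemma in_extension:
  assumes "f \<in> X" "f \<in> carrier R"
  shows "to_quot f \<in> extension X"
proof -
  have "to_quot f \<otimes>\<^bsub>L\<^esub> to_quot \<one> = to_quot f" using assms(2) by simp
  moreover have "to_quot f \<in> carrier L" using assms(2) by simp
  ultimately show ?thesis using assms(1) S_one by (intro extensionI)
qed

text \<open>An \<open>S\<close>-saturated ideal containing \<open>I\<close> is recovered from its extension.\<close>

lemma extension_contraction:
  assumes X: "ideal X R" and IX: "I \<subseteq> X"
    and sat: "\<And>f s. f \<in> carrier R \<Longrightarrow> s \<in> S \<Longrightarrow> s \<otimes> f \<in> X \<Longrightarrow> f \<in> X"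
    and g: "g \<in> carrier R" "to_quot g \<in> extension X"
  shows "g \<in> X"
proof -
  interpret X: ideal X R by (rule X)
  obtain f s where f: "f \<in> X" "s \<in> S" "to_quot g \<otimes>\<^bsub>L\<^esub> to_quot s = to_quot f"
    using g(2) by (rule extensionE)
  have fR: "f \<in> carrier R" using f(1) X.a_subset by blast
  have "to_quot (g \<otimes> s) = to_quot f" using f g fR by simp
  then obtain u where u: "u \<in> S" "u \<otimes> (g \<otimes> s \<ominus> f) \<in> I"
    using to_quot_eq_iff[of "g \<otimes> s" f] f(2) g(1) fR by (metis S_closed m_closed)
  have "g \<otimes> s \<ominus> f \<in> carrier R" using f(2) g(1) fR by simp
  then have "g \<otimes> s \<ominus> f \<in> X" using u(1) subsetD[OF IX u(2)] by (rule sat)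
  then have "(g \<otimes> s \<ominus> f) \<oplus> f \<in> X"
    using f(1) by (rule additive_subgroup.a_closed[OF X.additive_subgroup_axioms])
  moreover have "(g \<otimes> s \<ominus> f) \<oplus> f = s \<otimes> g"
    using f(2) g(1) fR by (simp add: a_minus_def a_assoc l_neg m_comm)
  ultimately have "s \<otimes> g \<in> X" by simp
  with g(1) f(2) show ?thesis by (rule sat)
qed

lemma extension_maximal:
  assumes M: "primeideal M R" and IM: "I \<subseteq> M" and S: "S = carrier R - M"
  shows "maximalideal (extension M) L"
proof -
  interpret M: primeideal M R by (rule M)
  note ext = extension_ideal[OF M.ideal_axioms]
  show ?thesis
  proof (rule maximalidealI[OF ext])
    have "to_quot \<one> \<notin> extension M"
    proof
      assume "to_quot \<one> \<in> extension M"
      have "f \<in> M" if "f \<in> carrier R" "s \<in> S" "s \<otimes> f \<in> M" for f s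
        using M.I_prime[of s f] that S by blast
      then have "\<one> \<in> M"
        using \<open>to_quot \<one> \<in> extension M\<close>
        by (rule extension_contraction[OF M.ideal_axioms IM _ one_closed])
      then show False using S_one S by blast
    qed
    then show "carrier L \<noteq> extension M" using L.one_closed by auto
    fix K assume K: "ideal K L" "extension M \<subseteq> K" "K \<subseteq> carrier L"
    show "K = extension M \<or> K = carrier L"
    proof (rule disjCI)
      assume "K \<noteq> carrier L"
      show "K = extension M"
      proof (rule ccontr)
        assume "K \<noteq> extension M"
        then obtain r where r: "r \<in> K" "r \<notin> extension M" using K by blast
        then have rL: "r \<in> carrier L" using K by blast
        obtain f s where f: "f \<in> carrier R" "s \<in> S" "r \<otimes>\<^bsub>L\<^esub> to_quot s = to_quot f"
          using rL by (rule L_cases)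
        have "f \<notin> M"
        proof
          assume "f \<in> M"
          with rL have "r \<in> extension M" using f(2,3) by (rule extensionI)
          then show False using r(2) by contradiction
        qed
        then have "f \<in> S" using f(1) S by blast
        then have unit: "to_quot f \<in> Units L" by (rule to_quot_unit)
        have "to_quot f \<in> K" using ideal.I_r_closed[OF K(1) r(1), of "to_quot s"] f by simp
        from unit_in_ideal[OF K(1) this unit] \<open>K \<noteq> carrier L\<close> show False by contradiction
      qed
    qed
  qed
qed

end

section \<open>The local ring at the origin\<close>

lemma max_ideal_prime: "primeideal (max_ideal n) (P_ring n :: 'k::field mpoly ring)"
proof (rule primeidealI)
  have "ideal (Idl\<^bsub>P_ring n\<^esub> (var ` {1..n}) :: 'k mpoly set) (P_ring n)"
    by (rule ring.genideal_ideal[OF poly_ring_ring]) (auto simp: var_in_carrier)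
  then show "ideal (max_ideal n :: 'k mpoly set) (P_ring n)" by (simp add: max_ideal_def)
  show "cring (P_ring n :: 'k mpoly ring)" by (rule poly_ring_cring)
  have "(1 :: 'k mpoly) \<notin> max_ideal n" by (simp add: max_ideal_eq)
  then show "carrier (P_ring n) \<noteq> (max_ideal n :: 'k mpoly set)"
    using poly_ring_const_closed(2) by blast
next
  fix f g :: "'k mpoly"
  assume "f \<in> carrier (P_ring n)" "g \<in> carrier (P_ring n)" "f \<otimes>\<^bsub>P_ring n\<^esub> g \<in> max_ideal n"
  then show "f \<in> max_ideal n \<or> g \<in> max_ideal n"
    by (simp add: max_ideal_eq lookup_mult_low_degree)
qed

text \<open>
  An ideal \<open>I\<close> vanishing at the origin and containing an ideal \<open>J\<close> whose leading terms generate
  $\langle z_1,\dots,z_s\rangle$; both are present until \<open>I = J\<close> is known.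
\<close>

locale separated_subideal = separated_ideal n Z J \<sigma>
  for n :: nat and Z :: "nat list" and J :: "'k::field mpoly set" and \<sigma> +
  fixes I :: "'k mpoly set"
  assumes I: "ideal I (P_ring n)" and JI: "J \<subseteq> I" and IM: "I \<subseteq> max_ideal n"
begin

abbreviation "S \<equiv> carrier (P_ring n) - (max_ideal n :: 'k mpoly set)"

lemmas ID = ideal_poly_ringD[OF I]

lemma S_iff: "s \<in> S \<longleftrightarrow> s \<in> P \<and> s \<cdot> 0 \<noteq> 0"
  by (auto simp: max_ideal_eq)

sublocale loc: localized_quotient "P_ring n" S I
proof -
  have "localized_ring (P_ring n) S"
  proof (intro localized_ring.intro localized_ring_axioms.intro)
    show "cring (P_ring n :: 'k mpoly ring)" by (rule poly_ring_cring)
    show "S \<subseteq> P" by blast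
    show "\<one>\<^bsub>P_ring n\<^esub> \<in> S" unfolding S_iff by simp
    fix s t assume "s \<in> S" "t \<in> S"
    then show "s \<otimes>\<^bsub>P_ring n\<^esub> t \<in> S"
      unfolding S_iff by (simp add: poly_ring_closed lookup_mult_low_degree)
  qed
  then show "localized_quotient (P_ring n) S I"
    using I by (rule localized_quotient.intro)
qed

(* As a rewrite rule this would call itself, since membership in S has membership in P as a condition. *)
declare loc.S_closed [simp del]

abbreviation "\<rho> \<equiv> loc.to_quot"

lemma local_ring_eq: "local_ring_at_origin n I = loc.L"
  unfolding local_ring_at_origin_def localization_at_def extended_ideal_at_def loc.L_def ..

lemma \<rho>_eq_iff:
  assumes "f \<in> P" "g \<in> P"
  shows "\<rho> f = \<rho> g \<longleftrightarrow> (\<exists>u\<in>S. u * (f - g) \<in> I)"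
  using loc.to_quot_eq_iff[OF assms] unfolding poly_ring_minus[OF assms] poly_ring_ops .

lemma \<rho>_nf:
  assumes "f \<in> P"
  shows "\<rho> (nf f) = \<rho> f"
proof -
  have "1 \<in> S" unfolding S_iff by simp
  moreover have "1 * (f - nf f) \<in> I" using nf(2)[OF assms] JI by auto
  ultimately have "\<exists>u\<in>S. u * (f - nf f) \<in> I" by (rule bexI[rotated])
  moreover have "nf f \<in> P" using nf(1)[OF assms] P'_subset_P by blast
  ultimately have "\<rho> f = \<rho> (nf f)" using \<rho>_eq_iff[OF assms, of "nf f"] by blast
  then show ?thesis by simp
qed

lemma \<rho>_zero:
  assumes "f \<in> I"
  shows "\<rho> f = \<zero>\<^bsub>loc.L\<^esub>"
proof (rule iffD2[OF loc.to_quot_eq_zero_iff])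
  show "f \<in> P" by (rule subsetD[OF ID(1) assms])
  have "1 \<in> S" unfolding S_iff by simp
  moreover have "1 \<otimes>\<^bsub>P_ring n\<^esub> f \<in> I" using assms by simp
  ultimately show "\<exists>u\<in>S. u \<otimes>\<^bsub>P_ring n\<^esub> f \<in> I" by (rule bexI[rotated])
qed

subsection \<open>The dimension is at most the number of remaining indeterminates\<close>

text \<open>The preimage in $\widehat{P}$ of an ideal of the local ring.\<close>

definition contraction where
  "contraction p = {f \<in> P'. \<rho> f \<in> p}"

lemma primeideal_contraction:
  assumes "primeideal p loc.L"
  shows "primeideal (contraction p) (P_hat n Z)"
proof -
  let ?c = "{a \<in> P. \<rho> a \<in> p}"
  have c: "primeideal ?c (P_ring n)" by (rule loc.prime_vimage[OF assms])
  note cD = ideal_poly_ringD[OF primeideal_poly_ringD(1)[OF c]]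
  have eq: "contraction p = P' \<inter> ?c" using P'_subset_P by (auto simp: contraction_def)
  show ?thesis
    unfolding eq
  proof (rule primeidealI)
    show "ideal (P' \<inter> ?c) (P_hat n Z)"
    proof (rule ideal_poly_ringI)
      show "P' \<inter> ?c \<subseteq> P'" by blast
      show "0 \<in> P' \<inter> ?c" using cD(2) by simp
      show "f + g \<in> P' \<inter> ?c" if "f \<in> P' \<inter> ?c" "g \<in> P' \<inter> ?c" for f g
        using that by (intro IntI cD(3) poly_ring_closed) (simp_all only: Int_iff)
      show "g * f \<in> P' \<inter> ?c" if "f \<in> P' \<inter> ?c" "g \<in> P'" for f g
      proof -
        have "g \<in> P" using that(2) P'_subset_P by blast
        with that show ?thesis
          by (intro IntI cD(6) poly_ring_closed) (simp_all only: Int_iff)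
      qed
    qed
    show "cring (P_hat n Z :: 'k mpoly ring)" by (rule poly_ring_cring)
    show "P' \<noteq> P' \<inter> ?c"
      using primeideal_poly_ringD(2)[OF c] poly_ring_const_closed(2)[of V] by blast
    fix f g assume fg: "f \<in> P'" "g \<in> P'" "f \<otimes>\<^bsub>P_hat n Z\<^esub> g \<in> P' \<inter> ?c"
    then have "f * g \<in> ?c" by simp
    moreover have "f \<in> P" "g \<in> P" using fg P'_subset_P by blast+
    ultimately have "f \<in> ?c \<or> g \<in> ?c" by (rule primeideal_poly_ringD(3)[OF c])
    then show "f \<in> P' \<inter> ?c \<or> g \<in> P' \<inter> ?c" using fg(1,2) by blast
  qed
qed

lemma contraction_strict:
  assumes "primeideal p loc.L" "primeideal q loc.L" "p \<subset> q"
  shows "contraction p \<subset> contraction q"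
proof -
  obtain a where a: "a \<in> P" "\<rho> a \<in> q" "\<rho> a \<notin> p"
    using loc.prime_strict[OF assms] by blast
  have "nf a \<in> contraction q" "nf a \<notin> contraction p"
    using a nf(1)[OF a(1)] by (simp_all add: contraction_def \<rho>_nf)
  moreover have "contraction p \<subseteq> contraction q" using assms(3) by (auto simp: contraction_def)
  ultimately show ?thesis by blast
qed

lemma elim_subset_contraction:
  assumes "primeideal p loc.L"
  shows "I \<inter> P' \<subseteq> contraction p"
proof
  fix f assume f: "f \<in> I \<inter> P'"
  interpret p: primeideal p loc.L by (rule assms)
  have "\<rho> f = \<zero>\<^bsub>loc.L\<^esub>" using f by (intro \<rho>_zero) blast
  then have "\<rho> f \<in> p" using additive_subgroup.zero_closed[OF p.additive_subgroup_axioms] by simp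
  then show "f \<in> contraction p" using f by (simp add: contraction_def)
qed

text \<open>
  If $I \cap \widehat{P}$ is nonzero, the contracted chain can be prolonged by the zero ideal.
\<close>

lemma local_chain_length:
  assumes prime: "\<And>i. i \<le> k \<Longrightarrow> primeideal (p i) loc.L" and strict: "\<And>i. i < k \<Longrightarrow> p i \<subset> p (Suc i)"
  shows "k \<le> card V" and "I \<inter> P' \<noteq> {0} \<Longrightarrow> Suc k \<le> card V"
proof -
  have str: "contraction (p i) \<subset> contraction (p (Suc i))" if "i < k" for i
  proof (rule contraction_strict)
    show "primeideal (p i) loc.L" "primeideal (p (Suc i)) loc.L" using that by (simp_all add: prime)
    show "p i \<subset> p (Suc i)" using that by (rule strict)
  qed
  have V: "finite V" by simp
  show "k \<le> card V"
    using V primeideal_contraction[OF prime] str by (rule prime_chain_length_le)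
  assume "I \<inter> P' \<noteq> {0}"
  moreover have "0 \<in> I \<inter> P'" using ID(2) by simp
  ultimately have pos: "{0} \<subset> I \<inter> P'" by blast
  let ?q = "\<lambda>i. case i of 0 \<Rightarrow> {0} | Suc j \<Rightarrow> contraction (p j)"
  show "Suc k \<le> card V"
  proof (rule prime_chain_length_le)
    show "finite V" by simp
    show "primeideal (?q i) (P_hat n Z)" if "i \<le> Suc k" for i
    proof (cases i)
      case 0
      then show ?thesis using domain.zeroprimeideal[OF poly_ring_domain[where V = V and 'k = 'k]] by simp
    next
      case (Suc j)
      then show ?thesis using that primeideal_contraction[OF prime[of j]] by simp
    qed
    show "?q i \<subset> ?q (Suc i)" if "i < Suc k" for i
    proof (cases i)
      case 0
      have "{0} \<subset> contraction (p 0)"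
        using pos elim_subset_contraction[OF prime[of 0]] by simp
      then show ?thesis using 0 by simp
    next
      case (Suc j)
      then show ?thesis using that str[of j] by simp
    qed
  qed
qed

subsection \<open>Linear parts and the embedding dimension\<close>

lemma lookup_zero_I: "f \<in> I \<Longrightarrow> f \<cdot> 0 = 0"
  using IM by (auto simp: max_ideal_eq)

lemma lookup_nf_zero: "f \<in> P \<Longrightarrow> nf f \<cdot> 0 = f \<cdot> 0"
  using nf(2)[of f] JI lookup_zero_I[of "f - nf f"] by (auto simp: lookup_minus)

text \<open>The linear part of the image in $\widehat{P}$; it is a derivation at the origin.\<close>

definition lin where "lin f = homog_comp 1 (nf f)"

lemma lin_add: "f \<in> P \<Longrightarrow> g \<in> P \<Longrightarrow> lin (f + g) = lin f + lin g"
  by (simp add: lin_def nf_add homog_comp_add)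

lemma lin_mult:
  assumes "f \<in> P" "g \<in> P"
  shows "lin (f * g) = poly_scale (f \<cdot> 0) (lin g) + poly_scale (g \<cdot> 0) (lin f)"
  unfolding lin_def nf_mult[OF assms] lookup_mult_low_degree(2) lookup_nf_zero[OF assms(1)]
    lookup_nf_zero[OF assms(2)] ..

lemma lookup_var_zero: "var i \<cdot> 0 = (0 :: 'k)"
proof -
  have "Poly_Mapping.single i (1 :: nat) \<noteq> 0"
  proof
    assume "Poly_Mapping.single i (1 :: nat) = 0"
    then have "Poly_Mapping.single i (1 :: nat) \<cdot> i = 0" by simp
    then show False by simp
  qed
  then show ?thesis by (simp add: var_def monomial_def lookup_single when_def)
qed

lemma var_eq_iff: "(var i :: 'k mpoly) = var j \<longleftrightarrow> i = j"
proof
  assume "(var i :: 'k mpoly) = var j"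
  then have "Poly_Mapping.keys (var i :: 'k mpoly) = Poly_Mapping.keys (var j :: 'k mpoly)"
    by (rule arg_cong)
  then show "i = j" by (simp add: var_def monomial_def single_one_eq_iff)
qed simp

lemma independent_vars: "poly_vs.independent (var ` A :: 'k mpoly set)" if "finite A"
proof (rule poly_vs.independent_if_scalars_zero)
  show "finite (var ` A)" using that by simp
  fix c :: "'k mpoly \<Rightarrow> 'k" and x :: "'k mpoly" assume s: "(\<Sum>x\<in>var ` A. poly_scale (c x) x) = 0" and "x \<in> var ` A"
  then obtain i where i: "i \<in> A" "x = var i" by blast
  have "(\<Sum>x\<in>var ` A. poly_scale (c x) x) \<cdot> (Poly_Mapping.single i 1) = (\<Sum>x\<in>var ` A. if x = var i then c x else 0)"
    unfolding lookup_sum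
  proof (rule sum.cong)
    fix y :: "'k mpoly" assume "y \<in> var ` A"
    then obtain j where "y = var j" by blast
    moreover have "var j = (var i :: 'k mpoly) \<longleftrightarrow> j = i" by (rule var_eq_iff)
    ultimately show "poly_scale (c y) y \<cdot> (Poly_Mapping.single i 1) = (if y = var i then c y else 0)"
      by (simp add: poly_scale_def lookup_cst_mult var_def monomial_def lookup_single when_def single_one_eq_iff)
  qed simp
  also have "\<dots> = c x" using that i by simp
  finally show "c x = 0" using s by simp
qed

lemma card_vars: "card (var ` A :: 'k mpoly set) = card A"
  by (rule card_image, rule inj_onI) (simp add: var_eq_iff)

lemma homog_comp_in_span_vars:
  assumes "f \<in> carrier (poly_ring A)" "finite A"
  shows "homog_comp 1 f \<in> poly_vs.span (var ` A :: 'k mpoly set)"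
proof -
  have "homog_comp 1 f = (\<Sum>i\<in>A. poly_scale (f \<cdot> (Poly_Mapping.single i 1)) (var i))"
  proof (rule poly_mapping_eqI)
    fix t
    have r: "(\<Sum>i\<in>A. poly_scale (f \<cdot> (Poly_Mapping.single i 1)) (var i)) \<cdot> t =
      (\<Sum>i\<in>A. if t = Poly_Mapping.single i 1 then f \<cdot> t else 0)"
      unfolding lookup_sum
      by (rule sum.cong) (auto simp: poly_scale_def lookup_cst_mult var_def monomial_def lookup_single when_def)
    show "homog_comp 1 f \<cdot> t = (\<Sum>i\<in>A. poly_scale (f \<cdot> (Poly_Mapping.single i 1)) (var i)) \<cdot> t"
    proof (cases "term_deg t = 1")
      case True
      then obtain i where i: "t = Poly_Mapping.single i 1" by (rule term_deg_1E)
      have "(\<Sum>j\<in>A. if t = Poly_Mapping.single j 1 then f \<cdot> t else 0) = (if i \<in> A then f \<cdot> t else 0)"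
        unfolding i single_one_eq_iff using assms(2) by simp
      also have "\<dots> = f \<cdot> t"
      proof (cases "i \<in> A")
        case False
        then have "t \<notin> terms A" by (simp add: i single_in_terms)
        then have "t \<notin> Poly_Mapping.keys f" using assms(1) by (auto simp: carrier_poly_ring)
        then show ?thesis using False by (simp add: in_keys_iff)
      qed simp
      finally show ?thesis using True r by (simp add: lookup_homog_comp)
    next
      case False
      then have "t \<noteq> Poly_Mapping.single j 1" for j by auto
      then show ?thesis using False r by (simp add: lookup_homog_comp)
    qed
  qed
  then show ?thesis
    by (simp add: poly_vs.span_sum poly_vs.span_scale poly_vs.span_base)
qed

text \<open>
  The linear parts of the $z - h_z$ are already \<open>s\<close> independent elements of the linear part of \<open>I\<close>,
  so an element of $I \cap \widehat{P}$ with a nonzero linear part would give one more.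
\<close>

lemma elim_linear_part_zero:
  assumes dim: "poly_vs.dim (Lin I) = card (set Z)" and f: "f \<in> I" "f \<in> P'"
  shows "homog_comp 1 f = 0"
proof (rule ccontr)
  define l where "l = homog_comp 1 f"
  define g where "g z = homog_comp 1 (sep_elem z)" for z
  assume "homog_comp 1 f \<noteq> 0"
  then have l0: "l \<noteq> 0" by (simp add: l_def)
  have gz: "g z \<cdot> (Poly_Mapping.single z' 1) = (if z = z' then 1 else 0)" if "z \<in> set Z" "z' \<in> set Z" for z z'
    using sep_elem(3)[OF that] by (simp add: g_def lookup_homog_comp)
  have lz: "l \<cdot> (Poly_Mapping.single z 1) = 0" if "z \<in> set Z" for z
    using lookup_P'[OF f(2), of "Poly_Mapping.single z 1"] that by (simp add: l_def lookup_homog_comp)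
  have inj: "inj_on g (set Z)"
  proof (rule inj_onI)
    fix z z' assume z: "z \<in> set Z" "z' \<in> set Z" and eq: "g z = g z'"
    have "(if z' = z then 1 else 0 :: 'k) = 1"
      using gz[OF z(1,1)] unfolding eq gz[OF z(2,1)] by simp
    then show "z = z'" by (simp split: if_splits)
  qed
  have lg: "l \<notin> g ` set Z"
  proof
    assume "l \<in> g ` set Z"
    then obtain z where z: "z \<in> set Z" and l: "l = g z" by blast
    show False using gz[OF z z] lz[OF z] unfolding l by simp
  qed
  let ?B = "insert l (g ` set Z)"
  have indep: "poly_vs.independent ?B"
  proof (rule poly_vs.independent_if_scalars_zero)
    show "finite ?B" by simp
    fix c x assume s: "(\<Sum>x\<in>?B. poly_scale (c x) x) = 0" and x: "x \<in> ?B"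
    have sum: "(\<Sum>x\<in>?B. poly_scale (c x) x) = poly_scale (c l) l + (\<Sum>z\<in>set Z. poly_scale (c (g z)) (g z))"
      using lg inj by (simp add: sum.reindex)
    have cz: "c (g z) = 0" if z: "z \<in> set Z" for z
    proof -
      have "0 = (\<Sum>x\<in>?B. poly_scale (c x) x) \<cdot> (Poly_Mapping.single z 1)" using s by simp
      also have "\<dots> = (\<Sum>z'\<in>set Z. c (g z') * (g z' \<cdot> (Poly_Mapping.single z 1)))"
        unfolding sum using lz[OF z] by (simp add: lookup_add lookup_sum poly_scale_def lookup_cst_mult)
      also have "\<dots> = (\<Sum>z'\<in>set Z. if z' = z then c (g z') else 0)"
        by (rule sum.cong) (use gz z in auto)
      also have "\<dots> = c (g z)" using z by simp
      finally show ?thesis by simp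
    qed
    then have "(\<Sum>z\<in>set Z. poly_scale (c (g z)) (g z)) = 0"
      by (intro sum.neutral) simp
    then have "poly_scale (c l) l = 0" using s sum by simp
    then have "c l = 0" using l0 by simp
    with cz x show "c x = 0" by blast
  qed
  obtain B where B: "B \<subseteq> Lin I" "poly_vs.independent B" "Lin I \<subseteq> poly_vs.span B"
    "card B = poly_vs.dim (Lin I)" by (rule poly_vs.basis_exists)
  have "homog_comp 1 ` I \<subseteq> poly_vs.span (var ` {1..n})"
    using homog_comp_in_span_vars[of _ "{1..n}"] ID(1) by blast
  then have "Lin I \<subseteq> poly_vs.span (var ` {1..n})"
    unfolding Lin_def by (rule poly_vs.span_minimal) (rule poly_vs.subspace_span)
  then have finB: "finite B"
    using poly_vs.independent_span_bound[of "var ` {1..n}" B] B(1,2) by blast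
  have "?B \<subseteq> homog_comp 1 ` I"
    using f(1) sep_elem(1) JI by (auto simp: l_def g_def)
  then have "?B \<subseteq> Lin I" unfolding Lin_def using poly_vs.span_superset by blast
  then have "card ?B \<le> card B"
    using poly_vs.independent_span_bound[OF finB indep] B(3) by blast
  moreover have "card ?B = Suc (card (set Z))" using lg inj by (simp add: card_image)
  ultimately show False using B(4) dim by simp
qed

lemma lin_zero_on_I:
  assumes "poly_vs.dim (Lin I) = card (set Z)" "f \<in> I"
  shows "lin f = 0"
proof -
  have f: "f \<in> P" using assms(2) ID(1) by blast
  have "f - nf f \<in> I" by (rule subsetD[OF JI nf(2)[OF f]])
  with assms(2) have "f - (f - nf f) \<in> I" by (rule ID(4))
  then have "nf f \<in> I" by simp
  then show ?thesis unfolding lin_def using nf(1)[OF f] assms(1) by (intro elim_linear_part_zero)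
qed

text \<open>
  Generators of the maximal ideal can be multiplied by units so as to come from polynomials;
  the linear parts of these polynomials then span the linear forms of $\widehat{P}$.
\<close>

lemma card_generators_ge:
  assumes dim: "poly_vs.dim (Lin I) = card (set Z)"
    and A: "A \<subseteq> carrier loc.L" "finite A" "loc.extension (max_ideal n) = Idl\<^bsub>loc.L\<^esub> A"
  shows "card V \<le> card A"
proof -
  have "\<exists>f. a \<in> A \<longrightarrow> f \<in> max_ideal n \<and> (\<exists>s\<in>S. a \<otimes>\<^bsub>loc.L\<^esub> \<rho> s = \<rho> f)" for a
  proof (cases "a \<in> A")
    case True
    then have "a \<in> loc.extension (max_ideal n)"
      unfolding A(3) by (rule subsetD[OF loc.L.genideal_self[OF A(1)]])
    then obtain f s where "f \<in> max_ideal n" "s \<in> S" "a \<otimes>\<^bsub>loc.L\<^esub> \<rho> s = \<rho> f" "a \<in> carrier loc.L"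
      by (rule loc.extensionE)
    then show ?thesis by (intro exI conjI impI bexI)
  qed simp
  then obtain h where h: "\<And>a. a \<in> A \<Longrightarrow> h a \<in> max_ideal n \<and> (\<exists>s\<in>S. a \<otimes>\<^bsub>loc.L\<^esub> \<rho> s = \<rho> (h a))" by metis
  define T where "T = (\<lambda>a. lin (h a)) ` A"
  \<comment> \<open>Polynomials whose linear part lies in the span of those of the generators form a saturated ideal.\<close>
  define X where "X = {f \<in> P. f \<cdot> 0 = 0 \<and> lin f \<in> poly_vs.span T}"
  have X: "ideal X (P_ring n)"
  proof (rule ideal_poly_ringI)
    show "X \<subseteq> P" by (auto simp: X_def)
    have "lin 0 = 0" using lin_zero_on_I[OF dim ID(2)] .
    then show "0 \<in> X" by (simp add: X_def poly_vs.span_zero)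
    show "f + g \<in> X" if "f \<in> X" "g \<in> X" for f g
      using that by (simp add: X_def poly_ring_closed lookup_add lin_add poly_vs.span_add)
    show "g * f \<in> X" if "f \<in> X" "g \<in> P" for f g
      using that
      by (simp add: X_def poly_ring_closed lookup_mult_low_degree lin_mult poly_vs.span_scale)
  qed
  have IX: "I \<subseteq> X"
    using ID(1) lookup_zero_I lin_zero_on_I[OF dim] by (auto simp: X_def poly_vs.span_zero)
  have sat: "f \<in> X" if "f \<in> P" "s \<in> S" "s \<otimes>\<^bsub>P_ring n\<^esub> f \<in> X" for f s
  proof -
    have s: "s \<in> P" "s \<cdot> 0 \<noteq> 0" using that(2) unfolding S_iff by auto
    have sf: "(s * f) \<cdot> 0 = 0" "lin (s * f) \<in> poly_vs.span T" using that(3) by (simp_all add: X_def)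
    have f0: "f \<cdot> 0 = 0" using sf(1) s(2) by (simp add: lookup_mult_low_degree)
    then have "poly_scale (s \<cdot> 0) (lin f) \<in> poly_vs.span T"
      using sf(2) lin_mult[OF s(1) that(1)] by simp
    then have "poly_scale (inverse (s \<cdot> 0)) (poly_scale (s \<cdot> 0) (lin f)) \<in> poly_vs.span T"
      by (rule poly_vs.span_scale)
    then have "lin f \<in> poly_vs.span T" using s(2) by simp
    then show ?thesis using that(1) f0 by (simp add: X_def)
  qed
  have "A \<subseteq> loc.extension X"
  proof
    fix a assume a: "a \<in> A"
    have hM: "h a \<in> max_ideal n" by (rule conjunct1[OF h[OF a]])
    obtain s where s: "s \<in> S" "a \<otimes>\<^bsub>loc.L\<^esub> \<rho> s = \<rho> (h a)"
      by (rule bexE[OF conjunct2[OF h[OF a]]])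
    have "lin (h a) \<in> poly_vs.span T" unfolding T_def by (intro poly_vs.span_base imageI a)
    moreover have "h a \<in> P" "h a \<cdot> 0 = 0" using hM unfolding max_ideal_eq by simp_all
    ultimately have hX: "h a \<in> X" unfolding X_def by blast
    show "a \<in> loc.extension X" by (rule loc.extensionI[OF subsetD[OF A(1) a] hX s])
  qed
  then have sub: "loc.extension (max_ideal n) \<subseteq> loc.extension X"
    unfolding A(3) using loc.extension_ideal[OF X] by (rule loc.L.genideal_minimal[rotated])
  have "var i \<in> poly_vs.span T" if i: "i \<in> V" for i
  proof -
    have v: "var i \<in> P" "var i \<in> P'" using i by (simp_all add: var_in_carrier)
    have "(var i :: 'k mpoly) \<cdot> 0 = 0"
      by (rule lookup_var_zero)
    then have "(var i :: 'k mpoly) \<in> max_ideal n" using v(1) by (simp add: max_ideal_eq)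
    then have ext: "\<rho> (var i) \<in> loc.extension X"
      by (rule subsetD[OF sub loc.in_extension[OF _ v(1)]])
    have "var i \<in> X"
      using sat v(1) ext by (rule loc.extension_contraction[OF X IX])
    then have "lin (var i) \<in> poly_vs.span T" by (simp add: X_def)
    then show ?thesis using v(2) by (simp add: lin_def nf_id homog_comp_var)
  qed
  then have "var ` V \<subseteq> poly_vs.span T" by blast
  then have "card (var ` V :: 'k mpoly set) \<le> card T"
    using poly_vs.independent_span_bound[of T "var ` V"] independent_vars[of V] A(2) by (simp add: T_def)
  also have "\<dots> \<le> card A" unfolding T_def by (rule card_image_le[OF A(2)])
  finally show ?thesis by (simp add: card_vars)
qed

text \<open>
  Regularity identifies the dimension with a number of generators, which is at least the number of
  remaining indeterminates by the linear parts and at most that number by the bound on chains.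
\<close>

theorem regular_local_ring_origin:
  assumes reg: "regular_local_ring (local_ring_at_origin n I)"
    and dim: "poly_vs.dim (Lin I) = card (set Z)"
  shows "krull_dim (local_ring_at_origin n I) = enat (card V)" and "I \<inter> P' = {0}"
proof -
  let ?m = "loc.extension (max_ideal n)"
  have max: "maximalideal ?m loc.L"
    by (rule loc.extension_maximal[OF max_ideal_prime IM refl])
  have id: "ideal ?m loc.L" by (rule maximalideal.axioms(1)[OF max])
  have noeth: "noetherian_ring loc.L"
    using reg unfolding regular_local_ring_def local_ring_eq by (elim conjE)
  have "\<forall>m. maximalideal m loc.L \<longrightarrow> enat (num_generators loc.L m) = krull_dim loc.L"
    using reg unfolding regular_local_ring_def local_ring_eq by (elim conjE)
  then have dimL: "enat (num_generators loc.L ?m) = krull_dim loc.L"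
    using max by (elim allE impE)
  have "\<exists>k. \<exists>A\<subseteq>carrier loc.L. finite A \<and> card A = k \<and> ?m = Idl\<^bsub>loc.L\<^esub> A"
    using noetherian_ring.finetely_gen[OF noeth id] by blast
  then have "\<exists>A\<subseteq>carrier loc.L. finite A \<and> card A = num_generators loc.L ?m \<and> ?m = Idl\<^bsub>loc.L\<^esub> A"
    unfolding num_generators_def by (rule LeastI_ex)
  then obtain A where A: "A \<subseteq> carrier loc.L" "finite A" "card A = num_generators loc.L ?m"
    "?m = Idl\<^bsub>loc.L\<^esub> A" by blast
  have ge: "enat (card V) \<le> krull_dim loc.L"
    using card_generators_ge[OF dim A(1,2,4)] A(3) by (simp only: dimL[symmetric] enat_ord_simps)
  have bound: "krull_dim loc.L \<le> enat d"
    if "\<And>k p. (\<And>i. i \<le> k \<Longrightarrow> primeideal (p i) loc.L) \<Longrightarrow> (\<And>i. i < k \<Longrightarrow> p i \<subset> p (Suc i)) \<Longrightarrow> k \<le> d" for d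
    unfolding krull_dim_def
  proof (rule Sup_least)
    fix x assume "x \<in> {enat k |k. \<exists>p. (\<forall>i\<le>k. primeideal (p i) loc.L) \<and> (\<forall>i<k. p i \<subset> p (Suc i))}"
    then obtain k p where x: "x = enat k" and p: "\<forall>i\<le>k. primeideal (p i) loc.L" "\<forall>i<k. p i \<subset> p (Suc i)"
      by blast
    have "k \<le> d"
    proof (rule that)
      show "primeideal (p i) loc.L" if "i \<le> k" for i using p(1) that by blast
      show "p i \<subset> p (Suc i)" if "i < k" for i using p(2) that by blast
    qed
    then show "x \<le> enat d" by (simp add: x)
  qed
  have "krull_dim loc.L \<le> enat (card V)" by (rule bound) (rule local_chain_length(1))
  with ge show "krull_dim (local_ring_at_origin n I) = enat (card V)" unfolding local_ring_eq by simp
  show "I \<inter> P' = {0}"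
  proof (rule ccontr)
    assume ne: "I \<inter> P' \<noteq> {0}"
    have "primeideal ?m loc.L" by (rule loc.L.maximalideal_prime[OF max])
    then have "Suc 0 \<le> card V"
      using local_chain_length(2)[of 0 "\<lambda>_. ?m"] ne by simp
    moreover have "krull_dim loc.L \<le> enat (card V - 1)"
    proof (rule bound)
      fix k p assume "\<And>i. i \<le> k \<Longrightarrow> primeideal (p i) loc.L" "\<And>i. i < k \<Longrightarrow> p i \<subset> p (Suc i)"
      then have "Suc k \<le> card V" using ne by (rule local_chain_length(2))
      then show "k \<le> card V - 1" by linarith
    qed
    then have "enat (card V) \<le> enat (card V - 1)" using ge by (rule order_trans[rotated])
    ultimately show False by simp
  qed
qed

end

section \<open>Isomorphic algebras have isomorphic spectra\<close>

lemma openin_zariski: "openin (zariski R) U \<longleftrightarrow> (\<exists>A\<subseteq>carrier R. U = {p. primeideal p R \<and> \<not> A \<subseteq> p})"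
  unfolding zariski_def by (simp add: topology_inverse'[OF istopology_zariski])

lemma topspace_zariski: "topspace (zariski R) = {p. primeideal p R}"
proof -
  have "p \<in> topspace (zariski R)" if "primeideal p R" for p
  proof -
    have "\<not> carrier R \<subseteq> p"
      using primeideal.I_notcarr[OF that] ideal.Icarr[OF primeideal.axioms(1)[OF that]] by blast
    then have "p \<in> {p. primeideal p R \<and> \<not> carrier R \<subseteq> p}" using that by blast
    moreover have "openin (zariski R) {p. primeideal p R \<and> \<not> carrier R \<subseteq> p}"
      unfolding openin_zariski by blast
    ultimately show ?thesis using openin_subset by blast
  qed
  moreover have "primeideal p R" if "p \<in> topspace (zariski R)" for p
    using that unfolding topspace_def openin_zariski by blast
  ultimately show ?thesis by blast
qed

lemma localization_at_simps:
  "carrier (localization_at R p) = {fraction R (carrier R - p) a b | a b. a \<in> carrier R \<and> b \<in> carrier R - p}"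
  "\<one>\<^bsub>localization_at R p\<^esub> = fraction R (carrier R - p) \<one>\<^bsub>R\<^esub> \<one>\<^bsub>R\<^esub>"
  "A \<otimes>\<^bsub>localization_at R p\<^esub> B =
    (\<Union>(a, b)\<in>A. \<Union>(c, d)\<in>B. fraction R (carrier R - p) (a \<otimes>\<^bsub>R\<^esub> c) (b \<otimes>\<^bsub>R\<^esub> d))"
  "A \<oplus>\<^bsub>localization_at R p\<^esub> B =
    (\<Union>(a, b)\<in>A. \<Union>(c, d)\<in>B. fraction R (carrier R - p) (a \<otimes>\<^bsub>R\<^esub> d \<oplus>\<^bsub>R\<^esub> c \<otimes>\<^bsub>R\<^esub> b) (b \<otimes>\<^bsub>R\<^esub> d))"
  by (simp_all add: localization_at_def localization_def)

text \<open>
  A ring isomorphism together with its inverse.  All constructions on the spectrum are transported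
  along \<open>\<phi>\<close>; the locale is symmetric, so everything also holds for \<open>\<psi>\<close>.
\<close>

locale inverse_ring_isos =
  fixes R :: "('a, 'm) ring_scheme" and S :: "('b, 'l) ring_scheme" and \<phi> \<psi>
  assumes R: "cring R" and S: "cring S"
    and \<phi>: "\<phi> \<in> ring_hom R S" and \<psi>: "\<psi> \<in> ring_hom S R"
    and \<psi>\<phi>: "a \<in> carrier R \<Longrightarrow> \<psi> (\<phi> a) = a" and \<phi>\<psi>: "b \<in> carrier S \<Longrightarrow> \<phi> (\<psi> b) = b"
begin

lemma sym: "inverse_ring_isos S R \<psi> \<phi>"
  by (intro inverse_ring_isos.intro R S \<phi> \<psi> \<psi>\<phi> \<phi>\<psi>)

sublocale R: cring R by (rule R)
sublocale S: cring S by (rule S)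
sublocale \<phi>: ring_hom_cring R S \<phi> by unfold_locales (rule \<phi>)
sublocale \<psi>: ring_hom_cring S R \<psi> by unfold_locales (rule \<psi>)

lemma inj: "a \<in> carrier R \<Longrightarrow> b \<in> carrier R \<Longrightarrow> \<phi> a = \<phi> b \<longleftrightarrow> a = b"
  by (metis \<psi>\<phi>)

lemma image_eq_vimage: "X \<subseteq> carrier R \<Longrightarrow> \<phi> ` X = {b \<in> carrier S. \<psi> b \<in> X}"
  by (force simp: \<psi>\<phi> \<phi>\<psi> intro: rev_image_eqI)

lemma image_inverse: "X \<subseteq> carrier R \<Longrightarrow> \<psi> ` \<phi> ` X = X"
  by (force simp: image_image \<psi>\<phi> image_iff)

lemma in_image_iff: "X \<subseteq> carrier R \<Longrightarrow> a \<in> carrier R \<Longrightarrow> \<phi> a \<in> \<phi> ` X \<longleftrightarrow> a \<in> X"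
  by (metis image_iff inj subsetD)

lemma prime_carrier: "primeideal p R \<Longrightarrow> p \<subseteq> carrier R"
  by (rule ideal.Icarr[OF primeideal.axioms(1), THEN subsetI])

lemma prime_image:
  assumes "primeideal p R"
  shows "primeideal (\<phi> ` p) S"
  unfolding image_eq_vimage[OF prime_carrier[OF assms]]
  by (rule primeideal_vimage[OF \<psi> S R assms])

text \<open>The map on fractions; a fraction is a set of pairs, which is moved elementwise.\<close>

definition frac_map where "frac_map A = map_prod \<phi> \<phi> ` A"

lemma frac_map_fraction:
  assumes p: "p \<subseteq> carrier R" and ab: "a \<in> carrier R" "b \<in> carrier R"
  shows "frac_map (fraction R (carrier R - p) a b) = fraction S (carrier S - \<phi> ` p) (\<phi> a) (\<phi> b)"
proof -
  have key: "\<phi> t \<otimes>\<^bsub>S\<^esub> (\<phi> a \<otimes>\<^bsub>S\<^esub> \<phi> d \<ominus>\<^bsub>S\<^esub> \<phi> b \<otimes>\<^bsub>S\<^esub> \<phi> c) = \<zero>\<^bsub>S\<^esub> \<longleftrightarrow>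
      t \<otimes>\<^bsub>R\<^esub> (a \<otimes>\<^bsub>R\<^esub> d \<ominus>\<^bsub>R\<^esub> b \<otimes>\<^bsub>R\<^esub> c) = \<zero>\<^bsub>R\<^esub>"
    if "t \<in> carrier R" "c \<in> carrier R" "d \<in> carrier R" for t c d
  proof -
    define x where "x = t \<otimes>\<^bsub>R\<^esub> (a \<otimes>\<^bsub>R\<^esub> d \<ominus>\<^bsub>R\<^esub> b \<otimes>\<^bsub>R\<^esub> c)"
    have "\<phi> t \<otimes>\<^bsub>S\<^esub> (\<phi> a \<otimes>\<^bsub>S\<^esub> \<phi> d \<ominus>\<^bsub>S\<^esub> \<phi> b \<otimes>\<^bsub>S\<^esub> \<phi> c) = \<phi> x"
      using that ab by (simp add: a_minus_def x_def)
    moreover have "x \<in> carrier R" using that ab by (simp add: x_def)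
    then have "\<phi> x = \<phi> \<zero>\<^bsub>R\<^esub> \<longleftrightarrow> x = \<zero>\<^bsub>R\<^esub>" by (intro inj) simp_all
    ultimately show ?thesis by (simp add: x_def)
  qed
  have T: "carrier S - \<phi> ` p = \<phi> ` (carrier R - p)"
  proof -
    have "\<phi> ` carrier R = carrier S" using image_eq_vimage[of "carrier R"] by auto
    moreover have "inj_on \<phi> (carrier R)" by (rule inj_onI) (simp add: inj)
    ultimately show ?thesis using inj_on_image_set_diff[of \<phi> "carrier R" "carrier R" p] p by simp
  qed
  have sub: "(\<phi> c, \<phi> d) \<in> fraction S (carrier S - \<phi> ` p) (\<phi> a) (\<phi> b) \<longleftrightarrow> (c, d) \<in> fraction R (carrier R - p) a b"
    if cd: "c \<in> carrier R" "d \<in> carrier R" for c d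
  proof -
    have "(\<exists>t\<in>carrier S - \<phi> ` p. t \<otimes>\<^bsub>S\<^esub> (\<phi> a \<otimes>\<^bsub>S\<^esub> \<phi> d \<ominus>\<^bsub>S\<^esub> \<phi> b \<otimes>\<^bsub>S\<^esub> \<phi> c) = \<zero>\<^bsub>S\<^esub>) \<longleftrightarrow>
      (\<exists>t\<in>carrier R - p. t \<otimes>\<^bsub>R\<^esub> (a \<otimes>\<^bsub>R\<^esub> d \<ominus>\<^bsub>R\<^esub> b \<otimes>\<^bsub>R\<^esub> c) = \<zero>\<^bsub>R\<^esub>)"
      unfolding T bex_simps using key[OF _ cd] by blast
    moreover have "\<phi> d \<in> carrier S - \<phi> ` p \<longleftrightarrow> d \<in> carrier R - p"
      using in_image_iff[OF p cd(2)] cd(2) by simp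
    ultimately show ?thesis using cd by (simp add: fraction_def)
  qed
  show ?thesis
  proof (rule Set.set_eqI, rule iffI)
    fix x assume "x \<in> frac_map (fraction R (carrier R - p) a b)"
    then obtain c d where cd: "x = (\<phi> c, \<phi> d)" "(c, d) \<in> fraction R (carrier R - p) a b"
      unfolding frac_map_def by auto
    then have "c \<in> carrier R" "d \<in> carrier R" by (auto simp: fraction_def)
    then show "x \<in> fraction S (carrier S - \<phi> ` p) (\<phi> a) (\<phi> b)" using sub cd by simp
  next
    fix x assume x: "x \<in> fraction S (carrier S - \<phi> ` p) (\<phi> a) (\<phi> b)"
    obtain c d where cd: "x = (c, d)" by (cases x)
    have car: "c \<in> carrier S" "d \<in> carrier S" using x by (auto simp: cd fraction_def)
    then have "(\<psi> c, \<psi> d) \<in> fraction R (carrier R - p) a b"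
      using sub[of "\<psi> c" "\<psi> d"] x by (simp add: cd \<phi>\<psi>)
    moreover have "x = map_prod \<phi> \<phi> (\<psi> c, \<psi> d)" using car by (simp add: cd \<phi>\<psi>)
    ultimately show "x \<in> frac_map (fraction R (carrier R - p) a b)"
      unfolding frac_map_def by (rule rev_image_eqI)
  qed
qed

lemma stalk_subset:
  assumes "A \<in> carrier (localization_at R p)"
  shows "A \<subseteq> carrier R \<times> carrier R"
proof -
  obtain a b where "A = fraction R (carrier R - p) a b"
    using assms by (auto simp: localization_at_simps)
  then show ?thesis by (auto simp: fraction_def)
qed

lemma frac_map_stalk:
  assumes p: "primeideal p R" and A: "A \<in> carrier (localization_at R p)"
  shows "frac_map A \<in> carrier (localization_at S (\<phi> ` p))"
proof -
  note pc = prime_carrier[OF p]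
  obtain a b where ab: "A = fraction R (carrier R - p) a b" "a \<in> carrier R" "b \<in> carrier R" "b \<notin> p"
    using A by (auto simp: localization_at_simps)
  then have "\<phi> b \<in> carrier S - \<phi> ` p" using in_image_iff[OF pc] by simp
  then show ?thesis
    unfolding ab(1) frac_map_fraction[OF pc ab(2,3)] localization_at_simps
    using \<phi>.hom_closed[OF ab(2)] by blast
qed

lemma frac_map_Union:
  assumes "A \<subseteq> carrier R \<times> carrier R" "B \<subseteq> carrier R \<times> carrier R"
    and "\<And>a b c d. a \<in> carrier R \<Longrightarrow> b \<in> carrier R \<Longrightarrow> c \<in> carrier R \<Longrightarrow> d \<in> carrier R \<Longrightarrow>
      frac_map (F a b c d) = G (\<phi> a) (\<phi> b) (\<phi> c) (\<phi> d)"
  shows "frac_map (\<Union>(a, b)\<in>A. \<Union>(c, d)\<in>B. F a b c d) =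
    (\<Union>(a, b)\<in>frac_map A. \<Union>(c, d)\<in>frac_map B. G a b c d)"
proof -
  have "frac_map (\<Union>(a, b)\<in>A. \<Union>(c, d)\<in>B. F a b c d) = (\<Union>(a, b)\<in>A. \<Union>(c, d)\<in>B. frac_map (F a b c d))"
    unfolding frac_map_def by (simp add: image_UN case_prod_beta)
  also have "\<dots> = (\<Union>(a, b)\<in>A. \<Union>(c, d)\<in>B. G (\<phi> a) (\<phi> b) (\<phi> c) (\<phi> d))"
  proof -
    have "frac_map (F a b c d) = G (\<phi> a) (\<phi> b) (\<phi> c) (\<phi> d)" if "(a, b) \<in> A" "(c, d) \<in> B" for a b c d
      using that assms(1,2) by (intro assms(3)) auto
    then show ?thesis by (intro SUP_cong refl) (auto intro!: SUP_cong)
  qed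
  also have "\<dots> = (\<Union>(a, b)\<in>frac_map A. \<Union>(c, d)\<in>frac_map B. G a b c d)"
    unfolding frac_map_def by (simp add: case_prod_beta)
  finally show ?thesis .
qed

lemma frac_map_mult:
  assumes p: "p \<subseteq> carrier R" and "A \<in> carrier (localization_at R p)" "B \<in> carrier (localization_at R p)"
  shows "frac_map (A \<otimes>\<^bsub>localization_at R p\<^esub> B) = frac_map A \<otimes>\<^bsub>localization_at S (\<phi> ` p)\<^esub> frac_map B"
  unfolding localization_at_simps
  by (rule frac_map_Union) (use assms stalk_subset in \<open>simp_all add: frac_map_fraction\<close>)

lemma frac_map_add:
  assumes p: "p \<subseteq> carrier R" and "A \<in> carrier (localization_at R p)" "B \<in> carrier (localization_at R p)"
  shows "frac_map (A \<oplus>\<^bsub>localization_at R p\<^esub> B) = frac_map A \<oplus>\<^bsub>localization_at S (\<phi> ` p)\<^esub> frac_map B"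
  unfolding localization_at_simps
  by (rule frac_map_Union) (use assms stalk_subset in \<open>simp_all add: frac_map_fraction\<close>)

lemma frac_map_one:
  assumes "p \<subseteq> carrier R"
  shows "frac_map \<one>\<^bsub>localization_at R p\<^esub> = \<one>\<^bsub>localization_at S (\<phi> ` p)\<^esub>"
  by (simp add: localization_at_simps frac_map_fraction[OF assms])

lemma open_vimage:
  assumes "openin (zariski S) V"
  shows "openin (zariski R) {p. primeideal p R \<and> \<phi> ` p \<in> V}"
proof -
  obtain A where A: "A \<subseteq> carrier S" "V = {p. primeideal p S \<and> \<not> A \<subseteq> p}"
    using assms unfolding openin_zariski by blast
  have "A \<subseteq> \<phi> ` p \<longleftrightarrow> \<psi> ` A \<subseteq> p" if "primeideal p R" for p
    using image_eq_vimage[OF prime_carrier[OF that]] A(1) by auto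
  then have "{p. primeideal p R \<and> \<phi> ` p \<in> V} = {p. primeideal p R \<and> \<not> \<psi> ` A \<subseteq> p}"
    using prime_image by (auto simp: A(2))
  moreover have "\<psi> ` A \<subseteq> carrier R" using A(1) by auto
  ultimately show ?thesis unfolding openin_zariski by blast
qed

text \<open>The open set of $\mathrm{Spec}(S)$ corresponding to an open set \<open>U\<close> of $\mathrm{Spec}(R)$.\<close>

definition image_open where "image_open U = {q. primeideal q S \<and> \<psi> ` q \<in> U}"

text \<open>Sections over \<open>U\<close>, moved to sections over the corresponding open set.\<close>

definition push where "push U s = (\<lambda>q\<in>image_open U. frac_map (s (\<psi> ` q)))"

interpretation sym: inverse_ring_isos S R \<psi> \<phi> by (rule sym)

lemma image_openD:
  assumes "q \<in> image_open U"
  shows "primeideal q S" "q \<subseteq> carrier S" "primeideal (\<psi> ` q) R" "\<psi> ` q \<in> U" "\<phi> ` \<psi> ` q = q" "\<psi> ` q \<subseteq> carrier R"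
proof -
  show q: "primeideal q S" "\<psi> ` q \<in> U" using assms by (auto simp: image_open_def)
  show qc: "q \<subseteq> carrier S" by (rule sym.prime_carrier[OF q(1)])
  show pr: "primeideal (\<psi> ` q) R" by (rule sym.prime_image[OF q(1)])
  show "\<phi> ` \<psi> ` q = q" by (rule sym.image_inverse[OF qc])
  show "\<psi> ` q \<subseteq> carrier R" by (rule prime_carrier[OF pr])
qed

lemma sections_stalk:
  "s \<in> carrier (spec_sections R U) \<Longrightarrow> p \<in> U \<Longrightarrow> s p \<in> carrier (localization_at R p)"
  by (auto simp: spec_sections_def)

lemma push_closed:
  assumes s: "s \<in> carrier (spec_sections R U)"
  shows "push U s \<in> carrier (spec_sections S (image_open U))"
proof -
  have stalk: "push U s q \<in> carrier (localization_at S q)" if q: "q \<in> image_open U" for q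
    using frac_map_stalk[OF image_openD(3)[OF q] sections_stalk[OF s image_openD(4)[OF q]]] q
    by (simp add: push_def image_openD(5)[OF q])
  have local: "\<exists>V. openin (zariski S) V \<and> q \<in> V \<and> V \<subseteq> image_open U \<and>
      (\<exists>a\<in>carrier S. \<exists>b\<in>carrier S. \<forall>r\<in>V. b \<notin> r \<and> push U s r = fraction S (carrier S - r) a b)"
    if q: "q \<in> image_open U" for q
  proof -
    obtain W a b where W: "openin (zariski R) W" "\<psi> ` q \<in> W" "W \<subseteq> U" and ab: "a \<in> carrier R" "b \<in> carrier R"
      and fr: "\<forall>p\<in>W. b \<notin> p \<and> s p = fraction R (carrier R - p) a b"
      using s image_openD(4)[OF q] unfolding spec_sections_def partial_object.simps mem_Collect_eq by metis
    have sub: "image_open W \<subseteq> image_open U" using W(3) by (auto simp: image_open_def)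
    have "\<phi> b \<notin> r \<and> push U s r = fraction S (carrier S - r) (\<phi> a) (\<phi> b)" if r: "r \<in> image_open W" for r
    proof -
      note rD = image_openD[OF r]
      have f: "b \<notin> \<psi> ` r" "s (\<psi> ` r) = fraction R (carrier R - \<psi> ` r) a b" using fr rD(4) by auto
      have "\<phi> b \<notin> r" using in_image_iff[OF rD(6) ab(2)] f(1) rD(5) by simp
      moreover have "push U s r = frac_map (s (\<psi> ` r))" using r sub by (auto simp: push_def)
      ultimately show ?thesis using frac_map_fraction[OF rD(6) ab] f(2) rD(5) by simp
    qed
    moreover have "openin (zariski S) (image_open W)"
      unfolding image_open_def by (rule sym.open_vimage[OF W(1)])
    moreover have "q \<in> image_open W" using W(2) image_openD(1)[OF q] by (simp add: image_open_def)
    ultimately show ?thesis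
      using sub \<phi>.hom_closed[OF ab(1)] \<phi>.hom_closed[OF ab(2)] by blast
  qed
  have "push U s \<in> (\<Pi>\<^sub>E q\<in>image_open U. carrier (localization_at S q))"
    using stalk by (intro PiE_I) (simp_all add: push_def)
  then show ?thesis using local unfolding spec_sections_def by simp
qed

lemma push_hom: "push U \<in> ring_hom (spec_sections R U) (spec_sections S (image_open U))"
proof (rule ring_hom_memI)
  fix s t assume s: "s \<in> carrier (spec_sections R U)" and t: "t \<in> carrier (spec_sections R U)"
  show "push U s \<in> carrier (spec_sections S (image_open U))" by (rule push_closed[OF s])
  have st: "s (\<psi> ` q) \<in> carrier (localization_at R (\<psi> ` q))" "t (\<psi> ` q) \<in> carrier (localization_at R (\<psi> ` q))"
    if "q \<in> image_open U" for q
    using sections_stalk[OF s] sections_stalk[OF t] image_openD(4)[OF that] by blast+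
  show "push U (s \<otimes>\<^bsub>spec_sections R U\<^esub> t) = push U s \<otimes>\<^bsub>spec_sections S (image_open U)\<^esub> push U t"
    unfolding push_def spec_sections_def monoid.simps
    by (rule restrict_ext) (simp add: image_openD frac_map_mult st)
  show "push U (s \<oplus>\<^bsub>spec_sections R U\<^esub> t) = push U s \<oplus>\<^bsub>spec_sections S (image_open U)\<^esub> push U t"
    unfolding push_def spec_sections_def ring.simps
    by (rule restrict_ext) (simp add: image_openD frac_map_add st)
next
  show "push U \<one>\<^bsub>spec_sections R U\<^esub> = \<one>\<^bsub>spec_sections S (image_open U)\<^esub>"
    unfolding push_def spec_sections_def monoid.simps
    by (rule restrict_ext) (simp add: image_openD frac_map_one)
qed

lemma image_open_inverse: "U \<subseteq> {p. primeideal p R} \<Longrightarrow> sym.image_open (image_open U) = U"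
  using prime_image by (auto simp: image_open_def sym.image_open_def image_inverse prime_carrier)

lemma frac_map_inverse: "A \<subseteq> carrier R \<times> carrier R \<Longrightarrow> sym.frac_map (frac_map A) = A"
proof -
  assume A: "A \<subseteq> carrier R \<times> carrier R"
  have "map_prod \<psi> \<psi> (map_prod \<phi> \<phi> x) = x" if "x \<in> A" for x
    using that A by (cases x) (auto simp: \<psi>\<phi>)
  then show ?thesis by (simp add: frac_map_def sym.frac_map_def image_image)
qed

lemma push_inverse:
  assumes U: "U \<subseteq> {p. primeideal p R}" and s: "s \<in> carrier (spec_sections R U)"
  shows "sym.push (image_open U) (push U s) = s"
proof -
  have "sym.push (image_open U) (push U s) = restrict s U"
    unfolding sym.push_def image_open_inverse[OF U]
  proof (rule restrict_ext)
    fix p assume p: "p \<in> U"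
    then have pp: "primeideal p R" "p \<subseteq> carrier R" using U prime_carrier by auto
    have "\<phi> ` p \<in> image_open U"
      using prime_image[OF pp(1)] p by (simp add: image_open_def image_inverse[OF pp(2)])
    then show "sym.frac_map (push U s (\<phi> ` p)) = s p"
      using frac_map_inverse[OF stalk_subset[OF sections_stalk[OF s p]]]
      by (simp add: push_def image_inverse[OF pp(2)])
  qed
  also have "\<dots> = s"
    using s by (intro extensional_restrict) (auto simp: spec_sections_def PiE_def)
  finally show ?thesis .
qed

end

theorem isomorphic_Spec:
  assumes R: "cring R" and S: "cring S" and \<phi>: "\<phi> \<in> alg_iso R \<iota> S \<kappa>"
    and \<iota>: "\<And>c. \<iota> c \<in> carrier R"
  shows "isomorphic_schemes (Spec R \<iota>) (Spec S \<kappa>)"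
proof -
  define \<psi> where "\<psi> = inv_into (carrier R) \<phi>"
  have iso: "\<phi> \<in> ring_iso R S" and const: "\<And>c. \<phi> (\<iota> c) = \<kappa> c" using \<phi> by (auto simp: alg_iso_def)
  have bij: "bij_betw \<phi> (carrier R) (carrier S)" by (rule ring_iso_memE(5)[OF iso])
  interpret inverse_ring_isos R S \<phi> \<psi>
  proof (intro inverse_ring_isos.intro R S)
    show "\<phi> \<in> ring_hom R S" using iso by (simp add: ring_iso_def)
    have "\<psi> \<in> ring_iso S R"
      unfolding \<psi>_def by (rule ring_iso_set_sym[OF cring.axioms(1)[OF R] iso])
    then show "\<psi> \<in> ring_hom S R" by (simp add: ring_iso_def)
    show "a \<in> carrier R \<Longrightarrow> \<psi> (\<phi> a) = a" for a
      unfolding \<psi>_def using bij by (intro inv_into_f_f) (auto simp: bij_betw_def)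
    show "b \<in> carrier S \<Longrightarrow> \<phi> (\<psi> b) = b" for b
      unfolding \<psi>_def using bij by (intro f_inv_into_f) (auto simp: bij_betw_def)
  qed
  interpret sym: inverse_ring_isos S R \<psi> \<phi> by (rule sym)
  have homeo: "homeomorphic_map (zariski R) (zariski S) ((`) \<phi>)"
  proof -
    have "continuous_map (zariski R) (zariski S) ((`) \<phi>)"
      unfolding continuous_map_def topspace_zariski using prime_image open_vimage by auto
    moreover have "continuous_map (zariski S) (zariski R) ((`) \<psi>)"
      unfolding continuous_map_def topspace_zariski using sym.prime_image sym.open_vimage by auto
    ultimately have "homeomorphic_maps (zariski R) (zariski S) ((`) \<phi>) ((`) \<psi>)"
      unfolding homeomorphic_maps_def topspace_zariski
      using image_inverse prime_carrier sym.image_inverse sym.prime_carrier by auto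
    then show ?thesis by (rule homeomorphic_maps_map[THEN iffD1, THEN conjunct1])
  qed
  have sub: "V \<subseteq> {q. primeideal q S}" if "openin (zariski S) V" for V
    using openin_subset[OF that] by (simp add: topspace_zariski)
  have pre: "{p \<in> topspace (zariski R). \<phi> ` p \<in> V} = sym.image_open V" for V
    by (auto simp: topspace_zariski sym.image_open_def)
  have alg: "sym.push V \<in> alg_iso (spec_sections S V) (\<lambda>c. \<lambda>q\<in>V. fraction S (carrier S - q) (\<kappa> c) \<one>\<^bsub>S\<^esub>)
      (spec_sections R (sym.image_open V)) (\<lambda>c. \<lambda>p\<in>sym.image_open V. fraction R (carrier R - p) (\<iota> c) \<one>\<^bsub>R\<^esub>)"
    if V: "openin (zariski S) V" for V
  proof -
    let ?U = "sym.image_open V"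
    have U: "?U \<subseteq> {p. primeideal p R}" by (auto simp: sym.image_open_def)
    have eq: "image_open ?U = V" by (rule sym.image_open_inverse[OF sub[OF V]])
    have "bij_betw (sym.push V) (carrier (spec_sections S V)) (carrier (spec_sections R ?U))"
    proof (rule bij_betw_byWitness)
      show "\<forall>s\<in>carrier (spec_sections S V). push ?U (sym.push V s) = s"
        using sym.push_inverse[OF sub[OF V]] by blast
      show "\<forall>s\<in>carrier (spec_sections R ?U). sym.push V (push ?U s) = s"
        using push_inverse[OF U] unfolding eq by blast
      show "sym.push V ` carrier (spec_sections S V) \<subseteq> carrier (spec_sections R ?U)"
        using sym.push_closed by blast
      show "push ?U ` carrier (spec_sections R ?U) \<subseteq> carrier (spec_sections S V)"
        using push_closed[of _ ?U] unfolding eq by blast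
    qed
    then have "sym.push V \<in> ring_iso (spec_sections S V) (spec_sections R ?U)"
      using sym.push_hom by (simp add: ring_iso_def)
    moreover have "sym.push V (\<lambda>q\<in>V. fraction S (carrier S - q) (\<kappa> c) \<one>\<^bsub>S\<^esub>) =
      (\<lambda>p\<in>?U. fraction R (carrier R - p) (\<iota> c) \<one>\<^bsub>R\<^esub>)" for c
      unfolding sym.push_def
    proof (rule restrict_ext)
      fix p assume p: "p \<in> ?U"
      note pD = sym.image_openD[OF p]
      have "\<kappa> c \<in> carrier S" "\<psi> (\<kappa> c) = \<iota> c"
        using \<iota>[of c] \<phi>.hom_closed[OF \<iota>[of c]] \<psi>\<phi> by (simp_all flip: const)
      then show "sym.frac_map ((\<lambda>q\<in>V. fraction S (carrier S - q) (\<kappa> c) \<one>\<^bsub>S\<^esub>) (\<phi> ` p)) =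
          fraction R (carrier R - p) (\<iota> c) \<one>\<^bsub>R\<^esub>"
        using pD(4,5) sym.frac_map_fraction[OF pD(6), of "\<kappa> c" "\<one>\<^bsub>S\<^esub>"] by simp
    qed
    ultimately show ?thesis by (simp add: alg_iso_def)
  qed
  have restr: "restrict (sym.push V t) (sym.image_open W) = sym.push W (restrict t W)"
    if "W \<subseteq> V" for V W t
  proof (rule ext)
    fix p
    have "p \<in> sym.image_open V" if "p \<in> sym.image_open W"
      using that \<open>W \<subseteq> V\<close> by (auto simp: sym.image_open_def)
    then show "restrict (sym.push V t) (sym.image_open W) p = sym.push W (restrict t W) p"
      by (auto simp: sym.push_def sym.image_open_def)
  qed
  have "ringed_space_iso (Spec R \<iota>) (Spec S \<kappa>) ((`) \<phi>) sym.push"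
    unfolding ringed_space_iso_def Spec_def ringed_space.simps Let_def pre
    using homeo alg restr by blast
  then show ?thesis unfolding isomorphic_schemes_def by blast
qed

section \<open>Renaming indeterminates\<close>

text \<open>
  For a bijection \<open>g\<close> of the indices, \<open>rename g\<close> is the substitution of $x_{g(i)}$ for every $x_i$:
  the coefficient of a term in \<open>rename g f\<close> is that of the term with exponents permuted by \<open>g\<close> in \<open>f\<close>.
\<close>

definition rename :: "(nat \<Rightarrow> nat) \<Rightarrow> 'k::field mpoly \<Rightarrow> 'k mpoly" where
  "rename g f = Poly_Mapping.map_key (Poly_Mapping.map_key g) f"

lemma map_key_bij:
  assumes "bij g"
  shows "(Poly_Mapping.map_key g t) \<cdot> i = (t :: pterm) \<cdot> (g i)"
    and "Poly_Mapping.map_key (inv_into UNIV g) (Poly_Mapping.map_key g t) = t"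
    and "Poly_Mapping.map_key g (Poly_Mapping.map_key (inv_into UNIV g) t) = t"
proof -
  have g: "inj g" "inj (inv_into UNIV g)" using assms by (auto simp: bij_is_inj bij_imp_bij_inv)
  show l: "(Poly_Mapping.map_key g t) \<cdot> i = t \<cdot> (g i)"
    by (simp add: map_key.rep_eq[OF g(1)])
  have li: "(Poly_Mapping.map_key (inv_into UNIV g) t) \<cdot> i = t \<cdot> (inv_into UNIV g i)" for t :: pterm and i
    by (simp add: map_key.rep_eq[OF g(2)])
  have lg: "(Poly_Mapping.map_key g t) \<cdot> i = t \<cdot> (g i)" for t :: pterm and i
    by (simp add: map_key.rep_eq[OF g(1)])
  show "Poly_Mapping.map_key (inv_into UNIV g) (Poly_Mapping.map_key g t) = t"
    by (rule poly_mapping_eqI) (simp add: li lg surj_f_inv_f bij_is_surj[OF assms])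
  show "Poly_Mapping.map_key g (Poly_Mapping.map_key (inv_into UNIV g) t) = t"
    by (rule poly_mapping_eqI) (simp add: li lg inv_f_f g)
qed

lemma inj_map_key: "bij g \<Longrightarrow> inj (Poly_Mapping.map_key g :: pterm \<Rightarrow> pterm)"
  by (rule inj_on_inverseI[where g = "Poly_Mapping.map_key (inv_into UNIV g)"]) (simp add: map_key_bij)

lemma lookup_rename: "bij g \<Longrightarrow> rename g f \<cdot> t = f \<cdot> (Poly_Mapping.map_key g t)"
  by (simp add: rename_def map_key.rep_eq[OF inj_map_key])

lemma rename_add: "bij g \<Longrightarrow> rename g (f + h) = rename g f + rename g h"
  by (rule poly_mapping_eqI) (simp add: lookup_rename lookup_add)

lemma rename_sum: "bij g \<Longrightarrow> rename g (sum f A) = (\<Sum>x\<in>A. rename g (f x))"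
  by (rule poly_mapping_eqI) (simp add: lookup_rename lookup_sum)

lemma rename_single:
  assumes "bij g"
  shows "rename g (Poly_Mapping.single t c) = Poly_Mapping.single (Poly_Mapping.map_key (inv_into UNIV g) t) c"
proof (rule poly_mapping_eqI)
  fix u
  have "t = Poly_Mapping.map_key g u \<longleftrightarrow> Poly_Mapping.map_key (inv_into UNIV g) t = u"
    using map_key_bij(2,3)[OF assms] by metis
  then show "rename g (Poly_Mapping.single t c) \<cdot> u = Poly_Mapping.single (Poly_Mapping.map_key (inv_into UNIV g) t) c \<cdot> u"
    by (simp add: lookup_rename[OF assms] lookup_single)
qed

lemma rename_mult:
  assumes g: "bij g"
  shows "rename g (f * h) = rename g f * rename g h"
proof -
  let ?m = "Poly_Mapping.map_key (inv_into UNIV g) :: pterm \<Rightarrow> pterm"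
  have add: "?m (s + t) = ?m s + ?m t" for s t
    by (rule map_key_plus) (simp add: bij_is_inj bij_imp_bij_inv g)
  have sf: "f = (\<Sum>s\<in>Poly_Mapping.keys f. Poly_Mapping.single s (f \<cdot> s))" for f :: "'a mpoly"
    by (rule sum_single_lookup[symmetric])
  have "rename g (f * h) = rename g ((\<Sum>s\<in>Poly_Mapping.keys f. Poly_Mapping.single s (f \<cdot> s)) *
      (\<Sum>t\<in>Poly_Mapping.keys h. Poly_Mapping.single t (h \<cdot> t)))"
    by (simp add: sum_single_lookup)
  also have "\<dots> = (\<Sum>s\<in>Poly_Mapping.keys f. \<Sum>t\<in>Poly_Mapping.keys h.
      Poly_Mapping.single (?m s) (f \<cdot> s) * Poly_Mapping.single (?m t) (h \<cdot> t))"
    by (simp add: sum_product rename_sum[OF g] rename_single[OF g] mult_single add)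
  also have "\<dots> = rename g (\<Sum>s\<in>Poly_Mapping.keys f. Poly_Mapping.single s (f \<cdot> s)) *
      rename g (\<Sum>t\<in>Poly_Mapping.keys h. Poly_Mapping.single t (h \<cdot> t))"
    by (simp add: sum_product rename_sum[OF g] rename_single[OF g])
  also have "\<dots> = rename g f * rename g h" by (simp add: sum_single_lookup)
  finally show ?thesis .
qed

lemma rename_cst:
  assumes "bij g"
  shows "rename g (cst c) = cst c"
proof -
  have "Poly_Mapping.map_key (inv_into UNIV g) (0 :: pterm) = 0"
    by (rule map_key_zero) (simp add: bij_is_inj bij_imp_bij_inv assms)
  then show ?thesis by (simp add: cst_def rename_single[OF assms])
qed

lemma rename_inverse:
  assumes "bij g"
  shows "rename (inv_into UNIV g) (rename g f) = f" "rename g (rename (inv_into UNIV g) f) = f"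
  by (rule poly_mapping_eqI, simp add: lookup_rename assms bij_imp_bij_inv map_key_bij)+

lemma rename_closed:
  assumes g: "bij g" and f: "f \<in> carrier (poly_ring V)"
  shows "rename g f \<in> carrier (poly_ring (g ` V))"
proof -
  have "Poly_Mapping.keys t \<subseteq> g ` V" if t: "t \<in> Poly_Mapping.keys (rename g f)" for t
  proof
    fix i assume i: "i \<in> Poly_Mapping.keys t"
    have ij: "g (inv_into UNIV g i) = i" by (rule surj_f_inv_f[OF bij_is_surj[OF g]])
    have "Poly_Mapping.map_key g t \<in> Poly_Mapping.keys f"
      using t by (simp add: in_keys_iff lookup_rename[OF g])
    then have "Poly_Mapping.keys (Poly_Mapping.map_key g t) \<subseteq> V"
      using f by (auto simp: carrier_poly_ring terms_def)
    moreover have "inv_into UNIV g i \<in> Poly_Mapping.keys (Poly_Mapping.map_key g t)"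
      using i by (simp add: in_keys_iff map_key_bij(1)[OF g] ij)
    ultimately show "i \<in> g ` V" using ij by (metis imageI subsetD)
  qed
  then show ?thesis by (auto simp: carrier_poly_ring terms_def)
qed

lemma rename_alg_iso:
  assumes g: "bij g"
  shows "rename g \<in> alg_iso (poly_ring V :: 'k::field mpoly ring) cst (poly_ring (g ` V)) cst"
proof -
  have "bij_betw (rename g) (carrier (poly_ring V)) (carrier (poly_ring (g ` V)) :: 'k mpoly set)"
  proof (rule bij_betw_byWitness)
    have V: "inv_into UNIV g ` g ` V = V" using bij_is_inj[OF g] by simp
    show "rename g ` carrier (poly_ring V) \<subseteq> carrier (poly_ring (g ` V))"
      using rename_closed[OF g] by blast
    show "rename (inv_into UNIV g) ` carrier (poly_ring (g ` V)) \<subseteq> carrier (poly_ring V)"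
      using rename_closed[OF bij_imp_bij_inv[OF g], of _ "g ` V"] V by auto
  qed (simp_all add: rename_inverse[OF g])
  moreover have "rename g \<in> ring_hom (poly_ring V) (poly_ring (g ` V) :: 'k mpoly ring)"
    using rename_cst[OF g, of 1]
    by (intro ring_hom_memI) (simp_all add: rename_closed[OF g] rename_add[OF g] rename_mult[OF g] cst_simps)
  ultimately show ?thesis by (simp add: alg_iso_def ring_iso_def rename_cst[OF g])
qed

lemma ex_bij_image_eq:
  fixes V W :: "nat set"
  assumes "finite V" "finite W" "card V = card W"
  shows "\<exists>g. bij g \<and> g ` V = W"
proof -
  obtain f where f: "bij_betw f V W" using finite_same_card_bij[OF assms] by blast
  have "card (W - V) = card (V - W)"
    using assms by (simp add: card_le_sym_Diff card_Diff_subset_Int Int_commute)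
  then obtain f' where f': "bij_betw f' (W - V) (V - W)"
    using finite_same_card_bij[of "W - V" "V - W"] assms by auto
  define g where "g x = (if x \<in> V then f x else if x \<in> W then f' x else x)" for x
  have 1: "bij_betw g V W" using f by (rule bij_betw_cong[THEN iffD1, rotated]) (simp add: g_def)
  have 2: "bij_betw g (W - V) (V - W)" using f' by (rule bij_betw_cong[THEN iffD1, rotated]) (simp add: g_def)
  have 3: "bij_betw g (- (V \<union> W)) (- (V \<union> W))"
    using bij_betw_id by (rule bij_betw_cong[THEN iffD1, rotated]) (simp add: g_def)
  have "bij_betw g (V \<union> (W - V)) (W \<union> (V - W))" by (rule bij_betw_combine[OF 1 2]) blast
  then have "bij_betw g ((V \<union> (W - V)) \<union> - (V \<union> W)) ((W \<union> (V - W)) \<union> - (V \<union> W))"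
    by (rule bij_betw_combine[OF _ 3]) blast
  moreover have "(V \<union> (W - V)) \<union> - (V \<union> W) = UNIV" "(W \<union> (V - W)) \<union> - (V \<union> W) = UNIV" by blast+
  ultimately have "bij g" by simp
  then show ?thesis using 1 by (auto simp: bij_betw_def)
qed

section \<open>The re-embedding\<close>

lemma alg_iso_trans:
  assumes "f \<in> alg_iso R \<iota> S \<kappa>" "g \<in> alg_iso S \<kappa> T \<mu>"
  shows "g \<circ> f \<in> alg_iso R \<iota> T \<mu>"
  using assms ring_iso_set_trans by (auto simp: alg_iso_def)

lemma alg_iso_inv:
  assumes "ring R" "f \<in> alg_iso R \<iota> S \<kappa>" "\<And>c. \<iota> c \<in> carrier R"
  shows "inv_into (carrier R) f \<in> alg_iso S \<kappa> R \<iota>"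
proof -
  have f: "f \<in> ring_iso R S" "\<And>c. f (\<iota> c) = \<kappa> c" using assms(2) by (auto simp: alg_iso_def)
  have "inj_on f (carrier R)" using ring_iso_memE(5)[OF f(1)] by (simp add: bij_betw_def)
  then have "inv_into (carrier R) f (\<kappa> c) = \<iota> c" for c
    using assms(3) by (simp flip: f(2))
  then show ?thesis using ring_iso_set_sym[OF assms(1) f(1)] by (simp add: alg_iso_def)
qed

lemma alg_iso_cong:
  assumes "f \<in> alg_iso R \<iota> S \<kappa>" "ring R" "\<And>c. \<iota> c \<in> carrier R" "\<And>r. r \<in> carrier R \<Longrightarrow> f r = g r"
  shows "g \<in> alg_iso R \<iota> S \<kappa>"
proof -
  have "f \<in> ring_iso R S" using assms(1) by (simp add: alg_iso_def)
  then have "g \<in> ring_iso R S" using assms(4) by (rule ring.ring_iso_restrict[OF assms(2)])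
  moreover have "g (\<iota> c) = \<kappa> c" for c using assms(1) assms(4)[OF assms(3)[of c]] by (simp add: alg_iso_def)
  ultimately show ?thesis by (simp add: alg_iso_def)
qed

lemma coset_eq_iff:
  fixes J :: "'k::field mpoly set"
  assumes "ideal J (poly_ring W)" "f \<in> carrier (poly_ring W)" "g \<in> carrier (poly_ring W)"
  shows "J +>\<^bsub>poly_ring W\<^esub> f = J +>\<^bsub>poly_ring W\<^esub> g \<longleftrightarrow> f - g \<in> J"
  using ring.quotient_eq_iff_same_a_r_cos[OF poly_ring_ring assms] poly_ring_minus[OF assms(2,3)] by simp

lemma quot_carrierE:
  assumes "X \<in> carrier (R Quot J)"
  obtains f where "f \<in> carrier R" "X = J +>\<^bsub>R\<^esub> f"
  using assms unfolding FactRing_def A_RCOSETS_def' partial_object.simps by blast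

context separated_ideal
begin

text \<open>\<open>\<delta>\<close> and \<open>\<beta>\<close> take residue classes modulo \<open>J\<close> and modulo the zero ideal of $\widehat{P}$.\<close>

abbreviation "\<delta> \<equiv> \<lambda>r. J +>\<^bsub>P_ring n\<^esub> r"
abbreviation "\<beta> \<equiv> \<lambda>r :: 'k mpoly. {0} +>\<^bsub>P_hat n Z\<^esub> r"

lemma zero_ideal: "ideal {0} (P_hat n Z :: 'k mpoly ring)"
  using ring.zeroideal[OF poly_ring_ring[where V = V and 'k = 'k]] by simp

lemma quot_hom: "\<delta> \<in> ring_hom (P_ring n) (P_ring n Quot J)"
  by (rule ideal.rcos_ring_hom[OF J])

lemma coset_nf: "f \<in> P \<Longrightarrow> \<delta> (nf f) = \<delta> f"
  using nf[of f] P'_subset_P JD(5)[of "f - nf f"] by (subst coset_eq_iff[OF J]) auto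

text \<open>Since $P = J \oplus \widehat{P}$, the inclusion induces $\widehat{P} \cong P/J$.\<close>

lemma coset_alg_iso: "\<delta> \<in> alg_iso (P_hat n Z) cst (P_ring n Quot J) (quot_const (P_ring n) J)"
proof -
  have hom: "\<delta> \<in> ring_hom (P_hat n Z) (P_ring n Quot J)"
    using ring_hom_memE[OF quot_hom] P'_subset_P by (intro ring_hom_memI) (simp_all add: subset_iff)
  have "bij_betw \<delta> P' (carrier (P_ring n Quot J))"
    unfolding bij_betw_def
  proof
    show "inj_on \<delta> P'"
    proof (rule inj_onI)
      fix r r' assume r: "r \<in> P'" "r' \<in> P'" "\<delta> r = \<delta> r'"
      then have "r - r' \<in> J" using coset_eq_iff[OF J, of r r'] P'_subset_P by blast
      moreover have "r - r' \<in> P'" using r by (intro poly_ring_closed)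
      ultimately have "r - r' = 0" using J_Int_P' by blast
      then show "r = r'" by simp
    qed
    show "\<delta> ` P' = carrier (P_ring n Quot J)"
    proof
      show "\<delta> ` P' \<subseteq> carrier (P_ring n Quot J)" using ring_hom_memE(1)[OF hom] by blast
      show "carrier (P_ring n Quot J) \<subseteq> \<delta> ` P'"
      proof
        fix X assume "X \<in> carrier (P_ring n Quot J)"
        then obtain f where "f \<in> P" "X = \<delta> f" by (rule quot_carrierE)
        then show "X \<in> \<delta> ` P'" using coset_nf[of f] nf(1)[of f] by (metis imageI)
      qed
    qed
  qed
  with hom show ?thesis by (simp add: alg_iso_def ring_iso_def)
qed

lemma zero_coset_alg_iso:
  "\<beta> \<in> alg_iso (P_hat n Z) cst (P_hat n Z Quot {0}) (quot_const (P_hat n Z) {0})"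
proof -
  have "bij_betw \<beta> P' (carrier (P_hat n Z Quot {0}))"
    unfolding bij_betw_def
  proof
    show "inj_on \<beta> P'"
    proof (rule inj_onI)
      fix r r' assume "r \<in> P'" "r' \<in> P'" "\<beta> r = \<beta> r'"
      then show "r = r'" using coset_eq_iff[OF zero_ideal, of r r'] by simp
    qed
    show "\<beta> ` P' = carrier (P_hat n Z Quot {0})"
      unfolding FactRing_def A_RCOSETS_def' partial_object.simps by blast
  qed
  then show ?thesis
    using ideal.rcos_ring_hom[OF zero_ideal] by (simp add: alg_iso_def ring_iso_def)
qed

lemma inv_coset: "f \<in> P \<Longrightarrow> inv_into P' \<delta> (\<delta> f) = nf f"
proof -
  assume f: "f \<in> P"
  have "bij_betw \<delta> P' (carrier (P_ring n Quot J))"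
    using coset_alg_iso ring_iso_memE(5) by (auto simp: alg_iso_def)
  then have "inv_into P' \<delta> (\<delta> (nf f)) = nf f"
    using nf(1)[OF f] by (intro inv_into_f_f) (simp_all add: bij_betw_def)
  then show ?thesis by (simp add: coset_nf[OF f])
qed

lemma inv_coset_alg_iso:
  "inv_into P' \<delta> \<in> alg_iso (P_ring n Quot J) (quot_const (P_ring n) J) (P_hat n Z) cst"
  using poly_ring_ring coset_alg_iso by (rule alg_iso_inv) simp

lemma coset_closed: "f \<in> P \<Longrightarrow> \<delta> f \<in> carrier (P_ring n Quot J)"
  by (rule ring_hom_memE(1)[OF quot_hom])

text \<open>The re-embedding: the inverse of the isomorphism \<open>\<delta>\<close>, read modulo the zero ideal.\<close>

definition \<Phi> where
  "\<Phi> = (\<lambda>X\<in>carrier (P_ring n Quot J). \<beta> (inv_into P' \<delta> X))"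

lemma \<Phi>_coset: "f \<in> P \<Longrightarrow> \<Phi> (\<delta> f) = \<beta> (nf f)"
  by (simp add: \<Phi>_def coset_closed inv_coset)

lemma elim_eq: "elim_ideal n Z J = {0}"
  by (rule J_Int_P')

lemma quot_ring: "ring (P_ring n Quot J)"
  by (rule ideal.quotient_is_ring[OF J])

lemma is_reembedding_\<Phi>: "is_reembedding n Z J \<sigma> \<Phi>"
  unfolding is_reembedding_def elim_eq
proof (intro conjI ballI)
  show "\<Phi> \<in> extensional (carrier (P_ring n Quot J))" by (simp add: \<Phi>_def)
  have "\<beta> \<circ> inv_into P' \<delta> \<in> alg_iso (P_ring n Quot J) (quot_const (P_ring n) J)
      (P_hat n Z Quot {0}) (quot_const (P_hat n Z) {0})"
    using inv_coset_alg_iso zero_coset_alg_iso by (rule alg_iso_trans)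
  then show "\<Phi> \<in> alg_iso (P_ring n Quot J) (quot_const (P_ring n) J)
      (P_hat n Z Quot {0}) (quot_const (P_hat n Z) {0})"
    using quot_ring by (rule alg_iso_cong) (simp_all add: \<Phi>_def coset_closed)
  show "\<Phi> (\<delta> (var i)) = \<beta> (var i)" if "i \<in> V" for i
  proof -
    have "(var i :: 'k mpoly) \<in> P'" using that by (simp add: var_in_carrier)
    then show ?thesis using P'_subset_P \<Phi>_coset[of "var i"] by (simp add: nf_id subset_iff)
  qed
  show "\<Phi> (\<delta> (var z)) = \<beta> (sep_tail n Z J \<sigma> z)" if "z \<in> set Z" for z
    using \<Phi>_coset[OF var_in_P[OF that]] by (simp add: sep_tail_eq[OF that])
qed

text \<open>An algebra homomorphism on $P/J$ is determined by its values on the indeterminates.\<close>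

lemma is_reembedding_unique:
  assumes "is_reembedding n Z J \<sigma> \<Psi>"
  shows "\<Psi> = \<Phi>"
proof -
  have ext: "\<Psi> \<in> extensional (carrier (P_ring n Quot J))"
    and alg: "\<Psi> \<in> alg_iso (P_ring n Quot J) (quot_const (P_ring n) J)
      (P_hat n Z Quot {0}) (quot_const (P_hat n Z) {0})"
    and V: "\<And>i. i \<in> V \<Longrightarrow> \<Psi> (\<delta> (var i)) = \<beta> (var i)"
    and Z': "\<And>z. z \<in> set Z \<Longrightarrow> \<Psi> (\<delta> (var z)) = \<beta> (sep_tail n Z J \<sigma> z)"
    using assms unfolding is_reembedding_def elim_eq by blast+
  have \<Psi>: "\<Psi> \<in> ring_hom (P_ring n Quot J) (P_hat n Z Quot {0})" "\<And>c. \<Psi> (\<delta> (cst c)) = \<beta> (cst c)"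
    using alg by (auto simp: alg_iso_def ring_iso_def)
  have \<Phi>: "\<Phi> \<in> ring_hom (P_ring n Quot J) (P_hat n Z Quot {0})" "\<And>c. \<Phi> (\<delta> (cst c)) = \<beta> (cst c)"
    using is_reembedding_\<Phi> unfolding is_reembedding_def elim_eq by (auto simp: alg_iso_def ring_iso_def)
  have "\<Psi> (\<delta> f) = \<Phi> (\<delta> f)" if "f \<in> P" for f
    using that
  proof (induction f rule: poly_ring_induct)
    case (cst c)
    then show ?case using \<Psi>(2) \<Phi>(2) by simp
  next
    case (var i)
    have \<Phi>V: "\<And>i. i \<in> V \<Longrightarrow> \<Phi> (\<delta> (var i)) = \<beta> (var i)"
      and \<Phi>Z: "\<And>z. z \<in> set Z \<Longrightarrow> \<Phi> (\<delta> (var z)) = \<beta> (sep_tail n Z J \<sigma> z)"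
      using is_reembedding_\<Phi> unfolding is_reembedding_def elim_eq by blast+
    show ?case
    proof (cases "i \<in> set Z")
      case True
      show ?thesis unfolding Z'[OF True] \<Phi>Z[OF True] ..
    next
      case False
      with var have i: "i \<in> V" by blast
      show ?thesis unfolding V[OF i] \<Phi>V[OF i] ..
    qed
  next
    case (add f g)
    have "\<delta> (f + g) = \<delta> f \<oplus>\<^bsub>P_ring n Quot J\<^esub> \<delta> g"
      using ring_hom_memE(3)[OF quot_hom add(1,2)] by simp
    then show ?case
      using add(3,4) ring_hom_memE(3)[OF \<Psi>(1) coset_closed[OF add(1)] coset_closed[OF add(2)]]
        ring_hom_memE(3)[OF \<Phi>(1) coset_closed[OF add(1)] coset_closed[OF add(2)]] by simp
  next
    case (mult f g)
    have "\<delta> (f * g) = \<delta> f \<otimes>\<^bsub>P_ring n Quot J\<^esub> \<delta> g"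
      using ring_hom_memE(2)[OF quot_hom mult(1,2)] by simp
    then show ?case
      using mult(3,4) ring_hom_memE(2)[OF \<Psi>(1) coset_closed[OF mult(1)] coset_closed[OF mult(2)]]
        ring_hom_memE(2)[OF \<Phi>(1) coset_closed[OF mult(1)] coset_closed[OF mult(2)]] by simp
  qed
  then have "\<Psi> X = \<Phi> X" if "X \<in> carrier (P_ring n Quot J)" for X
    using that by (elim quot_carrierE) simp
  then show ?thesis
    using ext by (intro extensionalityI[of _ "carrier (P_ring n Quot J)"]) (simp_all add: \<Phi>_def)
qed

theorem reembedding:
  "is_reembedding n Z J \<sigma> (reembedding n Z J \<sigma>)"
  "inv_into P' (\<lambda>f. elim_ideal n Z J +>\<^bsub>P_hat n Z\<^esub> f) \<circ> reembedding n Z J \<sigma>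
    \<in> alg_iso (P_ring n Quot J) (quot_const (P_ring n) J) (P_hat n Z) cst"
proof -
  have eq: "reembedding n Z J \<sigma> = \<Phi>"
    unfolding reembedding_def using is_reembedding_\<Phi> is_reembedding_unique by (rule the_equality)
  then show r: "is_reembedding n Z J \<sigma> (reembedding n Z J \<sigma>)" using is_reembedding_\<Phi> by simp
  have "inv_into P' \<beta> \<in> alg_iso (P_hat n Z Quot {0}) (quot_const (P_hat n Z) {0}) (P_hat n Z) cst"
    using poly_ring_ring zero_coset_alg_iso by (rule alg_iso_inv) simp
  moreover have "reembedding n Z J \<sigma> \<in> alg_iso (P_ring n Quot J) (quot_const (P_ring n) J)
      (P_hat n Z Quot {0}) (quot_const (P_hat n Z) {0})"
    using r unfolding is_reembedding_def elim_eq by blast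
  ultimately show "inv_into P' (\<lambda>f. elim_ideal n Z J +>\<^bsub>P_hat n Z\<^esub> f) \<circ> reembedding n Z J \<sigma>
    \<in> alg_iso (P_ring n Quot J) (quot_const (P_ring n) J) (P_hat n Z) cst"
    unfolding elim_eq by (rule alg_iso_trans[rotated])
qed

theorem Spec_affine_space:
  "isomorphic_schemes (Spec (P_ring n Quot J) (quot_const (P_ring n) J)) (affine_space (card V))"
proof -
  obtain g where g: "bij g" "g ` V = {1..card V}"
    using ex_bij_image_eq[of V "{1..card V}"] by auto
  have "rename g \<circ> inv_into P' \<delta> \<in> alg_iso (P_ring n Quot J) (quot_const (P_ring n) J)
      (poly_ring {1..card V}) cst"
    using inv_coset_alg_iso rename_alg_iso[OF g(1), of V, unfolded g(2)] by (rule alg_iso_trans)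
  then show ?thesis
    unfolding affine_space_def
    by (rule isomorphic_Spec[OF ideal.quotient_is_cring[OF J poly_ring_cring] poly_ring_cring])
      (simp add: coset_closed)
qed

end

section \<open>Regular separating ideals\<close>

text \<open>The ideal generated by the $f_i$ witnessing that \<open>\<sigma>\<close> is $Z$-separating.\<close>

lemma separating_term_orderingE:
  assumes I: "ideal I (P_ring n)" and IM: "I \<subseteq> max_ideal n" and Z: "set Z \<subseteq> {1..n}"
    and sep: "separating_term_ordering n Z I \<sigma>"
  obtains J where "separated_subideal n Z J \<sigma> I"
proof -
  obtain fs where fs: "term_ordering n \<sigma>" "set fs \<subseteq> I - {0}"
    "LT_ideal n \<sigma> (Idl\<^bsub>P_ring n\<^esub> (set fs)) = Idl\<^bsub>P_ring n\<^esub> (var ` set Z)"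
    using sep by (auto simp: separating_term_ordering_def)
  have sub: "set fs \<subseteq> I" using fs(2) by blast
  have "ideal (Idl\<^bsub>P_ring n\<^esub> (set fs)) (P_ring n)"
    using sub ideal_poly_ringD(1)[OF I] by (intro ring.genideal_ideal[OF poly_ring_ring]) blast
  moreover have "Idl\<^bsub>P_ring n\<^esub> (set fs) \<subseteq> I"
    by (rule ring.genideal_minimal[OF poly_ring_ring I sub])
  ultimately have "separated_subideal n Z (Idl\<^bsub>P_ring n\<^esub> (set fs)) \<sigma> I"
    using fs Z I IM
    by (intro separated_subideal.intro separated_ideal.intro separated_subideal_axioms.intro)
  then show thesis by (rule that)
qed

theorem proposition6p7:
  fixes n s :: nat and Z :: "nat list" and I :: "'k::field mpoly set"
  assumes "distinct Z" and "set Z \<subseteq> {1..n}" and "length Z = s"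
    and "ideal I (P_ring n)" and "I \<subseteq> max_ideal n"
    and "separating n Z I"
    and "regular_local_ring (local_ring_at_origin n I)"
    and "vector_space.dim poly_scale (Lin I) = s"
  shows "(\<exists>d. krull_dim (local_ring_at_origin n I) = enat d \<and> int s = int n - int d) \<and>
    elim_ideal n Z I = {0} \<and>
    (\<forall>\<sigma>. separating_term_ordering n Z I \<sigma> \<longrightarrow>
       is_reembedding n Z I \<sigma> (reembedding n Z I \<sigma>) \<and>
       inv_into (carrier (P_hat n Z)) (\<lambda>f. elim_ideal n Z I +>\<^bsub>P_hat n Z\<^esub> f) \<circ> reembedding n Z I \<sigma>
         \<in> alg_iso (P_ring n Quot I) (quot_const (P_ring n) I) (P_hat n Z) cst) \<and>
    isomorphic_schemes (Spec (P_ring n Quot I) (quot_const (P_ring n) I)) (affine_space (n - s))"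
proof -
  have card: "card (set Z) = s" using assms(1,3) by (simp add: distinct_card)
  have cardV: "card ({1..n} - set Z) = n - s" using assms(2) card by (simp add: card_Diff_subset)
  have "s \<le> n" using card_mono[OF _ assms(2)] card by simp
  obtain \<sigma>0 where \<sigma>0: "separating_term_ordering n Z I \<sigma>0" using assms(6) by (auto simp: separating_def)
  obtain J0 where "separated_subideal n Z J0 \<sigma>0 I"
    using assms(4,5,2) \<sigma>0 by (rule separating_term_orderingE)
  then interpret J0: separated_subideal n Z J0 \<sigma>0 I .
  have dim: "krull_dim (local_ring_at_origin n I) = enat (n - s)" and elim: "elim_ideal n Z I = {0}"
    using J0.regular_local_ring_origin[OF assms(7)] assms(8) card cardV by simp_all
  \<comment> \<open>The decomposition of \<open>P\<close> gives $I = J + (I \cap \widehat{P})$, and the second summand vanishes.\<close>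
  have sep: "separated_ideal n Z I \<sigma>" if \<sigma>: "separating_term_ordering n Z I \<sigma>" for \<sigma>
  proof -
    obtain J where "separated_subideal n Z J \<sigma> I"
      using assms(4,5,2) \<sigma> by (rule separating_term_orderingE)
    then interpret J: separated_subideal n Z J \<sigma> I .
    have "f \<in> J" if f: "f \<in> I" for f
    proof -
      have fP: "f \<in> J.P" using f J.ID(1) by blast
      have "f - J.nf f \<in> I" using J.nf(2)[OF fP] J.JI by blast
      with f have "f - (f - J.nf f) \<in> I" by (rule J.ID(4))
      then have "J.nf f \<in> elim_ideal n Z I" using J.nf(1)[OF fP] by simp
      then have "J.nf f = 0" using elim by blast
      then show ?thesis using J.nf_eq_0_iff[OF fP] by simp
    qed
    then have "J = I" using J.JI by blast
    then show ?thesis using J.separated_ideal_axioms by simp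
  qed
  have "int s = int n - int (n - s)" using \<open>s \<le> n\<close> by simp
  moreover have "isomorphic_schemes (Spec (P_ring n Quot I) (quot_const (P_ring n) I)) (affine_space (n - s))"
    using separated_ideal.Spec_affine_space[OF sep[OF \<sigma>0]] unfolding cardV .
  ultimately show ?thesis
    using dim elim separated_ideal.reembedding[OF sep] by blast
qed

end
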